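(* Let $H\le S_n$ be a primitive subgroup with $H\ne A_n,S_n$. Then $H$ is indistinguishable. Moreover, there is an absolute constant $\varepsilon>0$ such that $$D_H\le n^{-\varepsilon\sqrt n}.$$
   Context: $S_n$ is the symmetric group on $\{1,\dots,n\}$ and $A_n$ the alternating group. For a finite group $G$, $\mathrm{Irr}(G)$ is the set of complex irreducible representations of $G$ up to equivalence; for $\rho\in \mathrm{Irr}(G)$, $d_\rho$ is its dimension and $\chi_\rho$ its character. For $H\le G$, $$D_H=\frac{1}{|G|}\sum_{\rho\in \mathrm{Irr}(G)} d_\rho\Big|\sum_{h\in H,\,h\ne 1}\chi_\rho(h)\Big|;$$ here $G=S_n$. A permutation group is primitive if it is transitive and does not preserve a non-trivial block system. A subgroup $H\le G$ is called distinguishable if $D_H\ge (\log|G|)^{-c}$ for some constant $c$, and indistinguishable otherwise; this is an asymptotic notion, where $G$ ranges over an infinite family of groups and $c$ does not depend on $G$. For $G=S_n$ distinguishability is equivalent to $D_H\ge n^{-c}$ for some constant $c$.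
   Formalization: The bound D_H ≤ n^{-ε√n} is stated for all n ≥ n0 with an absolute n0, not for every n: it fails at n = 5 for H = AGL(1,5), where D_H = 188/120 > 1. *)

theory Defs
  imports
    Complex_Main
    "HOL-Algebra.Sym_Groups"
    "HOL-Library.Disjoint_Sets"
    "Jordan_Normal_Form.VS_Connect"
begin

definition GL :: "nat \<Rightarrow> complex mat monoid" where
  "GL d = units_of (ring_mat TYPE(complex) d ())"

definition representation :: "('a, 'b) monoid_scheme \<Rightarrow> nat \<Rightarrow> ('a \<Rightarrow> complex mat) \<Rightarrow> bool" where
  "representation G d \<rho> \<longleftrightarrow> \<rho> \<in> hom G (GL d)"

definition invariant_subspace ::
  "('a, 'b) monoid_scheme \<Rightarrow> nat \<Rightarrow> ('a \<Rightarrow> complex mat) \<Rightarrow> complex vec set \<Rightarrow> bool" where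
  "invariant_subspace G d \<rho> W \<longleftrightarrow>
     VectorSpace.subspace class_ring W (module_vec TYPE(complex) d) \<and>
     (\<forall>g\<in>carrier G. \<forall>w\<in>W. \<rho> g *\<^sub>v w \<in> W)"

definition irreducible_representation ::
  "('a, 'b) monoid_scheme \<Rightarrow> nat \<Rightarrow> ('a \<Rightarrow> complex mat) \<Rightarrow> bool" where
  "irreducible_representation G d \<rho> \<longleftrightarrow>
     representation G d \<rho> \<and> d > 0 \<and>
     (\<forall>W. invariant_subspace G d \<rho> W \<longrightarrow> W = {0\<^sub>v d} \<or> W = carrier_vec d)"

definition degree_rep :: "('a, 'b) monoid_scheme \<Rightarrow> ('a \<Rightarrow> complex mat) \<Rightarrow> nat" where
  "degree_rep G \<rho> = dim_row (\<rho> \<one>\<^bsub>G\<^esub>)"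

definition character_rep :: "('a \<Rightarrow> complex mat) \<Rightarrow> 'a \<Rightarrow> complex" where
  "character_rep \<rho> g = (\<Sum>i<dim_row (\<rho> g). \<rho> g $$ (i, i))"

definition irreps :: "('a, 'b) monoid_scheme \<Rightarrow> ('a \<Rightarrow> complex mat) set" where
  "irreps G = {\<rho>. \<exists>d. irreducible_representation G d \<rho>}"

text \<open>One change of basis conjugates all the matrices simultaneously. Representations that differ
  only outside the carrier are identified as well.\<close>

definition rep_equiv :: "('a, 'b) monoid_scheme \<Rightarrow> (('a \<Rightarrow> complex mat) \<times> ('a \<Rightarrow> complex mat)) set" where
  "rep_equiv G = {(\<rho>, \<sigma>). \<rho> \<in> irreps G \<and> \<sigma> \<in> irreps G \<and>
     (\<exists>P Q. \<forall>g\<in>carrier G. similar_mat_wit (\<rho> g) (\<sigma> g) P Q)}"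

lemma equiv_rep_equiv: "equiv (irreps G) (rep_equiv G)"
proof (rule equivI)
  show "rep_equiv G \<subseteq> irreps G \<times> irreps G"
    by (auto simp: rep_equiv_def)
  show "refl_on (irreps G) (rep_equiv G)"
  proof (rule refl_onI)
    fix \<rho> assume r: "\<rho> \<in> irreps G"
    then obtain d where d: "\<rho> \<in> hom G (GL d)"
      by (auto simp: irreps_def irreducible_representation_def representation_def)
    have "similar_mat_wit (\<rho> g) (\<rho> g) (1\<^sub>m d) (1\<^sub>m d)" if "g \<in> carrier G" for g
    proof (rule similar_mat_wit_refl)
      show "\<rho> g \<in> carrier_mat d d"
        using hom_carrier[OF d] that by (auto simp: GL_def units_of_def Units_def ring_mat_def)
    qed
    then show "(\<rho>, \<rho>) \<in> rep_equiv G"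
      using r unfolding rep_equiv_def by blast
  qed
  show "sym (rep_equiv G)"
    unfolding sym_def rep_equiv_def using similar_mat_wit_sym by blast
  show "trans (rep_equiv G)"
    unfolding trans_def rep_equiv_def using similar_mat_wit_trans by blast
qed

definition Irr :: "('a, 'b) monoid_scheme \<Rightarrow> ('a \<Rightarrow> complex mat) set set" where
  "Irr G = irreps G // rep_equiv G"

text \<open>Degree and character do not depend on the representative chosen in a class, and
  \<^term>\<open>Irr G\<close> is finite for finite \<^term>\<open>G\<close>, so that the sum is a genuine finite sum.\<close>

definition D_dist :: "('a, 'b) monoid_scheme \<Rightarrow> 'a set \<Rightarrow> real" where
  "D_dist G H = 1 / real (Coset.order G) *
     (\<Sum>C\<in>Irr G. let \<rho> = (SOME \<rho>. \<rho> \<in> C) in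
        real (degree_rep G \<rho>) * cmod (\<Sum>h\<in>H - {\<one>\<^bsub>G\<^esub>}. character_rep \<rho> h))"

text \<open>Distinguishability is a property of a family of pairs \<open>(G, H)\<close>, with one exponent for the
  whole family; it is only meaningful for infinite families.\<close>

definition distinguishable :: "(('a, 'b) monoid_scheme \<times> 'a set) set \<Rightarrow> bool" where
  "distinguishable F \<longleftrightarrow>
     (\<exists>c::real. \<forall>(G, H)\<in>F. D_dist G H \<ge> ln (real (Coset.order G)) powr (- c))"

abbreviation indistinguishable :: "(('a, 'b) monoid_scheme \<times> 'a set) set \<Rightarrow> bool" where
  "indistinguishable F \<equiv> \<not> distinguishable F"

definition transitive_on_points :: "nat \<Rightarrow> (nat \<Rightarrow> nat) set \<Rightarrow> bool" where
  "transitive_on_points n H \<longleftrightarrow> (\<forall>x\<in>{1..n}. \<forall>y\<in>{1..n}. \<exists>h\<in>H. h x = y)"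

definition block_system :: "nat \<Rightarrow> (nat \<Rightarrow> nat) set \<Rightarrow> nat set set \<Rightarrow> bool" where
  "block_system n H \<B> \<longleftrightarrow> partition_on {1..n} \<B> \<and> (\<forall>h\<in>H. \<forall>B\<in>\<B>. h ` B \<in> \<B>)"

definition primitive_subgroup :: "nat \<Rightarrow> (nat \<Rightarrow> nat) set \<Rightarrow> bool" where
  "primitive_subgroup n H \<longleftrightarrow>
     subgroup H (sym_group n) \<and> transitive_on_points n H \<and>
     (\<forall>\<B>. block_system n H \<B> \<longrightarrow> \<B> = {{1..n}} \<or> \<B> = (\<lambda>x. {x}) ` {1..n})"

end

theory Submission
  imports
    Defs
    "HOL-Real_Asymp.Real_Asymp"
    "Jordan_Normal_Form.Spectral_Radius"
begin

text \<open>By Schur orthogonality and Bessel's inequality, \<open>D\<^sub>H \<le> \<Sum>h\<in>H - {1}. |h\<^sup>G|\<^sup>-\<^sup>1\<^sup>/\<^sup>2\<close>. In the symmetric group a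
  permutation moving \<open>m\<close> points has at least \<open>n\<^sup>c\<^sup>m\<close> conjugates, so it suffices that every nontrivial
  element of \<open>H\<close> moves at least \<open>c \<surd>n\<close> points and that \<open>H\<close> has only \<open>n\<^sup>\<delta>\<^sup>m\<close> elements moving \<open>m\<close> points,
  for a small \<open>\<delta>\<close>.

  Both follow if each pair \<open>x \<noteq> y\<close> is separated by many disjoint sets \<open>E\<close> of at most two points: no
  element of \<open>H\<close> fixing \<open>E\<close> pointwise maps \<open>x\<close> to \<open>y\<close>. An element mapping \<open>x\<close> to \<open>y\<close> moves a point of each
  \<open>E\<close>. In a random colouring of the points with \<open>q\<close> colours every colour class contains some \<open>E\<close> for
  each pair and is therefore a base; an element moving \<open>m\<close> points moves at most \<open>m / q\<close> points of
  some colour class, and it is determined by its action on these.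

  If \<open>H\<close> is primitive but not doubly transitive, connectivity of the orbital graphs yields
  \<open>c \<surd>n\<close> separating points for each pair (Babai). If \<open>H\<close> is doubly but not triply transitive, double
  counting yields linearly many disjoint separating pairs. If \<open>H\<close> is \<open>t\<close>-transitive with \<open>t\<close>
  maximal, this applies to the pointwise stabilizers of \<open>t - 2\<close> points, and \<open>t = O(\<surd>n)\<close>: otherwise
  \<open>H\<close> would contain elements with cycles of several coprime prime power lengths above \<open>\<surd>n\<close>, a suitable
  power of which moves few points; this contradicts the bound on the number of moved points or, for
  very large \<open>t\<close>, produces a 3-cycle. No classification of finite simple groups is needed.\<close>

subsection \<open>Characters of finite groups\<close>

text \<open>Everything is paid for in powers of n. A permutation moving m >= 8 points contributes at
  most n^(-m/32), and a colouring with q colours leaves at most q n^(|W| + 2m/q) elements of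
  \<open>H\<close> moving m points, where \<open>W\<close> is the set whose pointwise stabilizer is
  coloured. Any q > 64 beats the class size; q = 128 keeps a gain of n^(-m/64). In a triply
  transitive group no two further points separate x from y, which forces the passage to a stabilizer
  and the extra factor n^|W|. It is affordable because |W| = O(sqrt n) there, while nontrivial
  elements move about n/40 points. For a uniprimitive group \<open>W\<close> is empty, but the
  number of moved points is only bounded below by a multiple of sqrt n; this case alone dictates the
  exponent sqrt n of the theorem. The colouring exists once n^2 q (1 - 1/q^2)^k < 1, that is, for k
  well above log n, as both k of order sqrt n and k = n div 40 are.\<close>

lemma mult_mat_index:
  assumes "A \<in> carrier_mat n m" "B \<in> carrier_mat m p" "i < n" "j < p"
  shows "(A * B) $$ (i, j) = (\<Sum>c<m. A $$ (i, c) * B $$ (c, j))"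
  using assms by (auto simp: scalar_prod_def atLeast0LessThan intro!: sum.cong)

lemma mult_mat_unit_vec:
  assumes "T \<in> carrier_mat d e" "j < e"
  shows "T *\<^sub>v unit_vec e j = (col T j :: complex vec)"
  using col_mult2[of T d e "1\<^sub>m e" e j] assms by simp

definition mtrace :: "complex mat \<Rightarrow> complex" where
  "mtrace A = (\<Sum>i<dim_row A. A $$ (i, i))"

lemma mtrace_comm:
  assumes "A \<in> carrier_mat n m" "B \<in> carrier_mat m n"
  shows "mtrace (A * B) = mtrace (B * A)"
proof -
  have "mtrace (A * B) = (\<Sum>i<n. \<Sum>c<m. A $$ (i, c) * B $$ (c, i))"
    using assms by (auto simp: mtrace_def mult_mat_index[OF assms] simp del: index_mult_mat(1) intro!: sum.cong)
  also have "\<dots> = (\<Sum>c<m. \<Sum>i<n. B $$ (c, i) * A $$ (i, c))"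
    by (subst sum.swap) (simp add: mult.commute)
  also have "\<dots> = mtrace (B * A)"
    using assms by (auto simp: mtrace_def mult_mat_index[OF assms(2,1)] simp del: index_mult_mat(1) intro!: sum.cong)
  finally show ?thesis .
qed

lemma subspace_vecI:
  assumes "W \<subseteq> carrier_vec d" "0\<^sub>v d \<in> W"
    "\<And>v w. v \<in> W \<Longrightarrow> w \<in> W \<Longrightarrow> v + w \<in> W" "\<And>c v. v \<in> W \<Longrightarrow> c \<cdot>\<^sub>v v \<in> W"
  shows "VectorSpace.subspace class_ring W (module_vec TYPE(complex) d)"
proof -
  interpret V: vec_space "TYPE(complex)" d .
  show ?thesis
    unfolding VectorSpace.subspace_def
  proof
    show "vectorspace class_ring (module_vec TYPE(complex) d)" by (rule V.vectorspace_axioms)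
    show "submodule class_ring W (module_vec TYPE(complex) d)"
      unfolding submodule_def using assms V.module_axioms by (auto simp: module_vec_simps)
  qed
qed

section \<open>Representations as matrix-valued maps, and Schur's lemma\<close>

locale fin_group = group G for G (structure) +
  assumes fin_carrier: "finite (carrier G)"

context group
begin

text \<open>Invertibility of \<open>\<rho> g\<close> is contained in the last two clauses:
  \<open>\<rho> (inv g)\<close> is its inverse.\<close>

lemma representation_iff:
  "representation G d \<rho> \<longleftrightarrow> (\<forall>g\<in>carrier G. \<rho> g \<in> carrier_mat d d) \<and>
     (\<forall>g\<in>carrier G. \<forall>h\<in>carrier G. \<rho> (g \<otimes> h) = \<rho> g * \<rho> h) \<and> \<rho> \<one> = 1\<^sub>m d"
  (is "?L \<longleftrightarrow> ?R")
proof
  let ?M = "ring_mat TYPE(complex) d ()"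
  interpret M: ring ?M by (rule ring_mat)
  assume L: ?L
  then have hom: "\<rho> \<in> hom G (units_of ?M)" by (simp add: representation_def GL_def)
  interpret U: group "units_of ?M" by (rule M.units_group)
  have "\<rho> \<one> = \<one>\<^bsub>units_of ?M\<^esub>"
    using hom hom_one is_group U.is_group by blast
  then have "\<rho> \<one> = 1\<^sub>m d" by (simp add: units_of_one ring_mat_simps)
  moreover have "\<rho> g \<in> carrier_mat d d" if "g \<in> carrier G" for g
    using hom_in_carrier[OF hom that] M.Units_closed by (simp add: units_of_carrier ring_mat_simps)
  moreover have "\<rho> (g \<otimes> h) = \<rho> g * \<rho> h" if "g \<in> carrier G" "h \<in> carrier G" for g h
    using hom_mult[OF hom that] by (simp add: units_of_mult ring_mat_simps)
  ultimately show ?R by blast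
next
  let ?M = "ring_mat TYPE(complex) d ()"
  assume R: ?R
  have "\<rho> g \<in> Units ?M" if g: "g \<in> carrier G" for g
  proof -
    have "\<rho> g * \<rho> (inv g) = 1\<^sub>m d" "\<rho> (inv g) * \<rho> g = 1\<^sub>m d"
      using R g by (metis inv_closed r_inv, metis inv_closed l_inv)
    moreover have "\<rho> g \<in> carrier_mat d d" "\<rho> (inv g) \<in> carrier_mat d d" using R g by auto
    ultimately show ?thesis unfolding Units_def ring_mat_simps by blast
  qed
  then show ?L unfolding representation_def GL_def hom_def units_of_def using R
    by (auto simp: ring_mat_simps)
qed

text \<open>Kernel and image of an intertwiner are invariant, so for a nonzero \<open>T\<close> the
  kernel is zero and the image is everything. The inverse is produced as a matrix because it later
  serves as half of a similarity witness. Comparing the traces of \<open>T * S\<close> and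
  \<open>S * T\<close> gives \<open>d = e\<close>.\<close>

lemma Schur:
  assumes \<rho>: "irreducible_representation G d \<rho>" and \<sigma>: "irreducible_representation G e \<sigma>"
    and T: "T \<in> carrier_mat d e" and intertw: "\<And>g. g \<in> carrier G \<Longrightarrow> \<rho> g * T = T * \<sigma> g"
    and nz: "T \<noteq> 0\<^sub>m d e"
  obtains S where "S \<in> carrier_mat e d" "T * S = 1\<^sub>m d" "S * T = 1\<^sub>m e" "d = e"
proof -
  have r: "\<And>g. g \<in> carrier G \<Longrightarrow> \<rho> g \<in> carrier_mat d d" "\<And>g. g \<in> carrier G \<Longrightarrow> \<sigma> g \<in> carrier_mat e e"
    using \<rho> \<sigma> by (auto simp: irreducible_representation_def representation_iff)
  define K where "K = {v \<in> carrier_vec e. T *\<^sub>v v = 0\<^sub>v d}"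
  define I where "I = (\<lambda>v. T *\<^sub>v v) ` carrier_vec e"
  have "invariant_subspace G e \<sigma> K"
    unfolding invariant_subspace_def
  proof (intro conjI ballI subspace_vecI)
    show "K \<subseteq> carrier_vec e" by (auto simp: K_def)
    show "0\<^sub>v e \<in> K" using T by (auto simp: K_def)
    show "v + w \<in> K" if "v \<in> K" "w \<in> K" for v w
      using that T by (auto simp: K_def mult_add_distrib_mat_vec[OF T])
    show "c \<cdot>\<^sub>v v \<in> K" if "v \<in> K" for c v
      using that T by (auto simp: K_def mult_mat_vec[OF T])
    show "\<sigma> g *\<^sub>v v \<in> K" if g: "g \<in> carrier G" and v: "v \<in> K" for g v
    proof -
      have c: "v \<in> carrier_vec e" "T *\<^sub>v v = 0\<^sub>v d" using v by (auto simp: K_def)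
      have "T *\<^sub>v (\<sigma> g *\<^sub>v v) = (T * \<sigma> g) *\<^sub>v v" using T r(2)[OF g] c by simp
      also have "\<dots> = (\<rho> g * T) *\<^sub>v v" using intertw[OF g] by simp
      also have "\<dots> = \<rho> g *\<^sub>v (T *\<^sub>v v)" using T r(1)[OF g] c by simp
      also have "\<dots> = 0\<^sub>v d" using r(1)[OF g] c by auto
      finally show ?thesis using r(2)[OF g] c by (auto simp: K_def)
    qed
  qed
  with \<sigma> have K: "K = {0\<^sub>v e} \<or> K = carrier_vec e" by (auto simp: irreducible_representation_def)
  have "invariant_subspace G d \<rho> I"
    unfolding invariant_subspace_def
  proof (intro conjI ballI subspace_vecI)
    show "I \<subseteq> carrier_vec d" using T by (auto simp: I_def)
    have "T *\<^sub>v 0\<^sub>v e = 0\<^sub>v d" using T by auto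
    then show "0\<^sub>v d \<in> I" unfolding I_def by (metis imageI zero_carrier_vec)
    show "v + w \<in> I" if "v \<in> I" "w \<in> I" for v w
    proof -
      from that obtain v' w' where "v' \<in> carrier_vec e" "w' \<in> carrier_vec e" "v = T *\<^sub>v v'" "w = T *\<^sub>v w'"
        by (auto simp: I_def)
      then have "v + w = T *\<^sub>v (v' + w')" "v' + w' \<in> carrier_vec e" using mult_add_distrib_mat_vec[OF T] by auto
      then show ?thesis by (auto simp: I_def)
    qed
    show "c \<cdot>\<^sub>v v \<in> I" if "v \<in> I" for c v
    proof -
      from that obtain v' where "v' \<in> carrier_vec e" "v = T *\<^sub>v v'" by (auto simp: I_def)
      then have "c \<cdot>\<^sub>v v = T *\<^sub>v (c \<cdot>\<^sub>v v')" "c \<cdot>\<^sub>v v' \<in> carrier_vec e" using mult_mat_vec[OF T] by auto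
      then show ?thesis by (auto simp: I_def)
    qed
    show "\<rho> g *\<^sub>v v \<in> I" if g: "g \<in> carrier G" and v: "v \<in> I" for g v
    proof -
      from v obtain v' where c: "v' \<in> carrier_vec e" "v = T *\<^sub>v v'" by (auto simp: I_def)
      have "\<rho> g *\<^sub>v v = (\<rho> g * T) *\<^sub>v v'" using T r(1)[OF g] c by simp
      also have "\<dots> = (T * \<sigma> g) *\<^sub>v v'" using intertw[OF g] by simp
      also have "\<dots> = T *\<^sub>v (\<sigma> g *\<^sub>v v')" using T r(2)[OF g] c by simp
      finally show ?thesis using c r(2)[OF g] by (auto simp: I_def)
    qed
  qed
  with \<rho> have I: "I = {0\<^sub>v d} \<or> I = carrier_vec d" by (auto simp: irreducible_representation_def)
  have T0: "T = 0\<^sub>m d e" if z: "\<And>v. v \<in> carrier_vec e \<Longrightarrow> T *\<^sub>v v = 0\<^sub>v d"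
  proof (rule eq_matI)
    fix i j assume ij: "i < dim_row (0\<^sub>m d e)" "j < dim_col (0\<^sub>m d e)"
    have "T *\<^sub>v unit_vec e j = col T j" using T ij by (intro mult_mat_unit_vec) auto
    with z[of "unit_vec e j"] have "col T j = 0\<^sub>v d" by simp
    with ij T show "T $$ (i, j) = 0\<^sub>m d e $$ (i, j)"
      by (metis carrier_matD index_col index_zero_mat(1-3) index_zero_vec(1))
  qed (use T in auto)
  have "K \<noteq> carrier_vec e" using T0 nz by (auto simp: K_def)
  with K have K0: "K = {0\<^sub>v e}" by blast
  have "I \<noteq> {0\<^sub>v d}" using T0 nz unfolding I_def by blast
  with I have I1: "I = carrier_vec d" by blast
  have "\<exists>w. w \<in> carrier_vec e \<and> T *\<^sub>v w = unit_vec d i" for i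
  proof -
    have "unit_vec d i \<in> I" unfolding I1 by simp
    then show ?thesis by (auto simp: I_def)
  qed
  then obtain w where w: "\<And>i. w i \<in> carrier_vec e \<and> T *\<^sub>v w i = unit_vec d i" by metis
  \<comment> \<open>The columns of \<open>S\<close> are preimages under \<open>T\<close> of the unit
    vectors.\<close>
  define S where "S = mat e d (\<lambda>(i, j). w j $ i)"
  have S: "S \<in> carrier_mat e d" by (simp add: S_def)
  have TS: "T * S = 1\<^sub>m d"
  proof (rule eq_matI)
    fix i j assume ij: "i < dim_row (1\<^sub>m d)" "j < dim_col (1\<^sub>m d)"
    have "col S j = w j" using ij w[of j] by (auto simp: S_def)
    then have "(T * S) $$ (i, j) = (T *\<^sub>v w j) $ i" using ij T S by simp
    also have "\<dots> = 1\<^sub>m d $$ (i, j)" using w ij by simp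
    finally show "(T * S) $$ (i, j) = 1\<^sub>m d $$ (i, j)" .
  qed (use T S in auto)
  have ST: "S * T = 1\<^sub>m e"
  proof (rule eq_matI)
    fix i j assume ij: "i < dim_row (1\<^sub>m e)" "j < dim_col (1\<^sub>m e)"
    \<comment> \<open>\<open>T\<close> kills this difference because \<open>T * (S * T) = T\<close>;
      injectivity of \<open>T\<close> then makes it zero.\<close>
    let ?v = "col (S * T) j - unit_vec e j"
    have c: "col (S * T) j \<in> carrier_vec e" using S T ij by auto
    have "T *\<^sub>v col (S * T) j = col (T * (S * T)) j" using T S ij by (intro col_mult2[symmetric]) auto
    also have "T * (S * T) = T" using T S TS by (metis assoc_mult_mat left_mult_one_mat)
    also have "col T j = T *\<^sub>v unit_vec e j" using T ij by (intro mult_mat_unit_vec[symmetric]) auto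
    finally have "T *\<^sub>v ?v = 0\<^sub>v d"
      using T c by (simp add: mult_minus_distrib_mat_vec[OF T])
    with c have "?v \<in> K" by (auto simp: K_def)
    then have "?v = 0\<^sub>v e" using K0 by blast
    then have "?v $ i = 0" using ij by simp
    then show "(S * T) $$ (i, j) = 1\<^sub>m e $$ (i, j)" using ij S T c by (auto simp: unit_vec_def)
  qed (use T S in auto)
  have "mtrace (T * S) = mtrace (S * T)" by (rule mtrace_comm[OF T S])
  then have "of_nat d = (of_nat e :: complex)" unfolding TS ST by (simp add: mtrace_def)
  then have "d = e" by simp
  with S TS ST that show ?thesis by blast
qed

end

section \<open>Averaging over the group and orthogonality of irreducible characters\<close>

context fin_group
begin

lemma irrepD:
  assumes "irreducible_representation G d \<rho>"
  shows "g \<in> carrier G \<Longrightarrow> \<rho> g \<in> carrier_mat d d"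
    "g \<in> carrier G \<Longrightarrow> h \<in> carrier G \<Longrightarrow> \<rho> (g \<otimes> h) = \<rho> g * \<rho> h"
    "\<rho> \<one> = 1\<^sub>m d" "d > 0"
    "g \<in> carrier G \<Longrightarrow> character_rep \<rho> g = (\<Sum>i<d. \<rho> g $$ (i, i))"
proof -
  show a: "g \<in> carrier G \<Longrightarrow> \<rho> g \<in> carrier_mat d d"
    "g \<in> carrier G \<Longrightarrow> h \<in> carrier G \<Longrightarrow> \<rho> (g \<otimes> h) = \<rho> g * \<rho> h" "\<rho> \<one> = 1\<^sub>m d" "d > 0"
    using assms by (auto simp: irreducible_representation_def representation_iff)
  show "g \<in> carrier G \<Longrightarrow> character_rep \<rho> g = (\<Sum>i<d. \<rho> g $$ (i, i))"
    using a(1) by (auto simp: character_rep_def)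
qed

lemma irrep_mult_index:
  assumes "irreducible_representation G d \<rho>" "g \<in> carrier G" "h \<in> carrier G" "i < d" "j < d"
  shows "\<rho> (g \<otimes> h) $$ (i, j) = (\<Sum>c<d. \<rho> g $$ (i, c) * \<rho> h $$ (c, j))"
  unfolding irrepD(2)[OF assms(1-3)] using irrepD(1)[OF assms(1)] assms by (intro mult_mat_index) auto

text \<open>The unnormalised average of \<open>\<rho> g * E * \<sigma> (inv g)\<close> over the
  group, where \<open>E\<close> is the elementary matrix with its 1 at position
  \<open>(k, l)\<close>.\<close>

definition averaged :: "nat \<Rightarrow> nat \<Rightarrow> ('a \<Rightarrow> complex mat) \<Rightarrow> ('a \<Rightarrow> complex mat) \<Rightarrow> nat \<Rightarrow> nat \<Rightarrow> complex mat" where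
  "averaged d e \<rho> \<sigma> k l = mat d e (\<lambda>(a, b). \<Sum>g\<in>carrier G. \<rho> g $$ (a, k) * \<sigma> (inv g) $$ (l, b))"

lemma sum_translate:
  assumes h: "h \<in> carrier G"
  shows "(\<Sum>g\<in>carrier G. f (h \<otimes> g)) = (\<Sum>g\<in>carrier G. f g)"
  by (rule sum.reindex_bij_witness[of _ "\<lambda>g. inv h \<otimes> g" "\<lambda>g. h \<otimes> g"])
    (use h in \<open>auto simp: m_assoc[symmetric]\<close>)

lemma sum_translate_right:
  assumes h: "h \<in> carrier G"
  shows "(\<Sum>g\<in>carrier G. f (g \<otimes> h)) = (\<Sum>g\<in>carrier G. f g)"
  by (rule sum.reindex_bij_witness[of _ "\<lambda>g. g \<otimes> inv h" "\<lambda>g. g \<otimes> h"])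
    (use h in \<open>auto simp: m_assoc\<close>)

lemma averaged_intertwines:
  assumes \<rho>: "irreducible_representation G d \<rho>" and \<sigma>: "irreducible_representation G e \<sigma>"
    and h: "h \<in> carrier G" and kl: "k < d" "l < e"
  shows "\<rho> h * averaged d e \<rho> \<sigma> k l = averaged d e \<rho> \<sigma> k l * \<sigma> h"
proof (rule eq_matI)
  let ?T = "averaged d e \<rho> \<sigma> k l"
  have T: "?T \<in> carrier_mat d e" by (simp add: averaged_def)
  note c = irrepD(1)[OF \<rho> h] irrepD(1)[OF \<sigma> h]
  show "dim_row (\<rho> h * ?T) = dim_row (?T * \<sigma> h)" "dim_col (\<rho> h * ?T) = dim_col (?T * \<sigma> h)"
    using T c by auto
  fix i j assume "i < dim_row (?T * \<sigma> h)" "j < dim_col (?T * \<sigma> h)"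
  then have ij: "i < d" "j < e" using T c by auto
  have "(\<rho> h * ?T) $$ (i, j) = (\<Sum>b<d. \<rho> h $$ (i, b) * (\<Sum>g\<in>carrier G. \<rho> g $$ (b, k) * \<sigma> (inv g) $$ (l, j)))"
    using mult_mat_index[OF c(1) T ij] ij by (simp add: averaged_def)
  also have "\<dots> = (\<Sum>g\<in>carrier G. \<Sum>b<d. \<rho> h $$ (i, b) * \<rho> g $$ (b, k) * \<sigma> (inv g) $$ (l, j))"
    by (simp add: sum_distrib_left mult.assoc) (rule sum.swap)
  \<comment> \<open>Written in terms of \<open>h \<otimes> g\<close>, with
    \<open>inv g = inv (h \<otimes> g) \<otimes> h\<close>, the sum can be translated by
    \<open>h\<close>; the factor \<open>h\<close> reappears on the right.\<close>
  also have "\<dots> = (\<Sum>g\<in>carrier G. \<rho> (h \<otimes> g) $$ (i, k) * \<sigma> (inv (h \<otimes> g) \<otimes> h) $$ (l, j))"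
  proof (rule sum.cong)
    fix g assume g: "g \<in> carrier G"
    have "inv (h \<otimes> g) \<otimes> h = inv g" using g h by (simp add: inv_mult_group m_assoc)
    then show "(\<Sum>b<d. \<rho> h $$ (i, b) * \<rho> g $$ (b, k) * \<sigma> (inv g) $$ (l, j))
      = \<rho> (h \<otimes> g) $$ (i, k) * \<sigma> (inv (h \<otimes> g) \<otimes> h) $$ (l, j)"
      using irrep_mult_index[OF \<rho> h g ij(1) kl(1)] by (simp add: sum_distrib_right)
  qed simp
  also have "\<dots> = (\<Sum>g\<in>carrier G. \<rho> g $$ (i, k) * \<sigma> (inv g \<otimes> h) $$ (l, j))"
    by (rule sum_translate[OF h, of "\<lambda>g. \<rho> g $$ (i, k) * \<sigma> (inv g \<otimes> h) $$ (l, j)"])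
  also have "\<dots> = (\<Sum>g\<in>carrier G. \<Sum>b<e. \<rho> g $$ (i, k) * \<sigma> (inv g) $$ (l, b) * \<sigma> h $$ (b, j))"
    using irrep_mult_index[OF \<sigma> _ h kl(2) ij(2)] by (intro sum.cong) (auto simp: sum_distrib_left mult.assoc)
  also have "\<dots> = (\<Sum>b<e. (\<Sum>g\<in>carrier G. \<rho> g $$ (i, k) * \<sigma> (inv g) $$ (l, b)) * \<sigma> h $$ (b, j))"
    unfolding sum_distrib_right by (rule sum.swap)
  also have "\<dots> = (?T * \<sigma> h) $$ (i, j)"
    using mult_mat_index[OF T c(2) ij] ij by (simp add: averaged_def)
  finally show "(\<rho> h * ?T) $$ (i, j) = (?T * \<sigma> h) $$ (i, j)" .
qed

text \<open>The product of two traces is the sum of all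
  \<open>\<rho> g $$ (i, i) * \<sigma> (inv g) $$ (j, j)\<close>, and summing such a term over
  \<open>g\<close> gives the \<open>(i, j)\<close> entry of the average of the elementary matrix at
  \<open>(i, j)\<close>.\<close>

lemma sum_characters_averaged:
  assumes \<rho>: "irreducible_representation G d \<rho>" and \<sigma>: "irreducible_representation G e \<sigma>"
  shows "(\<Sum>g\<in>carrier G. character_rep \<rho> g * character_rep \<sigma> (inv g))
    = (\<Sum>i<d. \<Sum>j<e. averaged d e \<rho> \<sigma> i j $$ (i, j))"
proof -
  have "(\<Sum>g\<in>carrier G. character_rep \<rho> g * character_rep \<sigma> (inv g))
    = (\<Sum>g\<in>carrier G. \<Sum>i<d. \<Sum>j<e. \<rho> g $$ (i, i) * \<sigma> (inv g) $$ (j, j))"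
    by (intro sum.cong) (auto simp: irrepD(5)[OF \<rho>] irrepD(5)[OF \<sigma>] sum_product)
  also have "\<dots> = (\<Sum>i<d. \<Sum>g\<in>carrier G. \<Sum>j<e. \<rho> g $$ (i, i) * \<sigma> (inv g) $$ (j, j))"
    by (rule sum.swap)
  also have "\<dots> = (\<Sum>i<d. \<Sum>j<e. \<Sum>g\<in>carrier G. \<rho> g $$ (i, i) * \<sigma> (inv g) $$ (j, j))"
    by (rule sum.cong[OF refl]) (rule sum.swap)
  also have "\<dots> = (\<Sum>i<d. \<Sum>j<e. averaged d e \<rho> \<sigma> i j $$ (i, j))"
    by (auto simp: averaged_def)
  finally show ?thesis .
qed

text \<open>A nonzero entry would make an averaged matrix a nonzero intertwiner, and by
  \<open>Schur\<close> this is a change of basis turning \<open>\<sigma>\<close> into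
  \<open>\<rho>\<close>.\<close>

lemma character_orthogonal:
  assumes \<rho>: "\<rho> \<in> irreps G" and \<sigma>: "\<sigma> \<in> irreps G" and ne: "(\<rho>, \<sigma>) \<notin> rep_equiv G"
  shows "(\<Sum>g\<in>carrier G. character_rep \<rho> g * character_rep \<sigma> (inv g)) = 0"
proof -
  obtain d e where r: "irreducible_representation G d \<rho>" and s: "irreducible_representation G e \<sigma>"
    using \<rho> \<sigma> by (auto simp: irreps_def)
  have "averaged d e \<rho> \<sigma> i j $$ (i, j) = 0" if ij: "i < d" "j < e" for i j
  proof (rule ccontr)
    let ?T = "averaged d e \<rho> \<sigma> i j"
    assume "?T $$ (i, j) \<noteq> 0"
    then have nz: "?T \<noteq> 0\<^sub>m d e" using ij by auto
    have T: "?T \<in> carrier_mat d e" by (simp add: averaged_def)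
    obtain S where S: "S \<in> carrier_mat e d" "?T * S = 1\<^sub>m d" "S * ?T = 1\<^sub>m e" "d = e"
      using Schur[OF r s T averaged_intertwines[OF r s _ ij] nz] by blast
    have "similar_mat_wit (\<rho> g) (\<sigma> g) ?T S" if g: "g \<in> carrier G" for g
    proof (rule similar_mat_witI[of _ _ d])
      note c = irrepD(1)[OF r g] irrepD(1)[OF s g]
      have "?T * \<sigma> g * S = \<rho> g * ?T * S" using averaged_intertwines[OF r s g ij] by simp
      also have "\<dots> = \<rho> g" using c S(1,2) T by (metis assoc_mult_mat right_mult_one_mat)
      finally show "\<rho> g = ?T * \<sigma> g * S" by simp
    qed (use S T irrepD(1)[OF r g] irrepD(1)[OF s g] in auto)
    then have "(\<rho>, \<sigma>) \<in> rep_equiv G" using \<rho> \<sigma> by (auto simp: rep_equiv_def)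
    with ne show False by blast
  qed
  then show ?thesis unfolding sum_characters_averaged[OF r s] by simp
qed

text \<open>Over the complex numbers \<open>T\<close> has an eigenvalue; subtracting it leaves an
  intertwiner that kills an eigenvector, so it is not invertible and vanishes by
  \<open>Schur\<close>.\<close>

lemma intertwiner_scalar:
  assumes \<rho>: "irreducible_representation G d \<rho>" and T: "T \<in> carrier_mat d d"
    and intertw: "\<And>g. g \<in> carrier G \<Longrightarrow> \<rho> g * T = T * \<rho> g"
  obtains \<mu> where "T = \<mu> \<cdot>\<^sub>m 1\<^sub>m d"
proof -
  obtain \<mu> where "eigenvalue T \<mu>"
    using spectrum_non_empty[OF T] irrepD(4)[OF \<rho>] by (auto simp: spectrum_def)
  then obtain v where v: "v \<in> carrier_vec d" "v \<noteq> 0\<^sub>v d" "T *\<^sub>v v = \<mu> \<cdot>\<^sub>v v"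
    using T by (auto simp: eigenvalue_def eigenvector_def)
  let ?T = "T - \<mu> \<cdot>\<^sub>m 1\<^sub>m d"
  have T': "?T \<in> carrier_mat d d" using T by auto
  have "?T = 0\<^sub>m d d"
  proof (rule ccontr)
    assume nz: "?T \<noteq> 0\<^sub>m d d"
    have "\<rho> g * ?T = ?T * \<rho> g" if g: "g \<in> carrier G" for g
    proof -
      have c: "\<rho> g \<in> carrier_mat d d" using irrepD(1)[OF \<rho> g] .
      have "\<rho> g * ?T = \<rho> g * T - \<rho> g * (\<mu> \<cdot>\<^sub>m 1\<^sub>m d)"
        using c T by (intro mult_minus_distrib_mat) auto
      also have "\<rho> g * (\<mu> \<cdot>\<^sub>m 1\<^sub>m d) = (\<mu> \<cdot>\<^sub>m 1\<^sub>m d) * \<rho> g"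
        using c mult_smult_distrib[OF c one_carrier_mat, of \<mu>] mult_smult_assoc_mat[OF one_carrier_mat c, of \<mu>] by simp
      also have "\<rho> g * T = T * \<rho> g" by (rule intertw[OF g])
      also have "T * \<rho> g - (\<mu> \<cdot>\<^sub>m 1\<^sub>m d) * \<rho> g = ?T * \<rho> g"
        using c T by (intro minus_mult_distrib_mat[symmetric]) auto
      finally show ?thesis .
    qed
    from Schur[OF \<rho> \<rho> T' this nz] obtain S where S: "S \<in> carrier_mat d d" "S * ?T = 1\<^sub>m d" by blast
    have "?T *\<^sub>v v = T *\<^sub>v v - (\<mu> \<cdot>\<^sub>m 1\<^sub>m d) *\<^sub>v v" using T v(1) by (intro minus_mult_distrib_mat_vec) auto
    also have "(\<mu> \<cdot>\<^sub>m 1\<^sub>m d) *\<^sub>v v = \<mu> \<cdot>\<^sub>v v" using v(1) by (intro eq_vecI) auto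
    finally have z: "?T *\<^sub>v v = 0\<^sub>v d" using v by auto
    have "v = (S * ?T) *\<^sub>v v" using S v(1) by simp
    also have "\<dots> = S *\<^sub>v (?T *\<^sub>v v)" using S T' v(1) by (intro assoc_mult_mat_vec) auto
    also have "\<dots> = 0\<^sub>v d" unfolding z using S by auto
    finally show False using v(2) by blast
  qed
  then have "T = \<mu> \<cdot>\<^sub>m 1\<^sub>m d" using T by (auto intro!: eq_matI simp: minus_mat_def mat_eq_iff)
  then show ?thesis by (rule that)
qed

text \<open>The average of the elementary matrix at \<open>(k, l)\<close> is a scalar matrix. Its
  trace is |G| if \<open>k = l\<close> and 0 otherwise, which determines the scalar as |G| / d or 0;
  the d diagonal positions then add up to |G|.\<close>

lemma character_norm:
  assumes \<rho>: "\<rho> \<in> irreps G"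
  shows "(\<Sum>g\<in>carrier G. character_rep \<rho> g * character_rep \<rho> (inv g)) = of_nat (card (carrier G))"
proof -
  obtain d where r: "irreducible_representation G d \<rho>" using \<rho> by (auto simp: irreps_def)
  have d: "d > 0" using irrepD(4)[OF r] .
  have av: "averaged d d \<rho> \<rho> k l $$ (k, l) = (if k = l then of_nat (card (carrier G)) / of_nat d else 0)"
    if kl: "k < d" "l < d" for k l
  proof -
    let ?T = "averaged d d \<rho> \<rho> k l"
    have T: "?T \<in> carrier_mat d d" by (simp add: averaged_def)
    obtain \<mu> where lam: "?T = \<mu> \<cdot>\<^sub>m 1\<^sub>m d"
      using intertwiner_scalar[OF r T averaged_intertwines[OF r r _ kl]] by blast
    have "(\<Sum>a<d. ?T $$ (a, a)) = (\<Sum>a<d. \<Sum>g\<in>carrier G. \<rho> (inv g) $$ (l, a) * \<rho> g $$ (a, k))"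
      by (auto simp: averaged_def mult.commute)
    also have "\<dots> = (\<Sum>g\<in>carrier G. \<Sum>a<d. \<rho> (inv g) $$ (l, a) * \<rho> g $$ (a, k))" by (rule sum.swap)
    also have "\<dots> = (\<Sum>g\<in>carrier G. \<rho> (inv g \<otimes> g) $$ (l, k))"
      by (rule sum.cong[OF refl], rule irrep_mult_index[OF r _ _ kl(2,1), symmetric]) auto
    also have "\<dots> = (\<Sum>g\<in>carrier G. if l = k then 1 else 0)"
      by (rule sum.cong) (use kl irrepD(3)[OF r] in auto)
    finally have tr: "(\<Sum>a<d. ?T $$ (a, a)) = (if k = l then of_nat (card (carrier G)) else 0)" by simp
    have "(\<Sum>a<d. ?T $$ (a, a)) = \<mu> * of_nat d" unfolding lam by simp
    with tr have "\<mu> = (if k = l then of_nat (card (carrier G)) / of_nat d else 0)"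
      using d by (auto simp: field_simps)
    moreover have "?T $$ (k, l) = (if k = l then \<mu> else 0)" unfolding lam using kl by simp
    ultimately show ?thesis by simp
  qed
  have "(\<Sum>i<d. \<Sum>j<d. averaged d d \<rho> \<rho> i j $$ (i, j))
      = (\<Sum>i<d. \<Sum>j<d. if i = j then of_nat (card (carrier G)) / of_nat d else 0)"
    using av by (intro sum.cong) auto
  also have "\<dots> = of_nat (card (carrier G))" using d by simp
  finally show ?thesis unfolding sum_characters_averaged[OF r r] .
qed

text \<open>With the positive definite \<open>P = \<Sum>g. \<rho>(g)\<^sup>* \<rho>(g)\<close> one has \<open>P \<rho>(h) = \<rho>(h\<^sup>-\<^sup>1)\<^sup>* P\<close>, so both
  sides have the same trace.\<close>

lemma character_inv:
  assumes \<rho>: "\<rho> \<in> irreps G" and h: "h \<in> carrier G"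
  shows "character_rep \<rho> (inv h) = cnj (character_rep \<rho> h)"
proof -
  obtain d where r: "irreducible_representation G d \<rho>" using \<rho> by (auto simp: irreps_def)
  define P where "P = mat d d (\<lambda>(a, b). \<Sum>g\<in>carrier G. \<Sum>c<d. cnj (\<rho> g $$ (c, a)) * \<rho> g $$ (c, b))"
  have P: "P \<in> carrier_mat d d" by (simp add: P_def)
  \<comment> \<open>If \<open>P\<close> kills \<open>v\<close>, the Hermitian form of
    \<open>P\<close> at \<open>v\<close>, which is the sum over g of the squared norms of
    \<open>\<rho> g *\<^sub>v v\<close>, is zero. The summand for the identity is the squared norm
    of \<open>v\<close>.\<close>
  have "det P \<noteq> 0"
  proof
    assume "det P = 0"
    then obtain v where v: "v \<in> carrier_vec d" "v \<noteq> 0\<^sub>v d" "P *\<^sub>v v = 0\<^sub>v d"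
      using det_0_iff_vec_prod_zero[OF P] by blast
    define x where "x g c = (\<Sum>b<d. \<rho> g $$ (c, b) * v $ b)" for g c
    have "0 = (\<Sum>a<d. cnj (v $ a) * (P *\<^sub>v v) $ a)" using v(3) by simp
    also have "\<dots> = (\<Sum>a<d. cnj (v $ a) * (\<Sum>b<d. (\<Sum>g\<in>carrier G. \<Sum>c<d. cnj (\<rho> g $$ (c, a)) * \<rho> g $$ (c, b)) * v $ b))"
      using v(1) by (auto simp: P_def scalar_prod_def atLeast0LessThan intro!: sum.cong)
    also have "\<dots> = (\<Sum>a<d. \<Sum>b<d. \<Sum>g\<in>carrier G. \<Sum>c<d. (cnj (\<rho> g $$ (c, a)) * cnj (v $ a)) * (\<rho> g $$ (c, b) * v $ b))"
      by (simp only: sum_distrib_left sum_distrib_right) (simp only: mult_ac)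
    also have "\<dots> = (\<Sum>a<d. \<Sum>g\<in>carrier G. \<Sum>b<d. \<Sum>c<d. (cnj (\<rho> g $$ (c, a)) * cnj (v $ a)) * (\<rho> g $$ (c, b) * v $ b))"
      by (rule sum.cong[OF refl], rule sum.swap)
    also have "\<dots> = (\<Sum>g\<in>carrier G. \<Sum>a<d. \<Sum>b<d. \<Sum>c<d. (cnj (\<rho> g $$ (c, a)) * cnj (v $ a)) * (\<rho> g $$ (c, b) * v $ b))"
      by (rule sum.swap)
    also have "\<dots> = (\<Sum>g\<in>carrier G. \<Sum>a<d. \<Sum>c<d. \<Sum>b<d. (cnj (\<rho> g $$ (c, a)) * cnj (v $ a)) * (\<rho> g $$ (c, b) * v $ b))"
      by (rule sum.cong[OF refl], rule sum.cong[OF refl], rule sum.swap)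
    also have "\<dots> = (\<Sum>g\<in>carrier G. \<Sum>c<d. \<Sum>a<d. \<Sum>b<d. (cnj (\<rho> g $$ (c, a)) * cnj (v $ a)) * (\<rho> g $$ (c, b) * v $ b))"
      by (rule sum.cong[OF refl], rule sum.swap)
    also have "\<dots> = (\<Sum>g\<in>carrier G. \<Sum>c<d. cnj (x g c) * x g c)"
      by (simp add: x_def sum_product)
    also have "\<dots> = of_real (\<Sum>g\<in>carrier G. \<Sum>c<d. (cmod (x g c))\<^sup>2)"
      unfolding of_real_sum complex_norm_square by (simp add: mult.commute)
    finally have "(\<Sum>g\<in>carrier G. \<Sum>c<d. (cmod (x g c))\<^sup>2) = 0"
      using of_real_eq_0_iff by metis
    then have "\<forall>g\<in>carrier G. (\<Sum>c<d. (cmod (x g c))\<^sup>2) = 0"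
      by (subst (asm) sum_nonneg_eq_0_iff) (auto simp: fin_carrier sum_nonneg)
    then have "(\<Sum>c<d. (cmod (x \<one> c))\<^sup>2) = 0" by simp
    then have "\<forall>c<d. x \<one> c = 0" by (subst (asm) sum_nonneg_eq_0_iff) auto
    moreover have "x \<one> c = v $ c" if "c < d" for c
    proof -
      have "x \<one> c = (\<Sum>b<d. if b = c then v $ b else 0)"
        unfolding x_def irrepD(3)[OF r] using that by (intro sum.cong) auto
      then show ?thesis using that by simp
    qed
    ultimately have "v = 0\<^sub>v d" using v(1) by (intro eq_vecI) auto
    with v(2) show False by blast
  qed
  then have "P \<in> Units (ring_mat TYPE(complex) d ())" by (rule det_non_zero_imp_unit[OF P])
  then obtain Q where Q: "Q \<in> carrier_mat d d" "Q * P = 1\<^sub>m d" "P * Q = 1\<^sub>m d"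
    by (auto simp: Units_def ring_mat_simps)
  define A where "A = mat d d (\<lambda>(a, b). cnj (\<rho> (inv h) $$ (b, a)))"
  have A: "A \<in> carrier_mat d d" by (simp add: A_def)
  note c = irrepD(1)[OF r h]
  have "P * \<rho> h = A * P"
  proof (rule eq_matI)
    fix i j assume "i < dim_row (A * P)" "j < dim_col (A * P)"
    then have ij: "i < d" "j < d" using A P by auto
    have "(P * \<rho> h) $$ (i, j) = (\<Sum>b<d. (\<Sum>g\<in>carrier G. \<Sum>c<d. cnj (\<rho> g $$ (c, i)) * \<rho> g $$ (c, b)) * \<rho> h $$ (b, j))"
      using mult_mat_index[OF P c ij] ij by (simp add: P_def)
    also have "\<dots> = (\<Sum>b<d. \<Sum>g\<in>carrier G. \<Sum>c<d. cnj (\<rho> g $$ (c, i)) * \<rho> g $$ (c, b) * \<rho> h $$ (b, j))"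
      by (simp add: sum_distrib_right)
    also have "\<dots> = (\<Sum>g\<in>carrier G. \<Sum>b<d. \<Sum>c<d. cnj (\<rho> g $$ (c, i)) * \<rho> g $$ (c, b) * \<rho> h $$ (b, j))"
      by (rule sum.swap)
    also have "\<dots> = (\<Sum>g\<in>carrier G. \<Sum>c<d. \<Sum>b<d. cnj (\<rho> g $$ (c, i)) * \<rho> g $$ (c, b) * \<rho> h $$ (b, j))"
      by (rule sum.cong[OF refl], rule sum.swap)
    also have "\<dots> = (\<Sum>g\<in>carrier G. \<Sum>c<d. cnj (\<rho> (g \<otimes> h \<otimes> inv h) $$ (c, i)) * \<rho> (g \<otimes> h) $$ (c, j))"
    proof (intro sum.cong refl)
      fix g c assume g: "g \<in> carrier G" and c: "c \<in> {..<d}"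
      have "g \<otimes> h \<otimes> inv h = g" using g h by (simp add: m_assoc)
      then show "(\<Sum>b<d. cnj (\<rho> g $$ (c, i)) * \<rho> g $$ (c, b) * \<rho> h $$ (b, j))
          = cnj (\<rho> (g \<otimes> h \<otimes> inv h) $$ (c, i)) * \<rho> (g \<otimes> h) $$ (c, j)"
        using irrep_mult_index[OF r g h _ ij(2), of c] c by (simp add: sum_distrib_left mult.assoc)
    qed
    also have "\<dots> = (\<Sum>g\<in>carrier G. \<Sum>c<d. cnj (\<rho> (g \<otimes> inv h) $$ (c, i)) * \<rho> g $$ (c, j))"
      by (rule sum_translate_right[OF h, of "\<lambda>g. \<Sum>c<d. cnj (\<rho> (g \<otimes> inv h) $$ (c, i)) * \<rho> g $$ (c, j)"])
    also have "\<dots> = (\<Sum>g\<in>carrier G. \<Sum>c<d. \<Sum>b<d. cnj (\<rho> (inv h) $$ (b, i)) * (cnj (\<rho> g $$ (c, b)) * \<rho> g $$ (c, j)))"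
    proof (intro sum.cong refl)
      fix g c assume g: "g \<in> carrier G" and c: "c \<in> {..<d}"
      have "cnj (\<rho> (g \<otimes> inv h) $$ (c, i)) = (\<Sum>b<d. cnj (\<rho> g $$ (c, b)) * cnj (\<rho> (inv h) $$ (b, i)))"
        using irrep_mult_index[OF r g inv_closed[OF h] _ ij(1), of c] c by simp
      then show "cnj (\<rho> (g \<otimes> inv h) $$ (c, i)) * \<rho> g $$ (c, j)
        = (\<Sum>b<d. cnj (\<rho> (inv h) $$ (b, i)) * (cnj (\<rho> g $$ (c, b)) * \<rho> g $$ (c, j)))"
        by (simp only: sum_distrib_right) (simp only: mult_ac)
    qed
    also have "\<dots> = (\<Sum>g\<in>carrier G. \<Sum>b<d. \<Sum>c<d. cnj (\<rho> (inv h) $$ (b, i)) * (cnj (\<rho> g $$ (c, b)) * \<rho> g $$ (c, j)))"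
      by (rule sum.cong[OF refl], rule sum.swap)
    also have "\<dots> = (\<Sum>b<d. \<Sum>g\<in>carrier G. \<Sum>c<d. cnj (\<rho> (inv h) $$ (b, i)) * (cnj (\<rho> g $$ (c, b)) * \<rho> g $$ (c, j)))"
      by (rule sum.swap)
    also have "\<dots> = (\<Sum>b<d. cnj (\<rho> (inv h) $$ (b, i)) * (\<Sum>g\<in>carrier G. \<Sum>c<d. cnj (\<rho> g $$ (c, b)) * \<rho> g $$ (c, j)))"
      by (simp add: sum_distrib_left)
    also have "\<dots> = (A * P) $$ (i, j)"
      using mult_mat_index[OF A P ij] ij by (simp add: P_def A_def)
    finally show "(P * \<rho> h) $$ (i, j) = (A * P) $$ (i, j)" .
  qed (use P A c in auto)
  then have "P * \<rho> h * Q = A * (P * Q)" using assoc_mult_mat[OF A P Q(1)] by simp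
  then have "A = P * \<rho> h * Q" using A Q(3) by simp
  then have "mtrace A = mtrace (Q * (P * \<rho> h))"
    using mtrace_comm[of "P * \<rho> h" d d Q] P Q c by simp
  also have "Q * (P * \<rho> h) = \<rho> h" using assoc_mult_mat[OF Q(1) P c] Q(2) c by simp
  finally have "mtrace A = mtrace (\<rho> h)" .
  then have "cnj (character_rep \<rho> (inv h)) = character_rep \<rho> h"
    using c h irrepD(5)[OF r] by (simp add: A_def mtrace_def)
  then show ?thesis by (metis complex_cnj_cnj)
qed

end

section \<open>Bessel's inequality on a conjugacy class and the bound for
  \<open>D_dist\<close>\<close>

definition conj_class :: "('a, 'b) monoid_scheme \<Rightarrow> 'a \<Rightarrow> 'a set" where
  "conj_class G h = (\<lambda>g. g \<otimes>\<^bsub>G\<^esub> h \<otimes>\<^bsub>G\<^esub> inv\<^bsub>G\<^esub> g) ` carrier G"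

context fin_group
begin

lemma conj_class_carrier: "h \<in> carrier G \<Longrightarrow> conj_class G h \<subseteq> carrier G"
  by (auto simp: conj_class_def)

lemma finite_conj_class: "h \<in> carrier G \<Longrightarrow> finite (conj_class G h)"
  using conj_class_carrier fin_carrier finite_subset by blast

lemma card_conj_class_pos:
  assumes "h \<in> carrier G"
  shows "card (conj_class G h) > 0"
proof -
  have "conj_class G h \<noteq> {}" unfolding conj_class_def using one_closed by blast
  then show ?thesis using finite_conj_class[OF assms] by (simp add: card_gt_0_iff)
qed

lemma character_conj_class:
  assumes \<rho>: "\<rho> \<in> irreps G" and h: "h \<in> carrier G" and x: "x \<in> conj_class G h"
  shows "character_rep \<rho> x = character_rep \<rho> h"
proof -
  obtain d where r: "irreducible_representation G d \<rho>" using \<rho> by (auto simp: irreps_def)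
  obtain g where g: "g \<in> carrier G" "x = g \<otimes> h \<otimes> inv g" using x by (auto simp: conj_class_def)
  have x': "x \<in> carrier G" using g h by auto
  note c = irrepD(1)[OF r g(1)] irrepD(1)[OF r h] irrepD(1)[OF r inv_closed[OF g(1)]]
  have "\<rho> x = (\<rho> g * \<rho> h) * \<rho> (inv g)" unfolding g(2) using g(1) h irrepD(2)[OF r] by simp
  then have "mtrace (\<rho> x) = mtrace (\<rho> (inv g) * (\<rho> g * \<rho> h))"
    using mtrace_comm[of "\<rho> g * \<rho> h" d d "\<rho> (inv g)"] c by simp
  also have "\<rho> (inv g) * (\<rho> g * \<rho> h) = \<rho> (inv g \<otimes> g \<otimes> h)"
    using irrepD(2)[OF r g(1) h] irrepD(2)[OF r inv_closed[OF g(1)], of "g \<otimes> h"] g(1) h by (simp only: m_assoc inv_closed m_closed)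
  also have "inv g \<otimes> g \<otimes> h = h" using g(1) h by simp
  finally show ?thesis using irrepD(1)[OF r x'] c(2) irrepD(5)[OF r] h x' by (simp add: mtrace_def)
qed

lemma character_one:
  assumes "\<rho> \<in> irreps G"
  shows "character_rep \<rho> \<one> = of_nat (degree_rep G \<rho>)"
proof -
  obtain d where r: "irreducible_representation G d \<rho>" using assms by (auto simp: irreps_def)
  show ?thesis using irrepD(3)[OF r] irrepD(5)[OF r one_closed] by (simp add: degree_rep_def)
qed

text \<open>Bessel's inequality for the indicator \<open>f\<close> of the class of \<open>h\<close>.
  Characters are constant on the class, so \<open>c \<rho>\<close> is the Fourier coefficient of
  \<open>f\<close>, and \<open>u\<close> is the projection of \<open>f\<close> to the span of the
  characters from \<open>F\<close>. Nonnegativity of the squared norm of \<open>f - u\<close> bounds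
  the sum of the squared coefficients.\<close>

lemma character_Bessel:
  assumes F: "finite F" "F \<subseteq> irreps G" "\<And>\<rho> \<sigma>. \<rho> \<in> F \<Longrightarrow> \<sigma> \<in> F \<Longrightarrow> \<rho> \<noteq> \<sigma> \<Longrightarrow> (\<rho>, \<sigma>) \<notin> rep_equiv G"
    and h: "h \<in> carrier G"
  shows "(\<Sum>\<rho>\<in>F. (cmod (character_rep \<rho> h))\<^sup>2) * real (card (conj_class G h)) \<le> real (card (carrier G))"
proof -
  define N where "N = real (card (carrier G))"
  define K where "K = conj_class G h"
  define k where "k = real (card K)"
  define f :: "'a \<Rightarrow> complex" where "f g = (if g \<in> K then 1 else 0)" for g
  define c where "c \<rho> = of_real k * cnj (character_rep \<rho> h) / of_real N" for \<rho>
  define u where "u g = (\<Sum>\<rho>\<in>F. c \<rho> * character_rep \<rho> g)" for g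
  have N: "N > 0" using fin_carrier one_closed by (auto simp: N_def card_gt_0_iff)
  have k: "k > 0" using card_conj_class_pos[OF h] by (simp add: k_def K_def)
  have K: "K \<subseteq> carrier G" using conj_class_carrier[OF h] by (simp add: K_def)
  have orth: "(\<Sum>g\<in>carrier G. character_rep \<rho> g * cnj (character_rep \<sigma> g)) = (if \<rho> = \<sigma> then of_real N else 0)"
    if "\<rho> \<in> F" "\<sigma> \<in> F" for \<rho> \<sigma>
  proof -
    have i: "\<rho> \<in> irreps G" "\<sigma> \<in> irreps G" using that F(2) by auto
    have "(\<Sum>g\<in>carrier G. character_rep \<rho> g * cnj (character_rep \<sigma> g))
      = (\<Sum>g\<in>carrier G. character_rep \<rho> g * character_rep \<sigma> (inv g))"
      using character_inv[OF i(2)] by simp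
    also have "\<dots> = (if \<rho> = \<sigma> then of_real N else 0)"
    proof (cases "\<rho> = \<sigma>")
      case True
      then show ?thesis using character_norm[OF i(1)] by (simp add: N_def)
    next
      case False
      then show ?thesis using character_orthogonal[OF i F(3)[OF that False]] by simp
    qed
    finally show ?thesis .
  qed
  have onK: "(\<Sum>g\<in>carrier G. f g * x g) = (\<Sum>g\<in>K. x g)" for x :: "'a \<Rightarrow> complex"
  proof -
    have "(\<Sum>g\<in>carrier G. f g * x g) = (\<Sum>g\<in>carrier G \<inter> K. x g)"
      unfolding f_def sum.inter_restrict[OF fin_carrier] by (intro sum.cong) auto
    also have "carrier G \<inter> K = K" using K by blast
    finally show ?thesis .
  qed
  have uu: "(\<Sum>g\<in>carrier G. u g * cnj (u g)) = of_real (N * (\<Sum>\<rho>\<in>F. (cmod (c \<rho>))\<^sup>2))"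
  proof -
    have "(\<Sum>g\<in>carrier G. u g * cnj (u g))
      = (\<Sum>g\<in>carrier G. \<Sum>\<rho>\<in>F. \<Sum>\<sigma>\<in>F. (c \<rho> * cnj (c \<sigma>)) * (character_rep \<rho> g * cnj (character_rep \<sigma> g)))"
      by (simp add: u_def sum_product mult_ac)
    also have "\<dots> = (\<Sum>\<rho>\<in>F. \<Sum>g\<in>carrier G. \<Sum>\<sigma>\<in>F. (c \<rho> * cnj (c \<sigma>)) * (character_rep \<rho> g * cnj (character_rep \<sigma> g)))"
      by (rule sum.swap)
    also have "\<dots> = (\<Sum>\<rho>\<in>F. \<Sum>\<sigma>\<in>F. \<Sum>g\<in>carrier G. (c \<rho> * cnj (c \<sigma>)) * (character_rep \<rho> g * cnj (character_rep \<sigma> g)))"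
      by (rule sum.cong[OF refl], rule sum.swap)
    also have "\<dots> = (\<Sum>\<rho>\<in>F. \<Sum>\<sigma>\<in>F. (c \<rho> * cnj (c \<sigma>)) * (if \<rho> = \<sigma> then of_real N else 0))"
      by (intro sum.cong refl) (simp add: sum_distrib_left[symmetric] orth)
    also have "\<dots> = (\<Sum>\<rho>\<in>F. of_real N * (c \<rho> * cnj (c \<rho>)))"
      using F(1) by (intro sum.cong refl) (simp add: if_distrib cong: if_cong)
    also have "\<dots> = of_real (N * (\<Sum>\<rho>\<in>F. (cmod (c \<rho>))\<^sup>2))"
      unfolding of_real_mult of_real_sum complex_norm_square sum_distrib_left ..
    finally show ?thesis .
  qed
  have fu: "(\<Sum>g\<in>carrier G. f g * cnj (u g)) = of_real (N * (\<Sum>\<rho>\<in>F. (cmod (c \<rho>))\<^sup>2))"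
  proof -
    have "(\<Sum>g\<in>carrier G. f g * cnj (u g)) = (\<Sum>g\<in>K. \<Sum>\<rho>\<in>F. cnj (c \<rho>) * cnj (character_rep \<rho> h))"
      unfolding onK u_def using character_conj_class[OF _ h] F(2)
      by (intro sum.cong refl) (auto simp: K_def subset_iff intro!: sum.cong)
    also have "\<dots> = (\<Sum>\<rho>\<in>F. of_real N * (c \<rho> * cnj (c \<rho>)))"
      using N by (simp add: sum_distrib_left k_def c_def mult_ac)
    also have "\<dots> = of_real (N * (\<Sum>\<rho>\<in>F. (cmod (c \<rho>))\<^sup>2))"
      unfolding of_real_mult of_real_sum complex_norm_square sum_distrib_left ..
    finally show ?thesis .
  qed
  have fu': "(\<Sum>g\<in>carrier G. cnj (f g) * u g) = of_real (N * (\<Sum>\<rho>\<in>F. (cmod (c \<rho>))\<^sup>2))"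
    using arg_cong[OF fu, of cnj] by simp
  have ff: "(\<Sum>g\<in>carrier G. f g * cnj (f g)) = of_real k"
    unfolding onK by (simp add: f_def k_def)
  have "of_real (\<Sum>g\<in>carrier G. (cmod (f g - u g))\<^sup>2) = (\<Sum>g\<in>carrier G. (f g - u g) * cnj (f g - u g))"
    unfolding of_real_sum complex_norm_square ..
  also have "\<dots> = (\<Sum>g\<in>carrier G. f g * cnj (f g) - f g * cnj (u g) - cnj (f g) * u g + u g * cnj (u g))"
    by (intro sum.cong refl) (simp add: algebra_simps)
  also have "\<dots> = of_real (k - N * (\<Sum>\<rho>\<in>F. (cmod (c \<rho>))\<^sup>2))"
    unfolding sum.distrib sum_subtractf ff fu fu' uu by simp
  finally have "(\<Sum>g\<in>carrier G. (cmod (f g - u g))\<^sup>2) = k - N * (\<Sum>\<rho>\<in>F. (cmod (c \<rho>))\<^sup>2)"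
    using of_real_eq_iff by blast
  then have "N * (\<Sum>\<rho>\<in>F. (cmod (c \<rho>))\<^sup>2) \<le> k"
    using sum_nonneg[of "carrier G" "\<lambda>g. (cmod (f g - u g))\<^sup>2"] by simp
  also have "(\<Sum>\<rho>\<in>F. (cmod (c \<rho>))\<^sup>2) = (k / N)\<^sup>2 * (\<Sum>\<rho>\<in>F. (cmod (character_rep \<rho> h))\<^sup>2)"
    using k N unfolding sum_distrib_left
    by (intro sum.cong refl) (simp add: c_def norm_mult norm_divide power_mult_distrib power_divide)
  finally have "N * ((k / N)\<^sup>2 * (\<Sum>\<rho>\<in>F. (cmod (character_rep \<rho> h))\<^sup>2)) \<le> k" .
  then have "k * (k * (\<Sum>\<rho>\<in>F. (cmod (character_rep \<rho> h))\<^sup>2)) \<le> k * N"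
    using N by (simp add: power2_eq_square field_simps)
  then show ?thesis using k by (simp add: k_def K_def N_def mult.commute)
qed

text \<open>After the triangle inequality each \<open>h\<close> is treated alone.
  \<open>character_Bessel\<close> at the identity bounds the sum of the squared degrees by |G|, and
  at \<open>h\<close> it bounds the sum of the squared character values by |G| divided by the class
  size; the two are combined as in the Cauchy-Schwarz inequality.\<close>

lemma D_dist_le:
  assumes H: "H \<subseteq> carrier G"
  shows "D_dist G H \<le> (\<Sum>h\<in>H - {\<one>}. 1 / sqrt (real (card (conj_class G h))))"
proof -
  define N where "N = real (card (carrier G))"
  define r where "r C = (SOME \<rho>. \<rho> \<in> C)" for C :: "('a \<Rightarrow> complex mat) set"
  \<comment> \<open>A sum over an infinite set is 0, so \<open>I\<close> gives the same sum as
    \<open>Irr G\<close> in either case.\<close>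
  define I where "I = (if finite (Irr G) then Irr G else {})"
  have N: "N > 0" using fin_carrier one_closed by (auto simp: N_def card_gt_0_iff)
  have finI: "finite I" by (simp add: I_def)
  have I: "I \<subseteq> Irr G" by (simp add: I_def)
  have rC: "r C \<in> C" if "C \<in> I" for C
  proof -
    have "C \<noteq> {}" using that I in_quotient_imp_non_empty[OF equiv_rep_equiv] unfolding Irr_def by blast
    then show ?thesis unfolding r_def by (simp add: some_in_eq)
  qed
  have rirr: "r C \<in> irreps G" if "C \<in> I" for C
    using rC[OF that] that I in_quotient_imp_subset[OF equiv_rep_equiv] unfolding Irr_def by blast
  have rne: "(r C, r C') \<notin> rep_equiv G" if "C \<in> I" "C' \<in> I" "C \<noteq> C'" for C C'
    using quotient_eqI[OF equiv_rep_equiv, of C G C' "r C" "r C'"] that I rC unfolding Irr_def by blast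
  have refl: "(r C, r C) \<in> rep_equiv G" if "C \<in> I" for C
    using equiv_class_self[OF equiv_rep_equiv rirr[OF that]] by blast
  have inj: "inj_on r I"
  proof (rule inj_onI)
    fix C C' assume "C \<in> I" "C' \<in> I" "r C = r C'"
    then show "C = C'" using rne[of C C'] refl[of C] by auto
  qed
  have bes: "(\<Sum>C\<in>I. (cmod (character_rep (r C) h))\<^sup>2) * real (card (conj_class G h)) \<le> N"
    if h: "h \<in> carrier G" for h
  proof -
    have "(\<Sum>\<rho>\<in>r ` I. (cmod (character_rep \<rho> h))\<^sup>2) * real (card (conj_class G h)) \<le> N"
      unfolding N_def
    proof (rule character_Bessel[OF _ _ _ h])
      show "finite (r ` I)" "r ` I \<subseteq> irreps G" using finI rirr by auto
      show "(\<rho>, \<sigma>) \<notin> rep_equiv G" if "\<rho> \<in> r ` I" "\<sigma> \<in> r ` I" "\<rho> \<noteq> \<sigma>" for \<rho> \<sigma>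
        using that rne by auto
    qed
    then show ?thesis by (simp add: sum.reindex[OF inj])
  qed
  have "conj_class G \<one> = {\<one>}" unfolding conj_class_def using one_closed by auto
  with bes[OF one_closed] have deg: "(\<Sum>C\<in>I. (real (degree_rep G (r C)))\<^sup>2) \<le> N"
    using character_one[OF rirr] by simp
  have one: "(\<Sum>C\<in>I. real (degree_rep G (r C)) * cmod (character_rep (r C) h)) \<le> N / sqrt (real (card (conj_class G h)))"
    if h: "h \<in> carrier G" for h
  proof -
    define s where "s = sqrt (real (card (conj_class G h)))"
    have s: "s > 0" "s\<^sup>2 = real (card (conj_class G h))" using card_conj_class_pos[OF h] by (auto simp: s_def)
    \<comment> \<open>The arithmetic-geometric mean inequality with weight \<open>s\<close>, the
      square root of the class size, chosen so that both halves become at most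
      \<open>N / s\<close>.\<close>
    have "(\<Sum>C\<in>I. real (degree_rep G (r C)) * cmod (character_rep (r C) h))
      \<le> (\<Sum>C\<in>I. ((real (degree_rep G (r C)))\<^sup>2 / s + s * (cmod (character_rep (r C) h))\<^sup>2) / 2)"
    proof (rule sum_mono)
      fix C
      let ?d = "real (degree_rep G (r C))" and ?x = "cmod (character_rep (r C) h)"
      have "0 \<le> (?d - s * ?x)\<^sup>2 / s" using s by simp
      also have "(?d - s * ?x)\<^sup>2 / s = ?d\<^sup>2 / s + s * ?x\<^sup>2 - 2 * (?d * ?x)"
        using s(1) by (simp add: power2_eq_square field_simps)
      finally show "?d * ?x \<le> (?d\<^sup>2 / s + s * ?x\<^sup>2) / 2" by simp
    qed
    also have "\<dots> = ((\<Sum>C\<in>I. (real (degree_rep G (r C)))\<^sup>2) / s + s * (\<Sum>C\<in>I. (cmod (character_rep (r C) h))\<^sup>2)) / 2"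
      by (simp only: sum.distrib sum_divide_distrib sum_distrib_left add_divide_distrib)
    also have "\<dots> \<le> (N / s + N / s) / 2"
    proof -
      have "(\<Sum>C\<in>I. (cmod (character_rep (r C) h))\<^sup>2) * s * s \<le> N"
        using bes[OF h] s(2) by (simp add: power2_eq_square mult.assoc)
      then have 1: "s * (\<Sum>C\<in>I. (cmod (character_rep (r C) h))\<^sup>2) \<le> N / s"
        using s(1) by (simp add: field_simps)
      have 2: "(\<Sum>C\<in>I. (real (degree_rep G (r C)))\<^sup>2) / s \<le> N / s"
        using deg s(1) by (simp add: divide_right_mono)
      show ?thesis by (rule divide_right_mono[OF add_mono[OF 2 1]]) simp
    qed
    finally show ?thesis by (simp add: s_def)
  qed
  have "(\<Sum>C\<in>Irr G. real (degree_rep G (r C)) * cmod (\<Sum>h\<in>H - {\<one>}. character_rep (r C) h))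
     = (\<Sum>C\<in>I. real (degree_rep G (r C)) * cmod (\<Sum>h\<in>H - {\<one>}. character_rep (r C) h))"
    by (simp add: I_def)
  also have "\<dots> \<le> (\<Sum>C\<in>I. \<Sum>h\<in>H - {\<one>}. real (degree_rep G (r C)) * cmod (character_rep (r C) h))"
    unfolding sum_distrib_left[symmetric] by (intro sum_mono mult_left_mono norm_sum) auto
  also have "\<dots> = (\<Sum>h\<in>H - {\<one>}. \<Sum>C\<in>I. real (degree_rep G (r C)) * cmod (character_rep (r C) h))"
    by (rule sum.swap)
  also have "\<dots> \<le> (\<Sum>h\<in>H - {\<one>}. N / sqrt (real (card (conj_class G h))))"
    using one H by (intro sum_mono) auto
  also have "\<dots> = N * (\<Sum>h\<in>H - {\<one>}. 1 / sqrt (real (card (conj_class G h))))"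
    by (simp add: sum_distrib_left)
  finally show ?thesis
    using N unfolding D_dist_def Coset.order_def N_def[symmetric] Let_def r_def[symmetric]
    by (simp add: field_simps)
qed

end

subsection \<open>Permutation groups and separating sets\<close>

definition moved :: "('a \<Rightarrow> 'a) \<Rightarrow> 'a set" where
  "moved h = {x. h x \<noteq> x}"

text \<open>Equivalently, \<open>x\<close> and \<open>y\<close> lie in different orbits of the
  pointwise stabilizer of \<open>E\<close>.\<close>

definition separates :: "('a \<Rightarrow> 'a) set \<Rightarrow> 'a set \<Rightarrow> 'a \<Rightarrow> 'a \<Rightarrow> bool" where
  "separates H E x y \<longleftrightarrow> (\<forall>h\<in>H. (\<forall>e\<in>E. h e = e) \<longrightarrow> h x \<noteq> y)"

definition stab :: "'a set \<Rightarrow> ('a \<Rightarrow> 'a) set \<Rightarrow> ('a \<Rightarrow> 'a) set" where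
  "stab W H = {h \<in> H. \<forall>w\<in>W. h w = w}"

text \<open>Vacuously true for \<open>k > card \<Omega>\<close>; this is why monotonicity in
  \<open>k\<close> is claimed only up to \<open>card \<Omega>\<close>.\<close>

definition ktrans :: "'a set \<Rightarrow> ('a \<Rightarrow> 'a) set \<Rightarrow> nat \<Rightarrow> bool" where
  "ktrans \<Omega> H k \<longleftrightarrow> (\<forall>xs ys. length xs = k \<longrightarrow> length ys = k \<longrightarrow> distinct xs \<longrightarrow> distinct ys \<longrightarrow>
     set xs \<subseteq> \<Omega> \<longrightarrow> set ys \<subseteq> \<Omega> \<longrightarrow> (\<exists>h\<in>H. map h xs = ys))"

text \<open>The size bound 2 controls the random colouring: a set of at most two points lies inside
  a given colour class with probability at least q^(-2).\<close>

definition well_separated :: "'a set \<Rightarrow> ('a \<Rightarrow> 'a) set \<Rightarrow> nat \<Rightarrow> bool" where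
  "well_separated \<Omega> H k \<longleftrightarrow> (\<forall>x\<in>\<Omega>. \<forall>y\<in>\<Omega>. x \<noteq> y \<longrightarrow>
     (\<exists>\<E>. finite \<E> \<and> k \<le> card \<E> \<and> disjoint \<E> \<and>
        (\<forall>E\<in>\<E>. E \<subseteq> \<Omega> \<and> card E \<le> 2 \<and> separates H E x y)))"

lemma separates_mono: "separates H E x y \<Longrightarrow> E \<subseteq> E' \<Longrightarrow> separates H E' x y"
  unfolding separates_def by blast

locale perm_group =
  fixes \<Omega> :: "'a set" and H :: "('a \<Rightarrow> 'a) set"
  assumes fin: "finite \<Omega>"
    and perm: "h \<in> H \<Longrightarrow> h permutes \<Omega>"
    and id_in: "id \<in> H"
    and comp_in: "g \<in> H \<Longrightarrow> h \<in> H \<Longrightarrow> g \<circ> h \<in> H"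
    and inv_in: "h \<in> H \<Longrightarrow> inv' h \<in> H"
begin

lemma in_iff [simp]: "h \<in> H \<Longrightarrow> h x \<in> \<Omega> \<longleftrightarrow> x \<in> \<Omega>"
  using perm permutes_in_image by metis

lemma inv_apply [simp]: "h \<in> H \<Longrightarrow> inv' h (h x) = x" "h \<in> H \<Longrightarrow> h (inv' h x) = x"
  using perm permutes_inverses by metis+

lemma apply_eq_iff: "h \<in> H \<Longrightarrow> h x = y \<longleftrightarrow> inv' h y = x"
  by auto

lemma inj_apply [simp]: "h \<in> H \<Longrightarrow> h x = h y \<longleftrightarrow> x = y"
  by (metis inv_apply(1))

lemma moved_subset: "h \<in> H \<Longrightarrow> moved h \<subseteq> \<Omega>"
  using perm unfolding moved_def permutes_def by blast

lemma finite_moved: "h \<in> H \<Longrightarrow> finite (moved h)"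
  using moved_subset fin finite_subset by blast

lemma finite_H: "finite H"
proof -
  have "H \<subseteq> {p. p permutes \<Omega>}" using perm by blast
  thus ?thesis using finite_permutations[OF fin] finite_subset by blast
qed

lemma moved_nonempty: "h \<in> H \<Longrightarrow> h \<noteq> id \<Longrightarrow> \<exists>x\<in>\<Omega>. h x \<noteq> x"
  using perm unfolding permutes_def by fastforce

lemma funpow_in: "h \<in> H \<Longrightarrow> h ^^ k \<in> H"
  by (induction k) (auto simp: id_in comp_in)

lemma perm_group_stab: "perm_group (\<Omega> - W) (stab W H)"
proof
  show "finite (\<Omega> - W)" using fin by blast
  show "h permutes \<Omega> - W" if "h \<in> stab W H" for h
    using that perm[of h] unfolding stab_def permutes_def by auto
  show "id \<in> stab W H" by (simp add: stab_def id_in)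
  show "g \<circ> h \<in> stab W H" if "g \<in> stab W H" "h \<in> stab W H" for g h
    using that comp_in unfolding stab_def by auto
  show "inv' h \<in> stab W H" if "h \<in> stab W H" for h
    using that inv_in unfolding stab_def by (auto simp: apply_eq_iff[symmetric])
qed

lemma separates_commute: "separates H E x y \<longleftrightarrow> separates H E y x"
proof -
  have *: "separates H E y x" if s: "separates H E x y" for x y
    unfolding separates_def
  proof (intro ballI impI notI)
    fix h assume h: "h \<in> H" "\<forall>e\<in>E. h e = e" "h y = x"
    then have "\<forall>e\<in>E. inv' h e = e" "inv' h x = y" by (auto simp: apply_eq_iff[symmetric])
    with s h(1) inv_in show False unfolding separates_def by blast
  qed
  show ?thesis using * by blast
qed

lemma separates_image:
  assumes g: "g \<in> H" and s: "separates H E x y"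
  shows "separates H (g ` E) (g x) (g y)"
  unfolding separates_def
proof (intro ballI impI notI)
  fix h assume h: "h \<in> H" "\<forall>e\<in>g ` E. h e = e" "h (g x) = g y"
  let ?k = "inv' g \<circ> h \<circ> g"
  have "?k \<in> H" using g h(1) by (simp add: comp_in inv_in)
  moreover have "\<forall>e\<in>E. ?k e = e" using h(2) g by simp
  moreover have "?k x = y" using h(3) g by simp
  ultimately show False using s unfolding separates_def by blast
qed

lemma separates_image_iff:
  assumes g: "g \<in> H"
  shows "separates H (g ` E) (g x) (g y) \<longleftrightarrow> separates H E x y"
proof
  assume "separates H (g ` E) (g x) (g y)"
  from separates_image[OF inv_in[OF g] this] g show "separates H E x y"
    by (simp add: image_image)
qed (rule separates_image[OF g])

text \<open>Not being separated by \<open>E\<close> is the orbit relation of a stabilizer. Its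
  transitivity, read contrapositively, is the source of the triangle inequalities for numbers of
  separating sets below.\<close>

lemma separates_triangle:
  "separates H E x z \<Longrightarrow> separates H E x y \<or> separates H E y z"
proof (rule ccontr)
  assume xz: "separates H E x z" and n: "\<not> (separates H E x y \<or> separates H E y z)"
  then obtain h h' where h: "h \<in> H" "\<forall>e\<in>E. h e = e" "h x = y" "h' \<in> H" "\<forall>e\<in>E. h' e = e" "h' y = z"
    unfolding separates_def by blast
  then have "h' \<circ> h \<in> H" "\<forall>e\<in>E. (h' \<circ> h) e = e" "(h' \<circ> h) x = z" using comp_in by auto
  with xz show False unfolding separates_def by blast
qed

lemma card_moved_ge:
  assumes ws: "well_separated \<Omega> H k" and h: "h \<in> H" "h \<noteq> id"
  shows "k \<le> card (moved h)"
proof -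
  obtain x where x: "x \<in> \<Omega>" "h x \<noteq> x" using moved_nonempty[OF h] by blast
  then obtain \<E> where E: "finite \<E>" "k \<le> card \<E>" "disjoint \<E>" "\<forall>E\<in>\<E>. separates H E x (h x)"
    using ws h(1) unfolding well_separated_def by (metis in_iff)
  have "\<exists>e\<in>E. h e \<noteq> e" if "E \<in> \<E>" for E
    using E(4) that h(1) unfolding separates_def by blast
  then obtain f where f: "\<And>E. E \<in> \<E> \<Longrightarrow> f E \<in> E \<and> h (f E) \<noteq> f E" by metis
  have "inj_on f \<E>"
    using f E(3) unfolding inj_on_def disjoint_def by (metis IntI empty_iff)
  moreover have "f ` \<E> \<subseteq> moved h" using f unfolding moved_def by blast
  ultimately have "card \<E> \<le> card (moved h)" using card_inj_on_le finite_moved[OF h(1)] by blast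
  with E(2) show ?thesis by simp
qed

end

text \<open>A probability estimate with denominators cleared. For disjoint sets the events "all of E
  has colour c" are independent, each of probability at least q^(-2), so the chance that all of them
  fail is at most (1 - q^(-2)) to the number of sets. The induction splits off one set and restricts
  colourings to it and to its complement.\<close>

lemma card_colourings_avoiding:
  fixes q :: nat
  assumes "finite \<E>" "finite \<Omega>" "disjoint \<E>" "\<forall>E\<in>\<E>. E \<subseteq> \<Omega> \<and> card E \<le> 2" "c < q"
  shows "card {\<phi> \<in> \<Omega> \<rightarrow>\<^sub>E {..<q}. \<forall>E\<in>\<E>. \<not> \<phi> ` E \<subseteq> {c}} * (q\<^sup>2) ^ card \<E>
    \<le> q ^ card \<Omega> * (q\<^sup>2 - 1) ^ card \<E>"
  using assms
proof (induction \<E> arbitrary: \<Omega> rule: finite_induct)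
  case empty
  then show ?case by (simp add: card_PiE)
next
  case (insert E \<E>)
  let ?X = "{\<phi> \<in> \<Omega> \<rightarrow>\<^sub>E {..<q}. \<forall>E\<in>insert E \<E>. \<not> \<phi> ` E \<subseteq> {c}}"
  let ?A = "{\<phi> \<in> E \<rightarrow>\<^sub>E {..<q}. \<not> \<phi> ` E \<subseteq> {c}}"
  let ?B = "{\<phi> \<in> (\<Omega> - E) \<rightarrow>\<^sub>E {..<q}. \<forall>E\<in>\<E>. \<not> \<phi> ` E \<subseteq> {c}}"
  have E: "E \<subseteq> \<Omega>" "card E \<le> 2" "finite E" using insert.prems finite_subset by auto
  have sub: "E' \<subseteq> \<Omega> - E" if "E' \<in> \<E>" for E'
  proof -
    have "E' \<noteq> E" using that insert.hyps(2) by blast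
    then have "E' \<inter> E = {}" using that insert.prems(2) unfolding disjoint_def by blast
    then show ?thesis using that insert.prems(3) by blast
  qed
  have fB: "finite ?B" using insert.prems(1) by (simp add: finite_PiE)
  have fA: "finite ?A" using E by (simp add: finite_PiE)
  have IH: "card ?B * (q\<^sup>2) ^ card \<E> \<le> q ^ card (\<Omega> - E) * (q\<^sup>2 - 1) ^ card \<E>"
  proof (rule insert.IH)
    show "disjoint \<E>" using insert.prems(2) unfolding disjoint_def by blast
    show "\<forall>E'\<in>\<E>. E' \<subseteq> \<Omega> - E \<and> card E' \<le> 2" using sub insert.prems(3) by blast
  qed (use insert.prems in auto)
  let ?r = "\<lambda>\<phi>. (restrict \<phi> E, restrict \<phi> (\<Omega> - E))"
  have "card ?X \<le> card (?A \<times> ?B)"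
  proof (rule card_inj_on_le[where f = ?r])
    show "inj_on ?r ?X"
    proof (rule inj_onI)
      fix \<phi> \<psi> assume a: "\<phi> \<in> ?X" "\<psi> \<in> ?X" "?r \<phi> = ?r \<psi>"
      show "\<phi> = \<psi>"
      proof (rule PiE_ext[of _ \<Omega> "\<lambda>_. {..<q}"])
        fix x assume x: "x \<in> \<Omega>"
        have "restrict \<phi> E = restrict \<psi> E" "restrict \<phi> (\<Omega> - E) = restrict \<psi> (\<Omega> - E)" using a(3) by auto
        then show "\<phi> x = \<psi> x" using x by (metis Diff_iff restrict_apply')
      qed (use a in auto)
    qed
    show "?r ` ?X \<subseteq> ?A \<times> ?B"
    proof
      fix p assume "p \<in> ?r ` ?X"
      then obtain \<phi> where \<phi>: "\<phi> \<in> ?X" "p = ?r \<phi>" by blast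
      have 1: "restrict \<phi> E ` E = \<phi> ` E" by auto
      have 2: "restrict \<phi> (\<Omega> - E) ` E' = \<phi> ` E'" if "E' \<in> \<E>" for E' using sub[OF that] by auto
      show "p \<in> ?A \<times> ?B" unfolding \<phi>(2) mem_Times_iff fst_conv snd_conv
      proof (intro conjI CollectI ballI)
        show "restrict \<phi> E \<in> E \<rightarrow>\<^sub>E {..<q}" "restrict \<phi> (\<Omega> - E) \<in> \<Omega> - E \<rightarrow>\<^sub>E {..<q}"
          using \<phi>(1) E(1) by (auto simp: PiE_def Pi_def)
        show "\<not> restrict \<phi> E ` E \<subseteq> {c}" unfolding 1 using \<phi>(1) by blast
        show "\<not> restrict \<phi> (\<Omega> - E) ` E' \<subseteq> {c}" if "E' \<in> \<E>" for E' unfolding 2[OF that] using \<phi>(1) that by blast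
      qed
    qed
    show "finite (?A \<times> ?B)" using fA fB by blast
  qed
  then have X: "card ?X \<le> card ?A * card ?B" by (simp add: card_cartesian_product)
  \<comment> \<open>The colouring of \<open>E\<close> with constant value \<open>c\<close> is
    excluded.\<close>
  have "?A \<subseteq> (E \<rightarrow>\<^sub>E {..<q}) - {\<lambda>x\<in>E. c}" by auto
  then have "card ?A \<le> card ((E \<rightarrow>\<^sub>E {..<q}) - {\<lambda>x\<in>E. c})"
    using E by (intro card_mono) (auto simp: finite_PiE)
  also have "\<dots> = q ^ card E - 1"
    using E insert.prems(4) by (subst card_Diff_singleton) (auto simp: card_PiE)
  finally have A: "card ?A \<le> q ^ card E - 1" .
  \<comment> \<open>The only place where the sizes matter: 1 - q^(-|E|) is at most 1 -
    q^(-2).\<close>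
  have "q ^ card E \<le> q\<^sup>2" using E(2) insert.prems(4) by (intro power_increasing) auto
  then have "(q ^ card E - 1) * q\<^sup>2 \<le> q ^ card E * (q\<^sup>2 - 1)"
    by (simp add: diff_mult_distrib diff_mult_distrib2)
  with A have A2: "card ?A * q\<^sup>2 \<le> q ^ card E * (q\<^sup>2 - 1)"
    by (meson le_trans mult_le_mono1)
  have cO: "card \<Omega> = card E + card (\<Omega> - E)"
    using E insert.prems(1) by (metis card_Diff_subset card_mono le_add_diff_inverse)
  have "card ?X * (q\<^sup>2) ^ card (insert E \<E>) \<le> (card ?A * card ?B) * (q\<^sup>2) ^ Suc (card \<E>)"
    using X insert.hyps by simp
  also have "\<dots> = (card ?A * q\<^sup>2) * (card ?B * (q\<^sup>2) ^ card \<E>)" by (simp add: algebra_simps)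
  also have "\<dots> \<le> (q ^ card E * (q\<^sup>2 - 1)) * (q ^ card (\<Omega> - E) * (q\<^sup>2 - 1) ^ card \<E>)"
    by (rule mult_le_mono[OF A2 IH])
  also have "\<dots> = q ^ card \<Omega> * (q\<^sup>2 - 1) ^ card (insert E \<E>)"
    using insert.hyps by (simp add: cO power_add algebra_simps)
  finally show ?case .
qed

context perm_group
begin

text \<open>Union bound over the at most n^2 q choices of \<open>x\<close>, \<open>y\<close> and a
  colour; \<open>small\<close> says that the expected number of failures is below one.\<close>

lemma separating_colouring:
  fixes q :: nat
  assumes ws: "well_separated \<Omega> H k" and q: "0 < q"
    and small: "real (card \<Omega>) ^ 2 * real q * (1 - 1 / (real q)\<^sup>2) ^ k < 1"
  obtains \<phi> where "\<phi> \<in> \<Omega> \<rightarrow> {..<q}"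
    "\<And>c x y. c < q \<Longrightarrow> x \<in> \<Omega> \<Longrightarrow> y \<in> \<Omega> \<Longrightarrow> x \<noteq> y \<Longrightarrow> separates H {z \<in> \<Omega>. \<phi> z = c} x y"
proof -
  obtain \<E> where \<E>: "\<And>x y. x \<in> \<Omega> \<Longrightarrow> y \<in> \<Omega> \<Longrightarrow> x \<noteq> y \<Longrightarrow> finite (\<E> x y) \<and> k \<le> card (\<E> x y) \<and> disjoint (\<E> x y) \<and>
        (\<forall>E\<in>\<E> x y. E \<subseteq> \<Omega> \<and> card E \<le> 2 \<and> separates H E x y)"
    using ws unfolding well_separated_def by metis
  define F where "F = (\<Omega> \<rightarrow>\<^sub>E {..<q})"
  define bad where "bad = (\<lambda>((x, y), c). {\<phi> \<in> F. \<forall>E\<in>\<E> x y. \<not> \<phi> ` E \<subseteq> {c}})"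
  define P where "P = {(x, y) \<in> \<Omega> \<times> \<Omega>. x \<noteq> y} \<times> {..<q}"
  let ?r = "1 - 1 / (real q)\<^sup>2"
  have finF: "finite F" using fin by (simp add: F_def finite_PiE)
  have cF: "card F = q ^ card \<Omega>" using fin by (simp add: F_def card_PiE)
  have r: "0 \<le> ?r" "?r \<le> 1" using q by auto
  have "finite {(x, y) \<in> \<Omega> \<times> \<Omega>. x \<noteq> y}"
    by (rule finite_subset[of _ "\<Omega> \<times> \<Omega>"]) (use fin in auto)
  moreover have "card {(x, y) \<in> \<Omega> \<times> \<Omega>. x \<noteq> y} \<le> card (\<Omega> \<times> \<Omega>)"
    by (rule card_mono) (use fin in auto)
  ultimately have P: "finite P" "card P \<le> (card \<Omega>)\<^sup>2 * q"
    by (auto simp: P_def card_cartesian_product power2_eq_square)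
  have bad: "real (card (bad p)) \<le> real q ^ card \<Omega> * ?r ^ k" if "p \<in> P" for p
  proof -
    obtain x y c where p: "p = ((x, y), c)" "x \<in> \<Omega>" "y \<in> \<Omega>" "x \<noteq> y" "c < q"
      using \<open>p \<in> P\<close> by (auto simp: P_def)
    note e = \<E>[OF p(2-4)]
    have "card (bad p) * (q\<^sup>2) ^ card (\<E> x y) \<le> q ^ card \<Omega> * (q\<^sup>2 - 1) ^ card (\<E> x y)"
      unfolding p(1) bad_def F_def using card_colourings_avoiding[of "\<E> x y" \<Omega> c q] e fin p(5) by auto
    then have "real (card (bad p) * (q\<^sup>2) ^ card (\<E> x y)) \<le> real (q ^ card \<Omega> * (q\<^sup>2 - 1) ^ card (\<E> x y))"
      by (rule of_nat_mono)
    then have "real (card (bad p)) * ((real q)\<^sup>2) ^ card (\<E> x y)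
      \<le> real q ^ card \<Omega> * ((real q)\<^sup>2 - 1) ^ card (\<E> x y)"
      using q by (simp add: of_nat_diff)
    moreover have "(real q)\<^sup>2 - 1 = ?r * (real q)\<^sup>2" using q by (simp add: field_simps)
    ultimately have "real (card (bad p)) * ((real q)\<^sup>2) ^ card (\<E> x y)
      \<le> (real q ^ card \<Omega> * ?r ^ card (\<E> x y)) * ((real q)\<^sup>2) ^ card (\<E> x y)"
      by (simp add: power_mult_distrib mult.assoc)
    then have "real (card (bad p)) \<le> real q ^ card \<Omega> * ?r ^ card (\<E> x y)"
      using q by simp
    also have "\<dots> \<le> real q ^ card \<Omega> * ?r ^ k"
      using e r by (intro mult_left_mono power_decreasing) auto
    finally show ?thesis .
  qed
  have "real (card (\<Union>p\<in>P. bad p)) \<le> real (\<Sum>p\<in>P. card (bad p))"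
    using card_UN_le[OF P(1)] by (intro of_nat_mono) auto
  also have "\<dots> \<le> (\<Sum>p\<in>P. real q ^ card \<Omega> * ?r ^ k)"
    unfolding of_nat_sum by (intro sum_mono bad)
  also have "\<dots> = real (card P) * (real q ^ card \<Omega> * ?r ^ k)" by simp
  also have "\<dots> \<le> real ((card \<Omega>)\<^sup>2 * q) * (real q ^ card \<Omega> * ?r ^ k)"
    using P(2) r by (intro mult_right_mono of_nat_mono) auto
  also have "\<dots> = real q ^ card \<Omega> * (real (card \<Omega>) ^ 2 * real q * ?r ^ k)" by (simp add: algebra_simps)
  also have "\<dots> < real q ^ card \<Omega> * 1" using q small by (intro mult_strict_left_mono) auto
  finally have "card (\<Union>p\<in>P. bad p) < card F" by (simp add: cF)
  moreover have "finite (\<Union>p\<in>P. bad p)"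
  proof (rule finite_subset[OF _ finF])
    show "(\<Union>p\<in>P. bad p) \<subseteq> F" by (auto simp: bad_def)
  qed
  ultimately have "\<not> F \<subseteq> (\<Union>p\<in>P. bad p)"
    by (meson card_mono leD)
  then obtain \<phi> where \<phi>: "\<phi> \<in> F" "\<And>p. p \<in> P \<Longrightarrow> \<phi> \<notin> bad p" by blast
  show ?thesis
  proof (rule that)
    show "\<phi> \<in> \<Omega> \<rightarrow> {..<q}" using \<phi>(1) by (auto simp: F_def)
    fix c x y assume a: "c < q" "x \<in> \<Omega>" "y \<in> \<Omega>" "x \<noteq> y"
    then have "((x, y), c) \<in> P" by (simp add: P_def)
    from \<phi>(2)[OF this] \<phi>(1) obtain E where E: "E \<in> \<E> x y" "\<phi> ` E \<subseteq> {c}" by (auto simp: bad_def)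
    with \<E>[OF a(2-4)] have "separates H E x y" "E \<subseteq> {z \<in> \<Omega>. \<phi> z = c}" by auto
    then show "separates H {z \<in> \<Omega>. \<phi> z = c} x y" by (rule separates_mono)
  qed
qed

text \<open>The colour classes \<open>S c\<close> are bases of the stabilizer of \<open>W\<close>,
  so \<open>W \<union> S c\<close> is a base of \<open>H\<close>. By the pigeonhole principle an
  element moving \<open>m\<close> points moves at most \<open>m div q\<close> points of some
  \<open>S c\<close>. It is then determined by its values on \<open>W\<close> and by the list of
  these moved points together with their images, whence the factor 2 in the exponent.\<close>

lemma card_small_support:
  fixes q :: nat
  assumes W: "W \<subseteq> \<Omega>" and ws: "well_separated (\<Omega> - W) (stab W H) k" and q: "0 < q"
    and small: "real (card \<Omega>) ^ 2 * real q * (1 - 1 / (real q)\<^sup>2) ^ k < 1" and ne: "\<Omega> \<noteq> {}"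
  shows "card {h \<in> H. card (moved h) = m} \<le> q * card \<Omega> ^ (card W + 2 * (m div q))"
proof -
  interpret K: perm_group "\<Omega> - W" "stab W H" by (rule perm_group_stab)
  let ?s = "m div q"
  have "(1 - 1 / (real q)\<^sup>2) ^ k \<ge> 0" using q by simp
  moreover have "real (card (\<Omega> - W)) ^ 2 \<le> real (card \<Omega>) ^ 2"
    using fin by (intro power_mono of_nat_mono card_mono) auto
  ultimately have "real (card (\<Omega> - W)) ^ 2 * real q * (1 - 1 / (real q)\<^sup>2) ^ k
      \<le> real (card \<Omega>) ^ 2 * real q * (1 - 1 / (real q)\<^sup>2) ^ k"
    by (intro mult_right_mono) auto
  with small have small': "real (card (\<Omega> - W)) ^ 2 * real q * (1 - 1 / (real q)\<^sup>2) ^ k < 1" by simp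
  obtain \<phi> where \<phi>: "\<phi> \<in> \<Omega> - W \<rightarrow> {..<q}"
    "\<And>c x y. c < q \<Longrightarrow> x \<in> \<Omega> - W \<Longrightarrow> y \<in> \<Omega> - W \<Longrightarrow> x \<noteq> y \<Longrightarrow>
       separates (stab W H) {z \<in> \<Omega> - W. \<phi> z = c} x y"
    using K.separating_colouring[OF ws q small'] by blast
  define S where "S c = {z \<in> \<Omega> - W. \<phi> z = c}" for c
  have base: "g = h" if "c < q" "g \<in> H" "h \<in> H" "\<And>z. z \<in> W \<union> S c \<Longrightarrow> g z = h z" for c g h
  proof -
    let ?k = "inv' g \<circ> h"
    have k: "?k \<in> stab W H" using that comp_in inv_in unfolding stab_def by (auto simp: apply_eq_iff[symmetric])
    have "?k = id"
    proof (rule ccontr)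
      assume "?k \<noteq> id"
      then obtain x where x: "x \<in> \<Omega> - W" "?k x \<noteq> x" using K.moved_nonempty[OF k] by blast
      then have "separates (stab W H) (S c) x (?k x)"
        unfolding S_def using \<phi>(2)[OF that(1), of x "?k x"] K.in_iff[OF k] by auto
      moreover have "\<forall>e\<in>S c. ?k e = e" using that by (auto simp: apply_eq_iff[symmetric])
      ultimately show False using k unfolding separates_def by blast
    qed
    then have "g z = h z" for z
      using that(2) inv_apply(2)[OF that(2)] by (metis comp_apply id_apply)
    then show "g = h" by blast
  qed
  define X where "X c = {h \<in> H. card (S c \<inter> moved h) \<le> ?s}" for c
  have cover: "{h \<in> H. card (moved h) = m} \<subseteq> (\<Union>c<q. X c)"
  proof
    fix h assume "h \<in> {h \<in> H. card (moved h) = m}"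
    then have h: "h \<in> H" "card (moved h) = m" by auto
    have "\<exists>c<q. card (S c \<inter> moved h) \<le> ?s"
    proof (rule ccontr)
      assume "\<not> (\<exists>c<q. card (S c \<inter> moved h) \<le> ?s)"
      then have "q * (?s + 1) \<le> (\<Sum>c<q. card (S c \<inter> moved h))"
        using sum_mono[of "{..<q}" "\<lambda>_. ?s + 1" "\<lambda>c. card (S c \<inter> moved h)"] by force
      also have "\<dots> = card (\<Union>c<q. S c \<inter> moved h)"
        by (rule card_UN_disjoint[symmetric]) (auto simp: S_def fin)
      also have "\<dots> \<le> m"
        unfolding h(2)[symmetric] by (rule card_mono[OF finite_moved[OF h(1)]]) auto
      finally have "q * ?s + q \<le> m" by simp
      then show False
        using dividend_less_times_div[OF q, of m] by linarith
    qed
    then show "h \<in> (\<Union>c<q. X c)" using h by (auto simp: X_def)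
  qed
  obtain ws where ws': "set ws = W" "length ws = card W"
    using W fin finite_distinct_list[of W] distinct_card finite_subset by metis
  have cX: "card (X c) \<le> card \<Omega> ^ (card W + 2 * ?s)" if c: "c < q" for c
  proof -
    have "\<exists>us. set us \<subseteq> \<Omega> \<and> length us = ?s \<and> S c \<inter> moved h \<subseteq> set us" if "h \<in> X c" for h
    proof -
      have "finite (S c \<inter> moved h)" by (simp add: S_def fin)
      then obtain vs where vs: "set vs = S c \<inter> moved h" "length vs = card (S c \<inter> moved h)"
        using finite_distinct_list distinct_card by metis
      obtain z where z: "z \<in> \<Omega>" using ne by blast
      \<comment> \<open>Padding with an arbitrary point gives all lists the length
        \<open>?s\<close>. The extra pairs are harmless, since only points missing from the list
        have to be fixed.\<close>
      let ?us = "vs @ replicate (?s - length vs) z"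
      have "S c \<subseteq> \<Omega>" by (auto simp: S_def)
      then have "set ?us \<subseteq> \<Omega>" using vs(1) z by (auto simp: set_replicate_conv_if)
      moreover have "length ?us = ?s" using that vs(2) by (simp add: X_def)
      moreover have "S c \<inter> moved h \<subseteq> set ?us" using vs(1) by simp
      ultimately show ?thesis by blast
    qed
    then obtain us where us: "\<And>h. h \<in> X c \<Longrightarrow> set (us h) \<subseteq> \<Omega> \<and> length (us h) = ?s \<and> S c \<inter> moved h \<subseteq> set (us h)"
      by metis
    let ?f = "\<lambda>h. (map h ws, map (\<lambda>u. (u, h u)) (us h))"
    let ?L = "{l. set l \<subseteq> \<Omega> \<and> length l = card W} \<times> {l. set l \<subseteq> \<Omega> \<times> \<Omega> \<and> length l = ?s}"
    have "card (X c) \<le> card ?L"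
    proof (rule card_inj_on_le[where f = ?f])
      show "inj_on ?f (X c)"
      proof (rule inj_onI)
        fix g h assume a: "g \<in> X c" "h \<in> X c" "?f g = ?f h"
        have eqW: "g z = h z" if "z \<in> W" for z using a(3) that ws'(1) by auto
        have m: "map (\<lambda>u. (u, g u)) (us g) = map (\<lambda>u. (u, h u)) (us h)" using a(3) by auto
        then have "map fst (map (\<lambda>u. (u, g u)) (us g)) = map fst (map (\<lambda>u. (u, h u)) (us h))" by (rule arg_cong)
        then have ueq: "us g = us h" by (simp add: comp_def)
        have "\<forall>u\<in>set (us h). (u, g u) = (u, h u)" using m unfolding ueq by (simp only: map_eq_conv)
        then have e: "g u = h u" if "u \<in> set (us h)" for u using that by blast
        have "g z = h z" if "z \<in> S c" for z
        proof (cases "z \<in> set (us h)")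
          case False
          then have "z \<notin> moved g" "z \<notin> moved h" using us[OF a(1)] us[OF a(2)] that unfolding ueq by blast+
          then show ?thesis by (simp add: moved_def)
        qed (use e in auto)
        moreover have "g \<in> H" "h \<in> H" using a(1,2) by (auto simp: X_def)
        ultimately show "g = h" using base[OF c] eqW by (metis UnE)
      qed
      have "?f h \<in> ?L" if h: "h \<in> X c" for h
      proof -
        have hz: "h z \<in> \<Omega>" if "z \<in> \<Omega>" for z using h that by (simp add: X_def)
        have "set (map h ws) \<subseteq> \<Omega>" unfolding set_map ws'(1) using W hz by blast
        moreover have "set (map (\<lambda>u. (u, h u)) (us h)) \<subseteq> \<Omega> \<times> \<Omega>"
          unfolding set_map using us[OF h] hz by blast
        ultimately show ?thesis using us[OF h] ws'(2) by simp
      qed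
      then show "?f ` X c \<subseteq> ?L" by blast
      show "finite ?L" using fin by (intro finite_cartesian_product finite_lists_length_eq) auto
    qed
    also have "\<dots> = card \<Omega> ^ (card W + 2 * ?s)"
      using fin by (simp add: card_cartesian_product card_lists_length_eq power_add power_mult power2_eq_square)
    finally show ?thesis .
  qed
  have "card {h \<in> H. card (moved h) = m} \<le> card (\<Union>c<q. X c)"
    by (rule card_mono[OF _ cover]) (auto simp: X_def finite_H)
  also have "\<dots> \<le> (\<Sum>c<q. card (X c))" by (rule card_UN_le) simp
  also have "\<dots> \<le> (\<Sum>c<q. card \<Omega> ^ (card W + 2 * ?s))" by (intro sum_mono cX) auto
  also have "\<dots> = q * card \<Omega> ^ (card W + 2 * ?s)" by simp
  finally show ?thesis .
qed

end

subsection \<open>Uniprimitive groups\<close>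

context perm_group
begin

text \<open>The cardinality of this set behaves like an \<open>H\<close>-invariant pseudometric on
  \<open>\<Omega>\<close>: symmetric, zero on the diagonal, and subject to the triangle inequality.
  It is the quantity to be bounded below for uniprimitive groups.\<close>

definition sep :: "'a \<Rightarrow> 'a \<Rightarrow> 'a set" where
  "sep x y = {z \<in> \<Omega>. separates H {z} x y}"

lemma finite_sep: "finite (sep x y)"
  using fin by (simp add: sep_def)

lemma sep_image:
  assumes g: "g \<in> H"
  shows "sep (g x) (g y) = g ` sep x y"
proof (rule Set.set_eqI)
  fix z
  have "separates H {z} (g x) (g y) \<longleftrightarrow> separates H {inv' g z} x y"
    using separates_image_iff[OF g, of "{inv' g z}"] g by simp
  moreover have "z \<in> g ` A \<longleftrightarrow> inv' g z \<in> A" for A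
    using g by (auto intro!: image_eqI[of z g "inv' g z"])
  moreover have "inv' g z \<in> \<Omega> \<longleftrightarrow> z \<in> \<Omega>" using in_iff[OF inv_in[OF g]] .
  ultimately show "z \<in> sep (g x) (g y) \<longleftrightarrow> z \<in> g ` sep x y" by (simp add: sep_def)
qed

lemma inj_on_H: "g \<in> H \<Longrightarrow> inj_on g A"
  by (rule inj_onI) simp

lemma card_sep_image: "g \<in> H \<Longrightarrow> card (sep (g x) (g y)) = card (sep x y)"
  by (simp add: sep_image card_image inj_on_H)

lemma sep_commute: "sep x y = sep y x"
  by (simp add: sep_def separates_commute)

lemma card_sep_triangle: "card (sep x z) \<le> card (sep x y) + card (sep y z)"
proof -
  have "sep x z \<subseteq> sep x y \<union> sep y z" unfolding sep_def using separates_triangle by blast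
  then have "card (sep x z) \<le> card (sep x y \<union> sep y z)" by (rule card_mono[rotated]) (simp add: finite_sep)
  also have "\<dots> \<le> card (sep x y) + card (sep y z)" by (rule card_Un_le)
  finally show ?thesis .
qed

lemma sep_refl: "sep x x = {}"
  using id_in unfolding sep_def separates_def by fastforce

definition orbital :: "'a \<Rightarrow> 'a \<Rightarrow> ('a \<times> 'a) set" where
  "orbital a b = {(h a, h b) | h. h \<in> H}"

lemma orbital_invariant: "(x, y) \<in> orbital a b \<Longrightarrow> g \<in> H \<Longrightarrow> (g x, g y) \<in> orbital a b"
proof -
  assume "(x, y) \<in> orbital a b" and g: "g \<in> H"
  then obtain h where h: "h \<in> H" "x = h a" "y = h b" unfolding orbital_def by blast
  have "g \<circ> h \<in> H" "(g x, g y) = ((g \<circ> h) a, (g \<circ> h) b)" using comp_in g h by auto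
  then show ?thesis unfolding orbital_def by blast
qed

lemma orbital_subset: "a \<in> \<Omega> \<Longrightarrow> b \<in> \<Omega> \<Longrightarrow> orbital a b \<subseteq> \<Omega> \<times> \<Omega>"
  unfolding orbital_def by auto

lemma converse_orbital: "(orbital a b)\<inverse> = orbital b a"
  unfolding orbital_def by auto

lemma orbital_self: "(a, b) \<in> orbital a b"
  unfolding orbital_def by (intro CollectI exI[of _ id]) (simp add: id_in)

lemma card_sep_orbital: "(x, y) \<in> orbital a b \<Longrightarrow> card (sep x y) = card (sep a b)"
  by (auto simp: orbital_def card_sep_image)

end

locale trans_group = perm_group +
  assumes transitive: "x \<in> \<Omega> \<Longrightarrow> y \<in> \<Omega> \<Longrightarrow> \<exists>h\<in>H. h x = y"
begin

lemma card_Image_invariant: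
  assumes inv: "\<And>x y g. (x, y) \<in> Q \<Longrightarrow> g \<in> H \<Longrightarrow> (g x, g y) \<in> Q" and xy: "x \<in> \<Omega>" "y \<in> \<Omega>"
  shows "card (Q `` {x}) = card (Q `` {y})"
proof -
  obtain g where g: "g \<in> H" "g x = y" using transitive xy by blast
  have "Q `` {y} = g ` (Q `` {x})"
  proof
    show "g ` (Q `` {x}) \<subseteq> Q `` {y}" using inv g by auto
    show "Q `` {y} \<subseteq> g ` (Q `` {x})"
    proof
      fix z assume "z \<in> Q `` {y}"
      then have "(inv' g y, inv' g z) \<in> Q" using inv inv_in[OF g(1)] by blast
      moreover have "inv' g y = x" using g by auto
      ultimately have "inv' g z \<in> Q `` {x}" by simp
      then have "g (inv' g z) \<in> g ` (Q `` {x})" by (rule imageI)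
      then show "z \<in> g ` (Q `` {x})" using g(1) by simp
    qed
  qed
  then show ?thesis by (simp add: card_image inj_on_H[OF g(1)])
qed

lemma card_invariant_relation:
  assumes inv: "\<And>x y g. (x, y) \<in> Q \<Longrightarrow> g \<in> H \<Longrightarrow> (g x, g y) \<in> Q" and Q: "Q \<subseteq> \<Omega> \<times> \<Omega>" and x: "x \<in> \<Omega>"
  shows "card Q = card \<Omega> * card (Q `` {x})"
proof -
  have "Q = Sigma \<Omega> (\<lambda>y. Q `` {y})" using Q by auto
  moreover have "finite (Q `` {y})" for y
    by (rule finite_subset[OF _ fin]) (use Q in auto)
  ultimately have "card Q = (\<Sum>y\<in>\<Omega>. card (Q `` {y}))"
    using fin card_SigmaI by metis
  also have "\<dots> = (\<Sum>y\<in>\<Omega>. card (Q `` {x}))"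
    by (intro sum.cong refl card_Image_invariant[of Q]) (use inv x in auto)
  finally show ?thesis by simp
qed

text \<open>The two orbitals are converse to each other, and both are regular; multiplied by
  \<open>card \<Omega>\<close>, either degree counts the same edges.\<close>

lemma card_orbital_Image:
  assumes "a \<in> \<Omega>" "b \<in> \<Omega>"
  shows "card (orbital b a `` {a}) = card (orbital a b `` {a})"
proof -
  have "card \<Omega> * card (orbital b a `` {a}) = card (orbital b a)"
    by (rule card_invariant_relation[symmetric]) (use orbital_invariant orbital_subset assms in auto)
  also have "\<dots> = card (orbital a b)" by (metis converse_orbital card_inverse)
  also have "\<dots> = card \<Omega> * card (orbital a b `` {a})"
    by (rule card_invariant_relation) (use orbital_invariant orbital_subset assms in auto)
  finally show ?thesis using assms(1) fin by auto
qed

end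

text \<open>Invariant equivalence relations replace block systems because reachability in an orbital
  graph is such a relation.\<close>

locale primitive_group = trans_group +
  assumes primitive: "equiv \<Omega> r \<Longrightarrow> (\<And>x y g. (x, y) \<in> r \<Longrightarrow> g \<in> H \<Longrightarrow> (g x, g y) \<in> r) \<Longrightarrow>
     r = Id_on \<Omega> \<or> r = \<Omega> \<times> \<Omega>"
begin

text \<open>Reachability in \<open>R\<close> is an invariant equivalence relation other than the
  identity, so primitivity makes the graph connected. The cut form is the one used: every proper
  nonempty set of points has an outgoing edge.\<close>

lemma edge_leaving:
  assumes R: "R \<subseteq> \<Omega> \<times> \<Omega>" "sym R" and inv: "\<And>x y g. (x, y) \<in> R \<Longrightarrow> g \<in> H \<Longrightarrow> (g x, g y) \<in> R"
    and ab: "(a, b) \<in> R" "a \<noteq> b" and C: "C \<subseteq> \<Omega>" "C \<noteq> {}" "C \<noteq> \<Omega>"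
  obtains x y where "(x, y) \<in> R" "x \<in> C" "y \<notin> C"
proof -
  define r where "r = R\<^sup>* \<inter> \<Omega> \<times> \<Omega>"
  have "equiv \<Omega> r"
  proof (rule equivI)
    show "r \<subseteq> \<Omega> \<times> \<Omega>" by (auto simp: r_def)
    show "refl_on \<Omega> r" by (auto simp: r_def refl_on_def)
    show "sym r" using sym_rtrancl[OF R(2)] by (auto simp: r_def sym_def)
    show "trans r" by (auto simp: r_def trans_def intro: rtrancl_trans)
  qed
  moreover have "(g x, g y) \<in> r" if "(x, y) \<in> r" "g \<in> H" for x y g
  proof -
    have "(g x, g y) \<in> R\<^sup>*" if "(x, y) \<in> R\<^sup>*" for x y
      using that by (induction rule: rtrancl_induct) (use inv \<open>g \<in> H\<close> in \<open>auto intro: rtrancl_into_rtrancl\<close>)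
    with that show ?thesis by (auto simp: r_def)
  qed
  moreover have "(a, b) \<in> r" using ab R by (auto simp: r_def)
  ultimately have "r = \<Omega> \<times> \<Omega>" using primitive[of r] ab(2) by auto
  moreover obtain c e where ce: "c \<in> C" "e \<in> \<Omega>" "e \<notin> C" using C by blast
  ultimately have path: "(c, e) \<in> R\<^sup>*" using C(1) by (auto simp: r_def)
  have "\<exists>x y. (x, y) \<in> R \<and> x \<in> C \<and> y \<notin> C"
  proof (rule ccontr)
    assume no: "\<not> ?thesis"
    have "y \<in> C" if "(c, y) \<in> R\<^sup>*" for y
      using that by (induction rule: rtrancl_induct) (use ce(1) no in blast)+
    with path ce(3) show False by blast
  qed
  with that show ?thesis by blast
qed

text \<open>Symmetrised so that reachability becomes an equivalence relation; the size of
  \<open>sep\<close> is the same on both halves.\<close>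

definition sorbital :: "'a \<Rightarrow> 'a \<Rightarrow> ('a \<times> 'a) set" where
  "sorbital a b = orbital a b \<union> orbital b a"

lemma sorbital:
  assumes "a \<in> \<Omega>" "b \<in> \<Omega>"
  shows "sorbital a b \<subseteq> \<Omega> \<times> \<Omega>" "sym (sorbital a b)" "(a, b) \<in> sorbital a b"
    "\<And>x y g. (x, y) \<in> sorbital a b \<Longrightarrow> g \<in> H \<Longrightarrow> (g x, g y) \<in> sorbital a b"
    "\<And>x y. (x, y) \<in> sorbital a b \<Longrightarrow> card (sep x y) = card (sep a b)"
proof -
  show "sorbital a b \<subseteq> \<Omega> \<times> \<Omega>" unfolding sorbital_def using orbital_subset assms by blast
  show "sym (sorbital a b)" unfolding sorbital_def by (rule symI) (metis Un_iff converse_iff converse_orbital)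
  show "(a, b) \<in> sorbital a b" by (simp add: sorbital_def orbital_self)
  show "\<And>x y g. (x, y) \<in> sorbital a b \<Longrightarrow> g \<in> H \<Longrightarrow> (g x, g y) \<in> sorbital a b"
    unfolding sorbital_def using orbital_invariant by blast
  show "\<And>x y. (x, y) \<in> sorbital a b \<Longrightarrow> card (sep x y) = card (sep a b)"
    unfolding sorbital_def using card_sep_orbital sep_commute by (metis Un_iff)
qed

text \<open>Connectivity of the orbital graph makes every point \<open>z\<close> distinguish \<open>x\<close> from one of its
  neighbours, so the neighbours of \<open>x\<close> contribute sets of size \<open>card (sep a b)\<close> covering \<open>\<Omega>\<close>.\<close>

lemma card_le_valency_mult_sep:
  assumes ab: "a \<in> \<Omega>" "b \<in> \<Omega>" "a \<noteq> b" and x: "x \<in> \<Omega>"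
  shows "card \<Omega> \<le> card (sorbital a b `` {x}) * card (sep a b)"
proof -
  note R = sorbital[OF ab(1,2)]
  let ?R = "sorbital a b"
  have "\<Omega> \<subseteq> (\<Union>y\<in>?R `` {x}. sep x y)"
  proof
    fix z assume z: "z \<in> \<Omega>"
    \<comment> \<open>The orbit of \<open>x\<close> under the stabilizer of \<open>z\<close>. An
      edge leaving \<open>C\<close>, pulled back so that it starts at \<open>x\<close>, leads to a
      neighbour that \<open>z\<close> separates from \<open>x\<close>.\<close>
    define C where "C = {h x | h. h \<in> H \<and> h z = z}"
    have "x \<in> C" unfolding C_def by (intro CollectI exI[of _ id]) (simp add: id_in)
    moreover have "C \<subseteq> \<Omega>" unfolding C_def using x by auto
    moreover have "C \<noteq> \<Omega>"
    proof (cases "x = z")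
      case True
      then have "C \<subseteq> {z}" by (auto simp: C_def)
      then show ?thesis using ab by auto
    next
      case False
      have "z \<notin> C"
      proof
        assume "z \<in> C"
        then obtain h where "h \<in> H" "h z = z" "z = h x" by (auto simp: C_def)
        then have "h x = h z" by simp
        with \<open>h \<in> H\<close> False show False by simp
      qed
      then show ?thesis using z by blast
    qed
    ultimately have "\<exists>p y. (p, y) \<in> ?R \<and> p \<in> C \<and> y \<notin> C"
      using R(3) ab(3) by - (rule edge_leaving[of ?R a b C, OF R(1,2)], auto intro: R(4))
    then obtain p y where py: "(p, y) \<in> ?R" "p \<in> C" "y \<notin> C" by blast
    then obtain h where h: "h \<in> H" "h z = z" "p = h x" by (auto simp: C_def)
    let ?y = "inv' h y"
    have "(x, ?y) \<in> ?R" using R(4)[OF py(1) inv_in[OF h(1)]] h by simp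
    moreover have "separates H {z} x ?y"
      unfolding separates_def
    proof (intro ballI impI notI)
      fix k assume k: "k \<in> H" "\<forall>e\<in>{z}. k e = e" "k x = ?y"
      then have "(h \<circ> k) x = y" "(h \<circ> k) z = z" "h \<circ> k \<in> H" using h comp_in by auto
      then have "y \<in> C" unfolding C_def by blast
      with py(3) show False by blast
    qed
    ultimately show "z \<in> (\<Union>y\<in>?R `` {x}. sep x y)" using z by (auto simp: sep_def)
  qed
  moreover have fR: "finite (?R `` {x})" by (rule finite_subset[OF _ fin]) (use R(1) in auto)
  ultimately have "card \<Omega> \<le> card (\<Union>y\<in>?R `` {x}. sep x y)"
    by (intro card_mono) (auto simp: finite_sep)
  also have "\<dots> \<le> (\<Sum>y\<in>?R `` {x}. card (sep x y))" by (rule card_UN_le[OF fR])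
  also have "\<dots> = (\<Sum>y\<in>?R `` {x}. card (sep a b))" by (rule sum.cong) (use R(5) in auto)
  finally show ?thesis by simp
qed

text \<open>Double counting of triples; by transitivity every point separates the same number of
  pairs.\<close>

lemma sum_card_sep:
  assumes z: "z \<in> \<Omega>"
  shows "(\<Sum>p\<in>\<Omega> \<times> \<Omega>. card (sep (fst p) (snd p)))
    = card \<Omega> * card {p \<in> \<Omega> \<times> \<Omega>. separates H {z} (fst p) (snd p)}"
proof -
  let ?X = "\<lambda>z. {p \<in> \<Omega> \<times> \<Omega>. separates H {z} (fst p) (snd p)}"
  have "(\<Sum>p\<in>\<Omega> \<times> \<Omega>. card (sep (fst p) (snd p)))
    = (\<Sum>p\<in>\<Omega> \<times> \<Omega>. \<Sum>z\<in>\<Omega>. if separates H {z} (fst p) (snd p) then 1 else 0)"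
    unfolding sep_def card_eq_sum by (intro sum.cong refl sum.inter_filter fin)
  also have "\<dots> = (\<Sum>z\<in>\<Omega>. \<Sum>p\<in>\<Omega> \<times> \<Omega>. if separates H {z} (fst p) (snd p) then 1 else 0)"
    by (rule sum.swap)
  also have "\<dots> = (\<Sum>z\<in>\<Omega>. card (?X z))"
    unfolding card_eq_sum by (intro sum.cong refl sum.inter_filter[symmetric]) (simp add: fin)
  also have "\<dots> = (\<Sum>w\<in>\<Omega>. card (?X z))"
  proof (rule sum.cong[OF refl])
    fix w assume w: "w \<in> \<Omega>"
    obtain g where g: "g \<in> H" "g z = w" using transitive z w by blast
    have "?X w = map_prod g g ` ?X z"
    proof
      show "map_prod g g ` ?X z \<subseteq> ?X w"
        using separates_image[OF g(1), of "{z}"] g by auto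
      show "?X w \<subseteq> map_prod g g ` ?X z"
      proof
        fix p assume p: "p \<in> ?X w"
        obtain x y where xy: "p = (x, y)" by force
        have "separates H {z} (inv' g x) (inv' g y)"
          using separates_image[OF inv_in[OF g(1)], of "{w}" x y] p g xy by auto
        moreover have "inv' g x \<in> \<Omega>" "inv' g y \<in> \<Omega>" using p xy in_iff[OF inv_in[OF g(1)]] by auto
        ultimately have "(inv' g x, inv' g y) \<in> ?X z" by simp
        moreover have "p = map_prod g g (inv' g x, inv' g y)" using g xy by simp
        ultimately show "p \<in> map_prod g g ` ?X z" by blast
      qed
    qed
    moreover have "inj_on (map_prod g g) (?X z)" by (rule inj_onI) (use g in auto)
    ultimately show "card (?X w) = card (?X z)" by (simp add: card_image)
  qed
  finally show ?thesis by simp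
qed

text \<open>The point \<open>z\<close> separates its suborbit \<open>Q\<close> from the complement,
  in both orders. As \<open>Q\<close> has at most half of the n points, these are at least |Q| n
  pairs, so the average size of \<open>sep\<close> over all pairs is at least |Q|.\<close>

lemma small_suborbit_le_sep_bound:
  assumes z: "z \<in> \<Omega>" "x \<in> \<Omega>" "2 * card (orbital z x `` {z}) \<le> card \<Omega>"
    and m: "\<And>x y. x \<in> \<Omega> \<Longrightarrow> y \<in> \<Omega> \<Longrightarrow> card (sep x y) \<le> m"
  shows "card (orbital z x `` {z}) \<le> m"
proof -
  define Q where "Q = orbital z x `` {z}"
  have Q: "Q \<subseteq> \<Omega>" using orbital_subset[OF z(1,2)] by (auto simp: Q_def)
  have s: "separates H {z} v w" if "v \<in> Q" "w \<notin> Q" for v w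
    unfolding separates_def
  proof (intro ballI impI notI)
    fix h assume h: "h \<in> H" "\<forall>e\<in>{z}. h e = e" "h v = w"
    then have "(h z, h v) \<in> orbital z x" using that(1) orbital_invariant[of z v z x h] by (simp add: Q_def)
    with h that(2) show False by (auto simp: Q_def)
  qed
  have s': "separates H {z} w v" if "v \<in> Q" "w \<notin> Q" for v w
    using s[OF that] separates_commute by blast
  have "Q \<times> (\<Omega> - Q) \<union> (\<Omega> - Q) \<times> Q \<subseteq> {p \<in> \<Omega> \<times> \<Omega>. separates H {z} (fst p) (snd p)}"
    using s Q s' by auto
  moreover have fQ: "finite Q" using Q fin finite_subset by blast
  ultimately have "card (Q \<times> (\<Omega> - Q) \<union> (\<Omega> - Q) \<times> Q) \<le> card {p \<in> \<Omega> \<times> \<Omega>. separates H {z} (fst p) (snd p)}"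
    using fin by (intro card_mono) auto
  moreover have "card (Q \<times> (\<Omega> - Q) \<union> (\<Omega> - Q) \<times> Q) = 2 * (card Q * card (\<Omega> - Q))"
    using fin fQ by (subst card_Un_disjoint) (auto simp: card_cartesian_product)
  moreover have "card \<Omega> \<le> 2 * card (\<Omega> - Q)"
    using z(3) card_Diff_subset[OF fQ Q] by (simp add: Q_def)
  then have "card Q * card \<Omega> \<le> 2 * (card Q * card (\<Omega> - Q))"
    by (metis mult.left_commute mult_le_mono2)
  ultimately have "card Q * card \<Omega> \<le> card {p \<in> \<Omega> \<times> \<Omega>. separates H {z} (fst p) (snd p)}" by linarith
  then have "card \<Omega> * (card Q * card \<Omega>) \<le> (\<Sum>p\<in>\<Omega> \<times> \<Omega>. card (sep (fst p) (snd p)))"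
    unfolding sum_card_sep[OF z(1)] by simp
  also have "\<dots> \<le> (\<Sum>p\<in>\<Omega> \<times> \<Omega>. m)" by (intro sum_mono m) auto
  also have "\<dots> = card \<Omega> * (m * card \<Omega>)" by (simp add: card_cartesian_product mult_ac)
  finally show ?thesis using z(1) fin by (auto simp: Q_def)
qed

text \<open>Let d be the size of \<open>sep a b\<close>. If no pair exceeds 2d, the two suborbits at
  \<open>z\<close> supply one with at most half of the points, hence of size at most 2d by
  averaging. Its symmetrised orbital has valency at most 4d, and each edge has at most 2d separating
  points, so n <= 8 d^2. If some pair exceeds 2d, a point just outside the ball of radius two around
  \<open>x\<close> is separated from \<open>x\<close> by every neighbour of \<open>x\<close> but by
  at most 3d points in all; so the valency is at most 3d and n <= 3 d^2.\<close>

lemma card_le_sep_square: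
  assumes ab: "a \<in> \<Omega>" "b \<in> \<Omega>" "a \<noteq> b"
    and n2: "z \<in> \<Omega>" "x0 \<in> \<Omega>" "y0 \<in> \<Omega>" "x0 \<noteq> z" "y0 \<noteq> z" "separates H {z} x0 y0"
  shows "card \<Omega> \<le> 8 * (card (sep a b))\<^sup>2"
proof -
  note R = sorbital[OF ab(1,2)]
  let ?R = "sorbital a b" and ?d = "card (sep a b)"
  show ?thesis
  proof (cases "\<forall>x\<in>\<Omega>. \<forall>y\<in>\<Omega>. card (sep x y) \<le> 2 * ?d")
    case True
    have "orbital z x0 `` {z} \<inter> orbital z y0 `` {z} = {}"
    proof (rule ccontr)
      assume "\<not> ?thesis"
      then obtain w where w: "(z, w) \<in> orbital z x0" "(z, w) \<in> orbital z y0" by blast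
      obtain h where h: "h \<in> H" "(z, w) = (h z, h x0)" using w(1) unfolding orbital_def by blast
      obtain k where k: "k \<in> H" "(z, w) = (k z, k y0)" using w(2) unfolding orbital_def by blast
      have hk: "h \<in> H" "k \<in> H" "h z = z" "k z = z" "h x0 = k y0" using h k by auto
      then have "inv' k \<circ> h \<in> H" "(inv' k \<circ> h) z = z" "(inv' k \<circ> h) x0 = y0"
        using comp_in inv_in by (auto simp: apply_eq_iff[symmetric])
      with n2(6) show False unfolding separates_def by blast
    qed
    moreover have f: "finite (orbital z x `` {z})" "orbital z x `` {z} \<subseteq> \<Omega>" if "x \<in> \<Omega>" for x
      using orbital_subset[OF n2(1) that] fin finite_subset[of "orbital z x `` {z}" \<Omega>] by auto
    ultimately have "card (orbital z x0 `` {z}) + card (orbital z y0 `` {z}) \<le> card \<Omega>"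
      using n2 fin card_Un_disjoint[of "orbital z x0 `` {z}" "orbital z y0 `` {z}"] card_mono[OF fin]
      by (metis Un_least)
    then have "2 * card (orbital z x0 `` {z}) \<le> card \<Omega> \<or> 2 * card (orbital z y0 `` {z}) \<le> card \<Omega>" by linarith
    then obtain x where x: "x \<in> \<Omega>" "x \<noteq> z" "2 * card (orbital z x `` {z}) \<le> card \<Omega>"
      using n2(2-5) by blast
    define s where "s = card (orbital z x `` {z})"
    have s: "s \<le> 2 * ?d"
      unfolding s_def using small_suborbit_le_sep_bound[OF n2(1) x(1,3)] True by blast
    have "card (sorbital z x `` {z}) \<le> card (orbital z x `` {z}) + card (orbital x z `` {z})"
      unfolding sorbital_def Un_Image by (rule card_Un_le)
    also have "\<dots> = 2 * s" using card_orbital_Image[OF n2(1) x(1)] by (simp add: s_def)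
    finally have "card (sorbital z x `` {z}) \<le> 4 * ?d" using s by simp
    moreover have "card (sep z x) \<le> 2 * ?d" using True n2(1) x(1) by blast
    ultimately have "card (sorbital z x `` {z}) * card (sep z x) \<le> (4 * ?d) * (2 * ?d)" by (rule mult_le_mono)
    with card_le_valency_mult_sep[OF n2(1) x(1) x(2)[symmetric] n2(1)] show ?thesis
      by (simp add: power2_eq_square)
  next
    case False
    then obtain x y where xy: "x \<in> \<Omega>" "y \<in> \<Omega>" "card (sep x y) > 2 * ?d" by force
    \<comment> \<open>The ball of radius two around \<open>x\<close>. By the triangle inequality its
      points are separated from \<open>x\<close> by at most \<open>2 * ?d\<close> points, so it
      misses \<open>y\<close>.\<close>
    define B where "B = insert x (?R `` {x} \<union> ?R `` (?R `` {x}))"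
    have B: "card (sep x p) \<le> 2 * ?d" if p: "p \<in> B" for p
    proof -
      consider "p = x" | "(x, p) \<in> ?R" | w where "(x, w) \<in> ?R" "(w, p) \<in> ?R"
        using p unfolding B_def by blast
      then show ?thesis
      proof cases
        case 3
        then show ?thesis using card_sep_triangle[of x p w] R(5) by force
      qed (use R(5) in \<open>force simp: sep_refl\<close>)+
    qed
    have "B \<noteq> \<Omega>" using B xy by force
    moreover have "B \<subseteq> \<Omega>" unfolding B_def using R(1) xy(1) by blast
    moreover have "B \<noteq> {}" unfolding B_def by blast
    ultimately have "\<exists>p q. (p, q) \<in> ?R \<and> p \<in> B \<and> q \<notin> B"
      using R(3) ab(3) by - (rule edge_leaving[of ?R a b B, OF R(1,2)], auto intro: R(4))
    then obtain p q where pq: "(p, q) \<in> ?R" "p \<in> B" "q \<notin> B" by blast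
    have "card (sep x q) \<le> 2 * ?d + ?d"
      using card_sep_triangle[of x q p] B[OF pq(2)] R(5)[OF pq(1)] by linarith
    moreover have "?R `` {x} \<subseteq> sep x q"
    proof
      fix w assume w: "w \<in> ?R `` {x}"
      \<comment> \<open>An element fixing the neighbour \<open>w\<close> of \<open>x\<close> and
        mapping \<open>x\<close> to \<open>q\<close> would make \<open>w\<close> a neighbour of
        \<open>q\<close> too, placing \<open>q\<close> inside the ball.\<close>
      have "separates H {w} x q"
        unfolding separates_def
      proof (intro ballI impI notI)
        fix h assume h: "h \<in> H" "\<forall>e\<in>{w}. h e = e" "h x = q"
        then have "(q, w) \<in> ?R" using R(4)[of x w h] w by auto
        then have "(w, q) \<in> ?R" using R(2) by (meson symD)
        with w have "q \<in> B" unfolding B_def by blast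
        with pq(3) show False by blast
      qed
      then show "w \<in> sep x q" using w R(1) by (auto simp: sep_def)
    qed
    then have "card (?R `` {x}) \<le> card (sep x q)" by (rule card_mono[OF finite_sep])
    ultimately have "card (?R `` {x}) * ?d \<le> (3 * ?d) * ?d" by (intro mult_le_mono) auto
    with card_le_valency_mult_sep[OF ab xy(1)] have "card \<Omega> \<le> (3 * ?d) * ?d" by linarith
    then show ?thesis by (simp add: power2_eq_square)
  qed
qed

text \<open>Two ordered pairs in different orbits can be aligned in their first entries by
  transitivity; the common first entry then separates the second ones, which is the input of
  \<open>card_le_sep_square\<close>.\<close>

lemma well_separated_uniprimitive:
  assumes n2: "\<not> ktrans \<Omega> H 2" and k: "8 * k\<^sup>2 \<le> card \<Omega>"
  shows "well_separated \<Omega> H k"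
proof -
  obtain xs ys where l: "length xs = 2" "length ys = 2" "distinct xs" "distinct ys" "set xs \<subseteq> \<Omega>" "set ys \<subseteq> \<Omega>"
    and no: "\<And>h. h \<in> H \<Longrightarrow> map h xs \<noteq> ys" using n2 unfolding ktrans_def by blast
  obtain a1 a2 b1 b2 where ab: "xs = [a1, a2]" "ys = [b1, b2]"
    using l(1,2) by (auto simp: length_Suc_conv numeral_2_eq_2)
  have d: "a1 \<in> \<Omega>" "a2 \<in> \<Omega>" "b1 \<in> \<Omega>" "b2 \<in> \<Omega>" "a1 \<noteq> a2" "b1 \<noteq> b2" using l ab by auto
  obtain g where g: "g \<in> H" "g a1 = b1" using transitive d by blast
  have sepb: "separates H {b1} (g a2) b2"
    unfolding separates_def
  proof (intro ballI impI notI)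
    fix h assume h: "h \<in> H" "\<forall>e\<in>{b1}. h e = e" "h (g a2) = b2"
    then have "h \<circ> g \<in> H" "map (h \<circ> g) xs = ys" using g comp_in ab by auto
    with no show False by blast
  qed
  have ne: "g a2 \<noteq> b1" using g d by (metis inj_apply)
  show ?thesis
    unfolding well_separated_def
  proof (intro ballI impI)
    fix x y assume xy: "x \<in> \<Omega>" "y \<in> \<Omega>" "x \<noteq> y"
    let ?E = "(\<lambda>z. {z}) ` sep x y"
    have "card \<Omega> \<le> 8 * (card (sep x y))\<^sup>2"
      using card_le_sep_square[OF xy d(3) _ d(4) ne _ sepb] d g by auto
    with k have "k\<^sup>2 \<le> (card (sep x y))\<^sup>2" by linarith
    then have "k \<le> card (sep x y)" using power2_le_imp_le by blast
    moreover have "card ?E = card (sep x y)" by (rule card_image) simp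
    moreover have "finite ?E" "disjoint ?E" by (auto simp: finite_sep disjoint_def)
    moreover have "\<forall>E\<in>?E. E \<subseteq> \<Omega> \<and> card E \<le> 2 \<and> separates H E x y" by (auto simp: sep_def)
    ultimately show "\<exists>\<E>. finite \<E> \<and> k \<le> card \<E> \<and> disjoint \<E> \<and>
        (\<forall>E\<in>\<E>. E \<subseteq> \<Omega> \<and> card E \<le> 2 \<and> separates H E x y)" by (intro exI[of _ ?E]) auto
  qed
qed

end

subsection \<open>Doubly transitive groups\<close>

lemma ktransD2:
  assumes "ktrans \<Omega> H 2" "x \<in> \<Omega>" "y \<in> \<Omega>" "x' \<in> \<Omega>" "y' \<in> \<Omega>" "x \<noteq> y" "x' \<noteq> y'"
  shows "\<exists>h\<in>H. h x = x' \<and> h y = y'"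
proof -
  have "\<exists>h\<in>H. map h [x, y] = [x', y']"
    using assms(1)[unfolded ktrans_def, rule_format, of "[x, y]" "[x', y']"] assms(2-) by simp
  then show ?thesis by auto
qed

context perm_group
begin

text \<open>For fixed \<open>x\<close> and \<open>y\<close> this is the neighbourhood of
  \<open>u\<close> in a graph on the other points whose edges are the separating pairs, symmetric by
  \<open>tsep_sym\<close>. Disjoint separating pairs are matchings of this graph.\<close>

definition tsep :: "'a \<Rightarrow> 'a \<Rightarrow> 'a \<Rightarrow> 'a set" where
  "tsep u x y = {v \<in> \<Omega> - {u, x, y}. separates H {u, v} x y}"

lemma finite_tsep: "finite (tsep u x y)"
  using fin by (simp add: tsep_def)

lemma tsep_image:
  assumes g: "g \<in> H"
  shows "tsep (g u) (g x) (g y) = g ` tsep u x y"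
proof (rule Set.set_eqI)
  fix v
  have "separates H {g u, v} (g x) (g y) \<longleftrightarrow> separates H {u, inv' g v} x y"
    using separates_image_iff[OF g, of "{u, inv' g v}"] g by simp
  moreover have "v \<in> g ` A \<longleftrightarrow> inv' g v \<in> A" for A
    using g by (auto intro!: image_eqI[of v g "inv' g v"])
  moreover have "inv' g v \<in> \<Omega> \<longleftrightarrow> v \<in> \<Omega>" using in_iff[OF inv_in[OF g]] .
  moreover have "v = g w \<longleftrightarrow> inv' g v = w" for w using g by auto
  ultimately show "v \<in> tsep (g u) (g x) (g y) \<longleftrightarrow> v \<in> g ` tsep u x y" by (simp add: tsep_def)
qed

lemma card_tsep_image: "g \<in> H \<Longrightarrow> card (tsep (g u) (g x) (g y)) = card (tsep u x y)"
  by (simp add: tsep_image card_image inj_on_H)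

lemma tsep_sym: "u \<in> \<Omega> - {x, y} \<Longrightarrow> v \<in> tsep u x y \<Longrightarrow> v \<in> \<Omega> - {x, y} \<and> u \<in> tsep v x y"
  by (auto simp: tsep_def insert_commute)

text \<open>The summand 1 pays for \<open>y\<close>, which may belong to the set on the left but is
  excluded from both sets on the right.\<close>

lemma card_tsep_triangle: "card (tsep u x z) \<le> card (tsep u x y) + card (tsep u z y) + 1"
proof -
  have "tsep u x z \<subseteq> insert y (tsep u x y \<union> tsep u z y)"
    unfolding tsep_def using separates_triangle separates_commute by blast
  then have "card (tsep u x z) \<le> card (insert y (tsep u x y \<union> tsep u z y))"
    by (rule card_mono[rotated]) (simp add: finite_tsep)
  also have "\<dots> \<le> Suc (card (tsep u x y \<union> tsep u z y))" by (rule card_insert_le_m1) auto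
  also have "\<dots> \<le> card (tsep u x y) + card (tsep u z y) + 1" using card_Un_le by simp
  finally show ?thesis .
qed

lemma image_Diff_H: "g \<in> H \<Longrightarrow> g ` (\<Omega> - A) = \<Omega> - g ` A"
  using image_set_diff[of g \<Omega> A] permutes_image[OF perm] inj_on_H[of g UNIV] by simp

lemma sum_tsep_image:
  assumes g: "g \<in> H"
  shows "(\<Sum>y\<in>\<Omega> - {g u, g x}. card (tsep (g u) (g x) y)) = (\<Sum>y\<in>\<Omega> - {u, x}. card (tsep u x y))"
    "(\<Sum>w\<in>\<Omega> - {g x, g y}. card (tsep w (g x) (g y))) = (\<Sum>w\<in>\<Omega> - {x, y}. card (tsep w x y))"
proof -
  have i: "\<Omega> - {g u, g x} = g ` (\<Omega> - {u, x})" for u x using image_Diff_H[OF g] by simp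
  show "(\<Sum>y\<in>\<Omega> - {g u, g x}. card (tsep (g u) (g x) y)) = (\<Sum>y\<in>\<Omega> - {u, x}. card (tsep u x y))"
    unfolding i by (subst sum.reindex[OF inj_on_H[OF g]]) (simp add: card_tsep_image[OF g])
  show "(\<Sum>w\<in>\<Omega> - {g x, g y}. card (tsep w (g x) (g y))) = (\<Sum>w\<in>\<Omega> - {x, y}. card (tsep w x y))"
    unfolding i by (subst sum.reindex[OF inj_on_H[OF g]]) (simp add: card_tsep_image[OF g])
qed

text \<open>In the graph of separating pairs of \<open>x\<close> and \<open>y\<close> let
  \<open>t\<close> be the sum of the degrees, and let \<open>M\<close> be the largest degree over
  all \<open>x\<close> and \<open>y\<close>. Double transitivity makes \<open>t\<close> independent
  of \<open>x\<close> and \<open>y\<close>, and \<open>M * (n - 3) <= 4 * t\<close> says that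
  average and maximal degree are comparable. A maximum matching with e edges has 2e endpoints, which
  cover all edges, so \<open>t\<close> is at most 4 e M and n - 3 <= 16 e.\<close>

lemma well_separated_2trans:
  assumes t2: "ktrans \<Omega> H 2" and n3: "\<not> ktrans \<Omega> H 3" and k: "16 * k + 3 \<le> card \<Omega>"
  shows "well_separated \<Omega> H k"
proof -
  define n where "n = card \<Omega>"
  define d where "d u x y = card (tsep u x y)" for u x y
  obtain xs ys where l: "length xs = 3" "length ys = 3" "distinct xs" "distinct ys" "set xs \<subseteq> \<Omega>" "set ys \<subseteq> \<Omega>"
    and no: "\<And>h. h \<in> H \<Longrightarrow> map h xs \<noteq> ys" using n3 unfolding ktrans_def by blast
  obtain a1 a2 a3 b1 b2 b3 where ab: "xs = [a1, a2, a3]" "ys = [b1, b2, b3]"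
    using l(1,2) by (auto simp: length_Suc_conv numeral_3_eq_3)
  have dab: "a1 \<in> \<Omega>" "a2 \<in> \<Omega>" "a3 \<in> \<Omega>" "b1 \<in> \<Omega>" "b2 \<in> \<Omega>" "b3 \<in> \<Omega>" "a1 \<noteq> a2" "a1 \<noteq> a3" "a2 \<noteq> a3"
    "b1 \<noteq> b2" "b1 \<noteq> b3" "b2 \<noteq> b3" using l ab by auto
  obtain g where g: "g \<in> H" "g a1 = b1" "g a2 = b2"
    using ktransD2[OF t2 dab(1,2,4,5,7,10)] by blast
  obtain u v x0 y0 where uv: "u \<in> \<Omega>" "v \<in> \<Omega>" "x0 \<in> \<Omega>" "y0 \<in> \<Omega>" "u \<noteq> v" "x0 \<notin> {u, v}" "y0 \<notin> {u, v}"
    "separates H {u, v} x0 y0"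
  proof
    have "g a3 \<noteq> g a1" "g a3 \<noteq> g a2" using g(1) dab by auto
    then show "g a3 \<notin> {b1, b2}" using g by simp
    show "b3 \<notin> {b1, b2}" "b1 \<in> \<Omega>" "b2 \<in> \<Omega>" "g a3 \<in> \<Omega>" "b3 \<in> \<Omega>" "b1 \<noteq> b2" using dab g(1) by auto
    show "separates H {b1, b2} (g a3) b3"
      unfolding separates_def
    proof (intro ballI impI notI)
      fix h assume h: "h \<in> H" "\<forall>e\<in>{b1, b2}. h e = e" "h (g a3) = b3"
      then have "h \<circ> g \<in> H" "map (h \<circ> g) xs = ys" using g comp_in ab by auto
      with no show False by blast
    qed
  qed
  have n4: "n \<ge> 3" using k by (simp add: n_def)
  have cD: "card (\<Omega> - A) = n - card A" if "A \<subseteq> \<Omega>" for A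
    unfolding n_def using card_Diff_subset that fin finite_subset by metis
  define s where "s = (\<Sum>y\<in>\<Omega> - {u, v}. d u v y)"
  have s: "(\<Sum>y\<in>\<Omega> - {u', x}. d u' x y) = s" if a: "u' \<in> \<Omega>" "x \<in> \<Omega>" "u' \<noteq> x" for u' x
  proof -
    obtain g where "g \<in> H" "g u = u'" "g v = x" using ktransD2[OF t2 uv(1,2) a(1,2) uv(5) a(3)] by blast
    then show ?thesis using sum_tsep_image(1)[of g u v] by (simp add: s_def d_def)
  qed
  define t where "t = (\<Sum>w\<in>\<Omega> - {u, v}. d w u v)"
  have t: "(\<Sum>w\<in>\<Omega> - {x, y}. d w x y) = t" if a: "x \<in> \<Omega>" "y \<in> \<Omega>" "x \<noteq> y" for x y
  proof -
    obtain g where "g \<in> H" "g u = x" "g v = y" using ktransD2[OF t2 uv(1,2) a(1,2) uv(5) a(3)] by blast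
    then show ?thesis using sum_tsep_image(2)[of g u v] by (simp add: t_def d_def)
  qed
  \<comment> \<open>With \<open>x0\<close> fixed, summing over ordered pairs of distinct points
    \<open>w\<close>, \<open>y\<close> in either order yields \<open>n - 1\<close> copies of
    \<open>s\<close> or of \<open>t\<close>.\<close>
  have st: "s = t"
  proof -
    have "(\<Sum>w\<in>\<Omega> - {x0}. \<Sum>y\<in>{y\<in>\<Omega> - {x0}. w \<noteq> y}. d w x0 y)
        = (\<Sum>y\<in>\<Omega> - {x0}. \<Sum>w\<in>{w\<in>\<Omega> - {x0}. w \<noteq> y}. d w x0 y)"
      by (rule sum.swap_restrict) (auto simp: fin)
    moreover have "{y\<in>\<Omega> - {x0}. w \<noteq> y} = \<Omega> - {w, x0}" "{w'\<in>\<Omega> - {x0}. w' \<noteq> w} = \<Omega> - {x0, w}" for w by auto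
    ultimately have "(\<Sum>w\<in>\<Omega> - {x0}. \<Sum>y\<in>\<Omega> - {w, x0}. d w x0 y) = (\<Sum>y\<in>\<Omega> - {x0}. \<Sum>w\<in>\<Omega> - {x0, y}. d w x0 y)"
      by simp
    moreover have "(\<Sum>w\<in>\<Omega> - {x0}. \<Sum>y\<in>\<Omega> - {w, x0}. d w x0 y) = (\<Sum>w\<in>\<Omega> - {x0}. s)"
      using s uv(3) by (intro sum.cong) auto
    moreover have "(\<Sum>y\<in>\<Omega> - {x0}. \<Sum>w\<in>\<Omega> - {x0, y}. d w x0 y) = (\<Sum>w\<in>\<Omega> - {x0}. t)"
      using t uv(3) by (intro sum.cong) auto
    ultimately have "(n - 1) * s = (n - 1) * t" using cD[of "{x0}"] uv(3) by (simp add: n_def)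
    then show ?thesis using n4 by simp
  qed
  define T where "T = {(w, x, y) \<in> \<Omega> \<times> \<Omega> \<times> \<Omega>. w \<noteq> x \<and> w \<noteq> y \<and> x \<noteq> y}"
  have "x0 \<noteq> y0" using uv(8) id_in unfolding separates_def by fastforce
  then have uT: "(u, x0, y0) \<in> T" using uv by (auto simp: T_def)
  have fT: "finite T" unfolding T_def by (rule finite_subset[of _ "\<Omega> \<times> \<Omega> \<times> \<Omega>"]) (use fin in auto)
  obtain w1 x1 z1 where m1: "(w1, x1, z1) \<in> T"
    and max: "\<And>w x y. (w, x, y) \<in> T \<Longrightarrow> d w x y \<le> d w1 x1 z1"
  proof -
    let ?D = "(\<lambda>(w, x, y). d w x y) ` T"
    have fD: "finite ?D" using fT by simp
    have "Max ?D \<in> ?D" by (rule Max_in[OF fD]) (use uT in blast)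
    then obtain w1 x1 z1 where 1: "(w1, x1, z1) \<in> T" "Max ?D = d w1 x1 z1" by auto
    have "d w x y \<le> d w1 x1 z1" if "(w, x, y) \<in> T" for w x y
      unfolding 1(2)[symmetric] by (rule Max_ge[OF fD]) (use that in force)
    with 1(1) show thesis by (rule that)
  qed
  define M where "M = d w1 x1 z1"
  have M1: "M \<ge> 1"
  proof -
    have "v \<in> tsep u x0 y0" using uv by (auto simp: tsep_def)
    then have "d u x0 y0 > 0" unfolding d_def using finite_tsep by (auto simp: card_gt_0_iff)
    then show ?thesis using max[OF uT] by (simp add: M_def)
  qed
  \<comment> \<open>The triple attaining the maximum: by the triangle inequality every further point
    \<open>y\<close> has total degree at least \<open>M - 1\<close> towards its two ends.\<close>
  have s1: "(M - 1) * (n - 3) \<le> 2 * s"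
  proof -
    have w: "w1 \<in> \<Omega>" "x1 \<in> \<Omega>" "z1 \<in> \<Omega>" "w1 \<noteq> x1" "w1 \<noteq> z1" "x1 \<noteq> z1" using m1 by (auto simp: T_def)
    have c3: "card {w1, x1, z1} = 3" using w by simp
    have "(M - 1) * (n - 3) = (\<Sum>y\<in>\<Omega> - {w1, x1, z1}. M - 1)"
      using cD[of "{w1, x1, z1}"] w unfolding c3 by simp
    also have "\<dots> \<le> (\<Sum>y\<in>\<Omega> - {w1, x1, z1}. d w1 x1 y + d w1 z1 y)"
      unfolding M_def d_def using card_tsep_triangle[of w1 x1 z1] by (intro sum_mono) (simp add: le_diff_conv)
    also have "\<dots> = (\<Sum>y\<in>\<Omega> - {w1, x1, z1}. d w1 x1 y) + (\<Sum>y\<in>\<Omega> - {w1, x1, z1}. d w1 z1 y)"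
      by (rule sum.distrib)
    also have "\<dots> \<le> (\<Sum>y\<in>\<Omega> - {w1, x1}. d w1 x1 y) + (\<Sum>y\<in>\<Omega> - {w1, z1}. d w1 z1 y)"
      using fin by (intro add_mono sum_mono2) auto
    also have "\<dots> = 2 * s" using s w by simp
    finally show ?thesis .
  qed
  \<comment> \<open>The stabilizer of \<open>u\<close> and \<open>v\<close> has two orbits on the
    remaining points, so one of them has at most half of these. The pair of \<open>u\<close> and
    \<open>v\<close> separates a point of that orbit from everything outside it.\<close>
  have s2: "n - 2 \<le> 2 * s"
  proof -
    define O' where "O' x = {h x | h. h \<in> H \<and> h u = u \<and> h v = v}" for x
    have sub: "O' x \<subseteq> \<Omega> - {u, v}" if x: "x \<in> \<Omega> - {u, v}" for x
    proof
      fix w assume "w \<in> O' x"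
      then obtain h where h: "h \<in> H" "h u = u" "h v = v" "w = h x" by (auto simp: O'_def)
      then have "h x \<noteq> h u" "h x \<noteq> h v" using x by auto
      then show "w \<in> \<Omega> - {u, v}" using h x by auto
    qed
    have self: "x \<in> O' x" for x unfolding O'_def by (intro CollectI exI[of _ id]) (simp add: id_in)
    have "O' x0 \<inter> O' y0 = {}"
    proof (rule ccontr)
      assume "\<not> ?thesis"
      then obtain w where w: "w \<in> O' x0" "w \<in> O' y0" by blast
      obtain h where h: "h \<in> H" "h u = u" "h v = v" "w = h x0" using w(1) unfolding O'_def by blast
      obtain k where k: "k \<in> H" "k u = u" "k v = v" "w = k y0" using w(2) unfolding O'_def by blast
      have "inv' k \<circ> h \<in> H" "(inv' k \<circ> h) u = u" "(inv' k \<circ> h) v = v" "(inv' k \<circ> h) x0 = y0"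
        using h k comp_in inv_in by (auto simp: apply_eq_iff[symmetric])
      then show False using uv(8) unfolding separates_def by blast
    qed
    then have "card (O' x0) + card (O' y0) = card (O' x0 \<union> O' y0)"
      using sub uv fin by (intro card_Un_disjoint[symmetric]) (auto intro: finite_subset[OF sub])
    also have "\<dots> \<le> card (\<Omega> - {u, v})" using sub uv fin by (intro card_mono) auto
    also have "\<dots> = n - 2" using cD[of "{u, v}"] uv by simp
    finally have "2 * card (O' x0) \<le> n - 2 \<or> 2 * card (O' y0) \<le> n - 2" by linarith
    then obtain x where x: "x \<in> \<Omega>" "x \<notin> {u, v}" "2 * card (O' x) \<le> n - 2" using uv(3,4,6,7) by blast
    have Ox: "O' x \<subseteq> \<Omega> - {u, v}" using sub x by blast
    have d1: "1 \<le> d u x y" if y: "y \<in> \<Omega> - {u, v} - O' x" for y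
    proof -
      have "separates H {u, v} x y" using y unfolding separates_def O'_def by blast
      then have "v \<in> tsep u x y" using uv x y by (auto simp: tsep_def)
      then show ?thesis unfolding d_def using finite_tsep by (simp add: Suc_le_eq card_gt_0_iff) blast
    qed
    have "n - 2 - card (O' x) = card (\<Omega> - {u, v} - O' x)"
      using cD[of "{u, v}"] uv card_Diff_subset[of "O' x" "\<Omega> - {u, v}"] Ox fin finite_subset[OF Ox] by simp
    also have "\<dots> = (\<Sum>y\<in>\<Omega> - {u, v} - O' x. 1)" by simp
    also have "\<dots> \<le> (\<Sum>y\<in>\<Omega> - {u, v} - O' x. d u x y)" using d1 by (rule sum_mono)
    also have "\<dots> \<le> (\<Sum>y\<in>\<Omega> - {u, x}. d u x y)" using fin self[of x] by (intro sum_mono2) auto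
    also have "\<dots> = s" using s uv x by auto
    finally show ?thesis using x(3) by linarith
  qed
  have s4: "M * (n - 3) \<le> 4 * s"
  proof -
    have "M * (n - 3) = (M - 1) * (n - 3) + (n - 3)" using M1 by (simp add: diff_mult_distrib)
    with s1 s2 show ?thesis by linarith
  qed
  show ?thesis
    unfolding well_separated_def
  proof (intro ballI impI)
    fix x y assume xy: "x \<in> \<Omega>" "y \<in> \<Omega>" "x \<noteq> y"
    \<comment> \<open>The edges of the graph; members of \<open>\<F>\<close> are its matchings, and
      \<open>\<E>\<close> is chosen as one of maximum size.\<close>
    define X where "X = {{w, v} | w v. w \<in> \<Omega> - {x, y} \<and> v \<in> tsep w x y}"
    define \<F> where "\<F> = {\<E>. \<E> \<subseteq> X \<and> disjoint \<E>}"
    have "X \<subseteq> Pow \<Omega>" by (auto simp: X_def tsep_def)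
    then have fX: "finite X" by (rule finite_subset) (use fin in simp)
    then have "finite \<F>" unfolding \<F>_def by - (rule finite_subset[of _ "Pow X"], auto)
    have "{} \<in> \<F>" by (auto simp: \<F>_def)
    with \<open>finite \<F>\<close> have "Max (card ` \<F>) \<in> card ` \<F>" by (intro Max_in) auto
    then obtain \<E> where E1: "\<E> \<in> \<F>" "Max (card ` \<F>) = card \<E>" by auto
    have E: "\<E> \<in> \<F>" "\<And>\<E>'. \<E>' \<in> \<F> \<Longrightarrow> card \<E>' \<le> card \<E>"
      using E1(1) Max_ge[OF finite_imageI[OF \<open>finite \<F>\<close>]] unfolding E1(2)[symmetric] by blast+
    have EX: "\<E> \<subseteq> X" "disjoint \<E>" using E(1) by (auto simp: \<F>_def)
    have fE: "finite \<E>" using EX(1) fX finite_subset by blast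
    have X2: "A \<subseteq> \<Omega> \<and> card A \<le> 2 \<and> separates H A x y" if "A \<in> X" for A
      using that by (auto simp: X_def tsep_def card_insert_if)
    define W where "W = \<Union>\<E>"
    have "card W \<le> (\<Sum>A\<in>\<E>. card A)" unfolding W_def by (rule card_Union_le_sum_card)
    also have "\<dots> \<le> (\<Sum>A\<in>\<E>. 2)" using X2 EX(1) by (intro sum_mono) blast
    finally have W: "card W \<le> 2 * card \<E>" by simp
    have fW: "finite W" and WO: "W \<subseteq> \<Omega>" using X2 EX(1) fin finite_subset[of W \<Omega>] unfolding W_def by blast+
    \<comment> \<open>An edge with both ends outside \<open>W\<close> could be added to the
      matching.\<close>
    have cover: "w \<in> W \<or> v \<in> W" if wv: "w \<in> \<Omega> - {x, y}" "v \<in> tsep w x y" for w v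
    proof (rule ccontr)
      assume n: "\<not> (w \<in> W \<or> v \<in> W)"
      then have "{w, v} \<notin> \<E>" unfolding W_def by blast
      then have "card (insert {w, v} \<E>) = Suc (card \<E>)" using fE by simp
      moreover have "insert {w, v} \<E> \<in> \<F>"
        using EX n wv unfolding \<F>_def X_def disjoint_def W_def by blast
      ultimately show False using E(2) by fastforce
    qed
    let ?P = "SIGMA w:\<Omega> - {x, y}. tsep w x y" and ?Q = "SIGMA w:W \<inter> (\<Omega> - {x, y}). tsep w x y"
    have "?P \<subseteq> ?Q \<union> prod.swap ` ?Q"
    proof
      fix p assume p: "p \<in> ?P"
      obtain w v where wv: "p = (w, v)" by force
      with p have 1: "w \<in> \<Omega> - {x, y}" "v \<in> tsep w x y" by auto
      note 2 = tsep_sym[OF 1]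
      show "p \<in> ?Q \<union> prod.swap ` ?Q"
      proof (cases "w \<in> W")
        case False
        then have "(v, w) \<in> ?Q" using cover[OF 1] 2 by auto
        then have "prod.swap (v, w) \<in> prod.swap ` ?Q" by (rule imageI)
        then show ?thesis using wv by simp
      qed (use 1 wv in auto)
    qed
    moreover have fQ: "finite ?Q" using fin finite_tsep by (intro finite_SigmaI) auto
    ultimately have "card ?P \<le> card (?Q \<union> prod.swap ` ?Q)" by (intro card_mono) auto
    also have "\<dots> \<le> card ?Q + card (prod.swap ` ?Q)" by (rule card_Un_le)
    also have "\<dots> \<le> 2 * card ?Q" using card_image_le[OF fQ, of prod.swap] by simp
    also have "card ?Q = (\<Sum>w\<in>W \<inter> (\<Omega> - {x, y}). d w x y)"
      unfolding d_def using fin finite_tsep by (intro card_SigmaI) auto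
    also have "\<dots> \<le> (\<Sum>w\<in>W \<inter> (\<Omega> - {x, y}). M)"
      unfolding M_def using xy by (intro sum_mono max) (auto simp: T_def)
    also have "\<dots> = card (W \<inter> (\<Omega> - {x, y})) * M" by simp
    also have "\<dots> \<le> (2 * card \<E>) * M"
      using W card_mono[OF fW, of "W \<inter> (\<Omega> - {x, y})"] by (intro mult_le_mono1) auto
    finally have "card ?P \<le> 4 * card \<E> * M" by simp
    moreover have "card ?P = t"
      unfolding t[OF xy, symmetric] d_def using fin finite_tsep by (intro card_SigmaI) auto
    ultimately have "M * (n - 3) \<le> M * (16 * card \<E>)" using s4 st by (simp add: algebra_simps)
    then have "n - 3 \<le> 16 * card \<E>" using M1 by simp
    then have "k \<le> card \<E>" using k by (simp add: n_def)
    then show "\<exists>\<E>. finite \<E> \<and> k \<le> card \<E> \<and> disjoint \<E> \<and>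
        (\<forall>E\<in>\<E>. E \<subseteq> \<Omega> \<and> card E \<le> 2 \<and> separates H E x y)"
      using fE EX X2 by (intro exI[of _ \<E>]) blast
  qed
qed

end

subsection \<open>Highly transitive groups\<close>

lemma extend_distinct_list:
  assumes "finite \<Omega>" "distinct xs" "set xs \<subseteq> \<Omega>" "length xs \<le> k" "k \<le> card \<Omega>"
  shows "\<exists>zs. distinct (xs @ zs) \<and> set zs \<subseteq> \<Omega> \<and> length (xs @ zs) = k"
proof -
  have "card (\<Omega> - set xs) = card \<Omega> - length xs"
    using assms by (simp add: card_Diff_subset distinct_card)
  then obtain Z where Z: "Z \<subseteq> \<Omega> - set xs" "card Z = k - length xs" "finite Z"
    using assms obtain_subset_with_card_n[of "k - length xs" "\<Omega> - set xs"] by (metis diff_le_mono)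
  obtain zs where zs: "set zs = Z" "distinct zs" using finite_distinct_list[OF Z(3)] by blast
  then have "length zs = k - length xs" using Z(2) distinct_card by metis
  with zs Z assms show ?thesis by (intro exI[of _ zs]) auto
qed

lemma ktrans_mono:
  assumes "finite \<Omega>" "ktrans \<Omega> H k" "j \<le> k" "k \<le> card \<Omega>"
  shows "ktrans \<Omega> H j"
  unfolding ktrans_def
proof (intro allI impI)
  fix xs ys
  assume a: "length xs = j" "length ys = j" "distinct xs" "distinct ys" "set xs \<subseteq> \<Omega>" "set ys \<subseteq> \<Omega>"
  obtain us where us: "distinct (xs @ us)" "set us \<subseteq> \<Omega>" "length (xs @ us) = k"
    using extend_distinct_list[of \<Omega> xs k] assms a by auto
  obtain vs where vs: "distinct (ys @ vs)" "set vs \<subseteq> \<Omega>" "length (ys @ vs) = k"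
    using extend_distinct_list[of \<Omega> ys k] assms a by auto
  have "set (xs @ us) \<subseteq> \<Omega>" "set (ys @ vs) \<subseteq> \<Omega>" using a us vs by auto
  then obtain h where h: "h \<in> H" "map h (xs @ us) = ys @ vs"
    using assms(2)[unfolded ktrans_def, rule_format, OF us(3) vs(3) us(1) vs(1)] by blast
  have "map h xs = ys" using h(2) a(1,2) by (auto simp: append_eq_append_conv)
  with h(1) show "\<exists>h\<in>H. map h xs = ys" by blast
qed

context perm_group
begin

lemma ktrans_stab:
  assumes t: "ktrans \<Omega> H (card W + j)" and W: "W \<subseteq> \<Omega>"
  shows "ktrans (\<Omega> - W) (stab W H) j"
  unfolding ktrans_def
proof (intro allI impI)
  fix xs ys
  assume a: "length xs = j" "length ys = j" "distinct xs" "distinct ys" "set xs \<subseteq> \<Omega> - W" "set ys \<subseteq> \<Omega> - W"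
  have "finite W" using W fin finite_subset by blast
  then obtain ws where ws: "set ws = W" "distinct ws" "length ws = card W"
    using finite_distinct_list distinct_card by metis
  have "\<exists>h\<in>H. map h (ws @ xs) = ws @ ys"
    using t[unfolded ktrans_def, rule_format, of "ws @ xs" "ws @ ys"] a ws W by auto
  then obtain h where h: "h \<in> H" "map h ws = ws" "map h xs = ys" by (auto simp: append_eq_append_conv)
  have "map h ws = map (\<lambda>w. w) ws" using h(2) by simp
  then have "\<forall>w\<in>W. h w = w" unfolding map_eq_conv ws(1) .
  with h show "\<exists>h\<in>stab W H. map h xs = ys" by (auto simp: stab_def)
qed

text \<open>Both lists are carried to lists starting with one fixed enumeration of \<open>W\<close>;
  an element of the stabilizer then adjusts the remaining entries.\<close>

lemma ktrans_of_stab: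
  assumes t: "ktrans \<Omega> H (card W)" and W: "W \<subseteq> \<Omega>" and s: "ktrans (\<Omega> - W) (stab W H) j"
  shows "ktrans \<Omega> H (card W + j)"
  unfolding ktrans_def
proof (intro allI impI)
  fix xs ys
  assume a: "length xs = card W + j" "length ys = card W + j" "distinct xs" "distinct ys" "set xs \<subseteq> \<Omega>" "set ys \<subseteq> \<Omega>"
  have "finite W" using W fin finite_subset by blast
  then obtain ws where ws: "set ws = W" "distinct ws" "length ws = card W"
    using finite_distinct_list distinct_card by metis
  have *: "\<exists>g\<in>H. map g (take (card W) zs) = ws \<and> distinct (map g (drop (card W) zs)) \<and>
      set (map g (drop (card W) zs)) \<subseteq> \<Omega> - W"
    if z: "length zs = card W + j" "distinct zs" "set zs \<subseteq> \<Omega>" for zs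
  proof -
    have 1: "set (take (card W) zs) \<subseteq> \<Omega>" using set_take_subset z(3) by (rule subset_trans)
    have 2: "length (take (card W) zs) = card W" "distinct (take (card W) zs)" "set ws \<subseteq> \<Omega>"
      using z(1,2) ws(1) W by simp_all
    have "\<exists>g\<in>H. map g (take (card W) zs) = ws"
      by (rule t[unfolded ktrans_def, rule_format, OF 2(1) ws(3) 2(2) ws(2) 1 2(3)])
    then obtain g where g: "g \<in> H" "map g (take (card W) zs) = ws" by blast
    have "map g zs = map g (take (card W) zs) @ map g (drop (card W) zs)" by (simp only: map_append[symmetric] append_take_drop_id)
    then have e: "map g zs = ws @ map g (drop (card W) zs)" unfolding g(2) .
    have "distinct (map g zs)" using z(2) inj_on_H[OF g(1)] by (simp add: distinct_map)
    then have d: "distinct (map g (drop (card W) zs))" "set ws \<inter> set (map g (drop (card W) zs)) = {}"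
      unfolding e distinct_append by simp_all
    have "set (map g zs) \<subseteq> \<Omega>" using z(3) g(1) by auto
    then have "set (map g (drop (card W) zs)) \<subseteq> \<Omega>" unfolding e set_append by simp
    with d(2) have "set (map g (drop (card W) zs)) \<subseteq> \<Omega> - W" unfolding ws(1) by blast
    with d(1) g show ?thesis by (intro bexI[of _ g] conjI)
  qed
  obtain g where g: "g \<in> H" "map g (take (card W) xs) = ws" "distinct (map g (drop (card W) xs))"
      "set (map g (drop (card W) xs)) \<subseteq> \<Omega> - W" using *[OF a(1,3,5)] by blast
  obtain g' where g': "g' \<in> H" "map g' (take (card W) ys) = ws" "distinct (map g' (drop (card W) ys))"
      "set (map g' (drop (card W) ys)) \<subseteq> \<Omega> - W" using *[OF a(2,4,6)] by blast
  have "length (map g (drop (card W) xs)) = j" "length (map g' (drop (card W) ys)) = j"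
    using a(1,2) by simp_all
  then have "\<exists>k\<in>stab W H. map k (map g (drop (card W) xs)) = map g' (drop (card W) ys)"
    by (rule s[unfolded ktrans_def, rule_format, OF _ _ g(3) g'(3) g(4) g'(4)])
  then obtain k where k: "k \<in> stab W H" "map k (map g (drop (card W) xs)) = map g' (drop (card W) ys)"
    by blast
  have kH: "k \<in> H" and kW: "map k ws = ws" using k(1) ws(1) by (auto simp: stab_def intro: map_idI)
  have "map (k \<circ> g) xs = map (k \<circ> g) (take (card W) xs) @ map (k \<circ> g) (drop (card W) xs)"
    by (simp only: map_append[symmetric] append_take_drop_id)
  also have "map (k \<circ> g) (take (card W) xs) = map g' (take (card W) ys)"
    using g(2) g'(2) kW by (metis map_map)
  also have "map (k \<circ> g) (drop (card W) xs) = map g' (drop (card W) ys)" using k(2) by simp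
  also have "map g' (take (card W) ys) @ map g' (drop (card W) ys) = map g' ys"
    by (simp only: map_append[symmetric] append_take_drop_id)
  finally have "map (inv' g') (map (k \<circ> g) xs) = map (inv' g') (map g' ys)" by (rule arg_cong)
  then have "map (inv' g' \<circ> (k \<circ> g)) xs = ys" using g'(1) by (simp add: comp_def)
  moreover have "inv' g' \<circ> (k \<circ> g) \<in> H" using g(1) g'(1) kH comp_in inv_in by blast
  ultimately show "\<exists>h\<in>H. map h xs = ys" by blast
qed

text \<open>Fixing \<open>t - 2\<close> points leaves a doubly but not triply transitive group on
  \<open>card \<Omega> - (t - 2)\<close> points; the condition on \<open>k\<close> is that of
  \<open>well_separated_2trans\<close> for this number.\<close>

lemma well_separated_stab:
  assumes t: "2 \<le> t" "ktrans \<Omega> H t" "\<not> ktrans \<Omega> H (Suc t)" and tn: "t \<le> card \<Omega>"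
    and W: "W \<subseteq> \<Omega>" "card W = t - 2" and k: "16 * k + 1 + t \<le> card \<Omega>"
  shows "well_separated (\<Omega> - W) (stab W H) k"
proof -
  interpret K: perm_group "\<Omega> - W" "stab W H" by (rule perm_group_stab)
  show ?thesis
  proof (rule K.well_separated_2trans)
    show "ktrans (\<Omega> - W) (stab W H) 2" 
    proof (rule ktrans_stab[OF _ W(1)])
      have "card W + 2 = t" using t(1) W(2) by simp
      then show "ktrans \<Omega> H (card W + 2)" using t(2) by simp
    qed
    have "ktrans \<Omega> H (card W)" using ktrans_mono[OF fin t(2) _ tn] W(2) by simp
    moreover have "card W + 3 = Suc t" using t(1) W(2) by simp
    ultimately show "\<not> ktrans (\<Omega> - W) (stab W H) 3"
      using ktrans_of_stab[OF _ W(1), of 3] t(3) by metis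
    show "16 * k + 3 \<le> card (\<Omega> - W)"
      using k t(1) W fin card_Diff_subset[of W \<Omega>] finite_subset[of W \<Omega>] by auto
  qed
qed

text \<open>Here \<open>least_power h x\<close> is the length of the cycle of \<open>h\<close>
  through \<open>x\<close>.\<close>

lemma least_power_le_card:
  assumes h: "h \<in> H" and x: "x \<in> \<Omega>"
  shows "least_power h x \<le> card \<Omega>"
proof -
  have p: "permutation h" using perm[OF h] fin permutation_permutes by blast
  have "distinct (support h x)" by (rule cycle_of_permutation[OF p])
  moreover have "set (support h x) \<subseteq> \<Omega>" using funpow_in[OF h] x by auto
  ultimately show ?thesis using card_mono[OF fin, of "set (support h x)"] distinct_card by fastforce
qed

end

section \<open>Cycles of prescribed prime power lengths and elements of small support\<close>

lemma split_list_lengths: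
  "length xs = sum_list qs \<Longrightarrow> \<exists>bs. map length bs = qs \<and> concat bs = xs"
proof (induction qs arbitrary: xs)
  case (Cons q qs)
  then obtain bs where "map length bs = qs" "concat bs = drop q xs"
    by (metis add_diff_cancel_left' length_drop sum_list.Cons)
  then show ?case using Cons.prems by (intro exI[of _ "take q xs # bs"]) auto
qed simp

lemma least_power_rotate:
  assumes "map h b = rotate1 b" "distinct b" "b \<noteq> []"
  shows "least_power h (hd b) = length b"
proof -
  have step: "h (b ! i) = b ! (Suc i mod length b)" if "i < length b" for i
    using assms(1) nth_rotate1[OF that] that by (metis nth_map)
  have pow: "(h ^^ i) (b ! 0) = b ! (i mod length b)" for i
  proof (induction i)
    case (Suc i)
    have "(h ^^ Suc i) (b ! 0) = h (b ! (i mod length b))" using Suc by simp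
    also have "\<dots> = b ! (Suc (i mod length b) mod length b)" using assms(3) by (intro step) simp
    finally show ?case by (simp add: mod_Suc_eq)
  qed (use assms(3) in simp)
  show ?thesis
    unfolding least_power_def hd_conv_nth[OF assms(3)]
  proof (rule Least_equality)
    show "(h ^^ length b) (b ! 0) = b ! 0 \<and> 0 < length b" using pow[of "length b"] assms(3) by simp
    fix i assume i: "(h ^^ i) (b ! 0) = b ! 0 \<and> 0 < i"
    then have "b ! (i mod length b) = b ! 0" using pow by metis
    then have "i mod length b = 0" using assms(2,3) by (simp add: nth_eq_iff_index_eq)
    then show "length b \<le> i" using i by (metis mod_less not_le less_nat_zero_code)
  qed
qed

text \<open>\<open>N\<close> is the factorial of \<open>n\<close> with its p-part replaced by
  \<open>p ^ (a - 1)\<close>. Every \<open>l\<close> up to \<open>n\<close> divides the factorial,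
  so its p-free part always divides \<open>N\<close> and only its power of \<open>p\<close> decides.
  Raising to the power \<open>N\<close> thus kills exactly the cycles whose length is not divisible
  by \<open>p ^ a\<close>.\<close>

lemma prime_power_exponent:
  fixes p a n :: nat
  assumes p: "prime p" and a: "a > 0"
  obtains N where "\<And>l. 0 < l \<Longrightarrow> l \<le> n \<Longrightarrow> l dvd N \<longleftrightarrow> \<not> p ^ a dvd l"
proof -
  obtain m where m: "fact n = p ^ multiplicity p (fact n) * m" "\<not> p dvd m"
    using multiplicity_decompose'[of "fact n :: nat" p] p by (metis fact_nonzero not_prime_unit)
  define N where "N = p ^ (a - 1) * m"
  have "l dvd N \<longleftrightarrow> \<not> p ^ a dvd l" if l: "0 < l" "l \<le> n" for l
  proof
    assume "l dvd N"
    show "\<not> p ^ a dvd l"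
    proof
      assume "p ^ a dvd l"
      with \<open>l dvd N\<close> have "p ^ a dvd p ^ (a - 1) * m" unfolding N_def by (rule dvd_trans[rotated])
      moreover have "p ^ a = p ^ (a - 1) * p" using a by (metis power_Suc2 Suc_diff_1)
      moreover have "0 < p ^ (a - 1)" using p by (simp add: prime_gt_0_nat)
      ultimately have "p dvd m" using nat_mult_dvd_cancel1[of "p ^ (a - 1)" p m] by (simp only:)
      with m(2) show False by blast
    qed
  next
    assume na: "\<not> p ^ a dvd l"
    obtain l' where l': "l = p ^ multiplicity p l * l'" "\<not> p dvd l'"
      using multiplicity_decompose'[of l p] l(1) p by (metis not_prime_unit less_irrefl)
    have "\<not> a \<le> multiplicity p l" using na l'(1) by (metis dvd_mult2 le_imp_power_dvd)
    then have "p ^ multiplicity p l dvd p ^ (a - 1)" by (intro le_imp_power_dvd) auto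
    moreover have "l' dvd m"
    proof -
      have "l dvd fact n" using l by (simp add: dvd_fact)
      then have "l' dvd p ^ multiplicity p (fact n) * m" using l'(1) m(1) by (metis dvd_mult_right)
      moreover have "coprime l' (p ^ multiplicity p (fact n))"
        using p l'(2) by (metis coprime_commute coprime_power_left_iff prime_imp_coprime)
      ultimately show ?thesis by (simp add: coprime_dvd_mult_right_iff)
    qed
    ultimately show "l dvd N" unfolding N_def by (subst l'(1)) (rule mult_dvd_mono)
  qed
  then show ?thesis by (rule that)
qed

context perm_group
begin

text \<open>Let \<open>h\<close> act on some points with cycles of lengths \<open>q\<^sub>p = p ^ a p\<close>. A suitable power of \<open>h\<close> moves
  exactly the points whose cycle length is divisible by \<open>q\<^sub>p\<close>; as \<open>q\<^sub>p q\<^sub>p\<^sub>' > card \<Omega>\<close>, these sets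
  are disjoint for different \<open>p\<close>, so one of them is small.\<close>

lemma small_support_element:
  fixes P :: "nat set" and a :: "nat \<Rightarrow> nat"
  assumes P: "finite P" "P \<noteq> {}" "\<And>p. p \<in> P \<Longrightarrow> prime p \<and> 0 < a p \<and> card \<Omega> < (p ^ a p)\<^sup>2"
    and t: "ktrans \<Omega> H (\<Sum>p\<in>P. p ^ a p)" "(\<Sum>p\<in>P. p ^ a p) \<le> card \<Omega>"
  obtains g where "g \<in> H" "g \<noteq> id" "card P * card (moved g) \<le> card \<Omega>"
proof -
  define q where "q p = p ^ a p" for p
  obtain ps where ps: "set ps = P" "distinct ps" using finite_distinct_list[OF P(1)] by blast
  have sl: "sum_list (map q ps) = (\<Sum>p\<in>P. q p)" using ps by (simp add: sum_list_distinct_conv_sum_set)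
  obtain L where L: "distinct L" "set L \<subseteq> \<Omega>" "length L = (\<Sum>p\<in>P. q p)"
    using extend_distinct_list[of \<Omega> "[]" "\<Sum>p\<in>P. q p"] fin t(2) by (auto simp: q_def)
  obtain bs where bs: "map length bs = map q ps" "concat bs = L"
    using split_list_lengths[of L "map q ps"] L(3) sl by auto
  \<comment> \<open>An element mapping \<open>L\<close> to this list has every block of
    \<open>bs\<close> as a cycle.\<close>
  let ?L' = "concat (map rotate1 bs)"
  have "mset (rotate1 b) = mset b" for b :: "'a list" by (cases b) auto
  then have "mset ?L' = mset L" unfolding bs(2)[symmetric] by (simp add: mset_concat comp_def)
  then have L': "distinct ?L'" "set ?L' = set L" "length ?L' = length L"
    using L(1) mset_eq_imp_distinct_iff mset_eq_setD mset_eq_length by blast+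
  obtain h where h: "h \<in> H" "map h L = ?L'"
    using t(1)[unfolded ktrans_def, rule_format, of L ?L'] L L' by (auto simp: q_def)
  have "concat (map (map h) bs) = concat (map rotate1 bs)" using h(2) bs(2) by (metis map_concat)
  then have mb: "map (map h) bs = map rotate1 bs"
    by (subst (asm) concat_eq_concat_iff) (auto simp: zip_map_map zip_same)
  have point: "\<exists>x\<in>\<Omega>. least_power h x = q p" if p: "p \<in> P" for p
  proof -
    obtain i where i: "i < length ps" "ps ! i = p" using p ps(1) by (metis in_set_conv_nth)
    have lb: "length bs = length ps" using bs(1) by (metis length_map)
    have "length (bs ! i) = map length bs ! i" using i lb by simp
    also have "\<dots> = q p" unfolding bs(1) using i by simp
    finally have b: "bs ! i \<in> set bs" "length (bs ! i) = q p" using i lb by auto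
    have "q p > 0" using P(3)[OF p] prime_gt_0_nat by (simp add: q_def)
    then have ne: "bs ! i \<noteq> []" using b(2) by auto
    have "distinct (bs ! i)" using L(1) bs(2) b(1) by (metis distinct_concat_iff)
    moreover have "map h (bs ! i) = rotate1 (bs ! i)" using mb b(1) by (metis map_eq_conv)
    ultimately have "least_power h (hd (bs ! i)) = q p" using least_power_rotate ne b(2) by metis
    moreover have "hd (bs ! i) \<in> \<Omega>" using ne b(1) L(2) bs(2) by (metis UN_I hd_in_set set_concat subsetD)
    ultimately show ?thesis by blast
  qed
  have hp: "permutation h" using perm[OF h(1)] fin permutation_permutes by blast
  have "\<exists>N. \<forall>l. 0 < l \<longrightarrow> l \<le> card \<Omega> \<longrightarrow> (l dvd N \<longleftrightarrow> \<not> q p dvd l)" if "p \<in> P" for p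
    using prime_power_exponent[of p "a p" "card \<Omega>"] P(3)[OF that] unfolding q_def by metis
  then obtain N where N: "\<And>p l. p \<in> P \<Longrightarrow> 0 < l \<Longrightarrow> l \<le> card \<Omega> \<Longrightarrow> l dvd N p \<longleftrightarrow> \<not> q p dvd l" by metis
  have mv: "(h ^^ N p) x \<noteq> x \<longleftrightarrow> q p dvd least_power h x" if "p \<in> P" "x \<in> \<Omega>" for p x
    using N[OF that(1) least_power_of_permutation(2)[OF hp] least_power_le_card[OF h(1) that(2)]]
      least_power_dvd[OF hp] by blast
  have gH: "h ^^ N p \<in> H" for p using funpow_in[OF h(1)] .
  have disj: "moved (h ^^ N p) \<inter> moved (h ^^ N p') = {}" if pp: "p \<in> P" "p' \<in> P" "p \<noteq> p'" for p p'
  proof (rule ccontr)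
    assume "\<not> ?thesis"
    then obtain x where x: "x \<in> moved (h ^^ N p)" "x \<in> moved (h ^^ N p')" by blast
    then have xO: "x \<in> \<Omega>" using moved_subset[OF gH] by blast
    have dv: "q p dvd least_power h x" "q p' dvd least_power h x"
      using x mv[OF pp(1) xO] mv[OF pp(2) xO] by (auto simp: moved_def)
    have "coprime p p'" using primes_coprime P(3) pp by blast
    then have "coprime (q p) (q p')" by (simp add: q_def)
    then have "q p * q p' dvd least_power h x" using dv by (simp add: divides_mult)
    then have "q p * q p' \<le> card \<Omega>"
      using dvd_imp_le[OF _ least_power_of_permutation(2)[OF hp]] least_power_le_card[OF h(1) xO] le_trans by blast
    then have "(q p * q p')\<^sup>2 \<le> (card \<Omega>)\<^sup>2" by (rule power_mono) simp
    moreover have "card \<Omega> * card \<Omega> < (q p)\<^sup>2 * (q p')\<^sup>2"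
      using P(3)[OF pp(1)] P(3)[OF pp(2)] unfolding q_def by (intro mult_strict_mono) (auto simp: prime_gt_0_nat)
    ultimately show False by (simp add: power2_eq_square mult_ac)
  qed
  have "(\<Sum>p\<in>P. card (moved (h ^^ N p))) = card (\<Union>p\<in>P. moved (h ^^ N p))"
    using P(1) disj finite_moved[OF gH] by (intro card_UN_disjoint[symmetric]) auto
  also have "\<dots> \<le> card \<Omega>" using moved_subset[OF gH] by (intro card_mono[OF fin]) blast
  finally have total: "(\<Sum>p\<in>P. card (moved (h ^^ N p))) \<le> card \<Omega>" .
  have "\<exists>p\<in>P. card P * card (moved (h ^^ N p)) \<le> card \<Omega>"
  proof (rule ccontr)
    assume "\<not> ?thesis"
    then have "(\<Sum>p\<in>P. card \<Omega>) < (\<Sum>p\<in>P. card P * card (moved (h ^^ N p)))"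
      using P(1,2) by (intro sum_strict_mono) auto
    then have "card P * card \<Omega> < card P * (\<Sum>p\<in>P. card (moved (h ^^ N p)))"
      by (simp add: sum_distrib_left)
    with total show False by simp
  qed
  then obtain p where p: "p \<in> P" "card P * card (moved (h ^^ N p)) \<le> card \<Omega>" by blast
  obtain x where x: "x \<in> \<Omega>" "least_power h x = q p" using point[OF p(1)] by blast
  then have "(h ^^ N p) x \<noteq> x" using mv[OF p(1) x(1)] by simp
  then have "h ^^ N p \<noteq> id" by auto
  then show ?thesis using that gH p(2) by blast
qed

end

section \<open>Minimal degree, three-cycles and the degree of transitivity\<close>

context perm_group
begin

text \<open>If \<open>h\<close> fixes at least half of the points, the \<open>t - 2\<close> points
  of \<open>W\<close> can be chosen among its fixed points; then \<open>h\<close> lies in the well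
  separated stabilizer of \<open>W\<close>. Otherwise it moves more than half of the points
  anyway.\<close>

lemma min_degree_stab:
  assumes t: "2 \<le> t" "ktrans \<Omega> H t" "\<not> ktrans \<Omega> H (Suc t)" "2 * t \<le> card \<Omega>"
    and k: "16 * k + 1 + t \<le> card \<Omega>" and h: "h \<in> H" "h \<noteq> id"
  shows "k \<le> card (moved h)"
proof (cases "2 * card (moved h) \<le> card \<Omega>")
  case True
  have "card (\<Omega> - moved h) = card \<Omega> - card (moved h)"
    using moved_subset[OF h(1)] finite_moved[OF h(1)] by (rule card_Diff_subset[rotated])
  then have "t - 2 \<le> card (\<Omega> - moved h)" using t True by linarith
  then obtain W where W: "W \<subseteq> \<Omega> - moved h" "card W = t - 2"
    using obtain_subset_with_card_n by metis
  interpret K: perm_group "\<Omega> - W" "stab W H" by (rule perm_group_stab)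
  have ws: "well_separated (\<Omega> - W) (stab W H) k"
    by (rule well_separated_stab[OF t(1-3) _ _ W(2) k]) (use t(4) W(1) in auto)
  have "h \<in> stab W H" using h(1) W(1) unfolding stab_def moved_def by blast
  then show ?thesis by (rule K.card_moved_ge[OF ws _ h(2)])
next
  case False
  with k show ?thesis by linarith
qed

text \<open>If \<open>g\<close> moves the support of \<open>h\<close> to a set meeting it in a single point \<open>x\<close>, the commutator of
  \<open>h\<close> and its conjugate by \<open>g\<close> is the 3-cycle through \<open>x\<close> and its two images.\<close>

lemma three_cycle_from_small_support:
  assumes h: "h \<in> H" "h \<noteq> id" and t: "ktrans \<Omega> H (card (moved h))" and small: "2 * card (moved h) \<le> card \<Omega>"
  obtains x y z where "cycle_of_list [x, y, z] \<in> H" "distinct [x, y, z]" "{x, y, z} \<subseteq> \<Omega>"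
proof -
  define D where "D = moved h"
  have D: "D \<subseteq> \<Omega>" "finite D" using moved_subset finite_moved h by (auto simp: D_def)
  obtain x where x: "x \<in> D" using moved_nonempty[OF h] by (auto simp: D_def moved_def)
  have hD: "w \<in> D \<longleftrightarrow> h w \<noteq> w" for w by (simp add: D_def moved_def)
  obtain rest where rest: "set rest = D - {x}" "distinct rest"
    using finite_distinct_list[of "D - {x}"] D(2) by blast
  have lr: "length rest = card D - 1" using rest x D(2) distinct_card[OF rest(2)] by simp
  have cD: "card D > 0" using x D(2) by (auto simp: card_gt_0_iff)
  \<comment> \<open>There is room outside \<open>D\<close> for the images of \<open>D - {x}\<close>;
    the element \<open>g\<close> will fix \<open>x\<close> and carry the rest of \<open>D\<close>
    there.\<close>
  have "card D - 1 \<le> card (\<Omega> - D)"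
    using card_Diff_subset[OF D(2,1)] small by (simp add: D_def)
  then obtain F where F: "F \<subseteq> \<Omega> - D" "card F = card D - 1" "finite F"
    using obtain_subset_with_card_n fin by (metis finite_Diff finite_subset)
  obtain fr where fr: "set fr = F" "distinct fr" using finite_distinct_list[OF F(3)] by blast
  have lf: "length fr = card D - 1" using fr F(2) distinct_card by metis
  have "\<exists>g\<in>H. map g (x # rest) = x # fr"
  proof (rule t[unfolded ktrans_def, rule_format])
    show "length (x # rest) = card (moved h)" "length (x # fr) = card (moved h)"
      using lr lf cD by (auto simp: D_def)
    show "distinct (x # rest)" "set (x # rest) \<subseteq> \<Omega>" using rest x D(1) by auto
    show "distinct (x # fr)" "set (x # fr) \<subseteq> \<Omega>" using fr F(1) x D(1) by auto
  qed
  then obtain g where g: "g \<in> H" "g x = x" "map g rest = fr" by auto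
  have gD: "g ` (D - {x}) = F" using g(3) rest(1) fr(1) by (metis set_map)
  define k where "k = g \<circ> h \<circ> inv' g"
  have k: "k \<in> H" unfolding k_def using g(1) h(1) comp_in inv_in by blast
  have kmoved: "k w \<noteq> w \<longleftrightarrow> w = x \<or> w \<in> F" for w
  proof -
    have "k w \<noteq> w \<longleftrightarrow> inv' g w \<in> D"
      unfolding k_def hD using g(1) by (auto simp: apply_eq_iff)
    also have "\<dots> \<longleftrightarrow> w \<in> g ` D" using g(1) by (auto intro!: image_eqI[of w g "inv' g w"])
    also have "g ` D = g ` insert x (D - {x})" using x by (simp add: insert_absorb)
    also have "\<dots> = insert x F" by (simp only: image_insert gD g(2))
    finally show ?thesis by blast
  qed
  have kx: "k x \<noteq> x" and hx: "h x \<noteq> x" using kmoved x hD by auto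
  have xF: "x \<notin> F" using F(1) x by blast
  have dis: "w \<notin> F" if "w \<in> D" for w using F(1) that by blast
  have hin: "h w \<in> D \<longleftrightarrow> w \<in> D" "inv' h w \<in> D \<longleftrightarrow> w \<in> D" for w
    unfolding hD using h(1) by (auto simp: apply_eq_iff)
  have kin: "k w = x \<or> k w \<in> F \<longleftrightarrow> w = x \<or> w \<in> F" "inv' k w = x \<or> inv' k w \<in> F \<longleftrightarrow> w = x \<or> w \<in> F" for w
    unfolding kmoved[symmetric] using k by (auto simp: apply_eq_iff)
  have hfix: "h w = w" "inv' h w = w" if "w \<notin> D" for w
    using that hD[of w] h(1) by (auto simp: apply_eq_iff[symmetric])
  have kfix: "k w = w" "inv' k w = w" if "w \<noteq> x" "w \<notin> F" for w
    using that kmoved[of w] k by (auto simp: apply_eq_iff[symmetric])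
  define y where "y = h x"
  define z where "z = k x"
  have y: "y \<in> D" "y \<noteq> x" using hin x hx by (auto simp: y_def)
  have z: "z \<in> F" "z \<noteq> x" using kin(1)[of x] kx by (auto simp: z_def)
  have yz: "y \<noteq> z" using y z dis by blast
  let ?c = "h \<circ> k \<circ> inv' h \<circ> inv' k"
  have cyc: "cycle_of_list [x, y, z] w = (if w = x then y else if w = y then z else if w = z then x else w)" for w
    using y z yz by (auto simp: transpose_def)
  have "?c w = cycle_of_list [x, y, z] w" for w
  proof -
    consider "w = x" | "w = y" | "w = z" | "w \<noteq> x" "w \<noteq> y" "w \<in> D" | "w \<noteq> x" "w \<noteq> z" "w \<in> F"
      | "w \<notin> D" "w \<notin> F" by blast
    then show ?thesis
    proof cases
      case 1
      have "inv' k x \<in> F"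
      proof -
        have "inv' k x \<noteq> x" using kx k by (auto simp: apply_eq_iff[symmetric])
        then show ?thesis using kin(2)[of x] by blast
      qed
      then have "inv' h (inv' k x) = inv' k x" using hfix(2) dis by blast
      then have "?c x = h x" using k by simp
      then show ?thesis unfolding cyc 1 by (simp add: y_def)
    next
      case 2
      have "inv' k y = y" using kfix y dis by blast
      moreover have "inv' h y = x" using h(1) by (simp add: y_def)
      moreover have "h z = z" using hfix dis z by blast
      ultimately have "?c y = z" by (simp add: z_def)
      then show ?thesis unfolding cyc 2 using y yz by simp
    next
      case 3
      have "inv' k z = x" using k by (simp add: z_def)
      moreover have "k (inv' h x) = inv' h x"
      proof (rule kfix(1))
        show "inv' h x \<noteq> x" using hx h(1) by (auto simp: apply_eq_iff[symmetric])
        show "inv' h x \<notin> F" using hin(2)[of x] x dis by blast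
      qed
      ultimately have "?c z = x" using h(1) by simp
      then show ?thesis unfolding cyc 3 using z yz by simp
    next
      case 4
      have "inv' k w = w" using kfix 4 dis by blast
      moreover have "k (inv' h w) = inv' h w"
      proof (rule kfix(1))
        show "inv' h w \<noteq> x" using 4(2) h(1) by (auto simp: y_def)
        show "inv' h w \<notin> F" using hin(2)[of w] 4 dis by blast
      qed
      ultimately have "?c w = w" using h(1) by simp
      moreover have "w \<noteq> z" using 4 z dis by blast
      ultimately show ?thesis unfolding cyc using 4 by simp
    next
      case 5
      have "inv' k w \<noteq> x" using 5(2) k by (auto simp: z_def)
      then have "inv' k w \<in> F" using kin(2)[of w] 5 by blast
      then have "inv' h (inv' k w) = inv' k w" using hfix(2) dis by blast
      moreover have "h w = w" using hfix(1) dis 5 by blast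
      ultimately have "?c w = w" using k by simp
      moreover have "w \<noteq> y" using 5 y dis by blast
      ultimately show ?thesis unfolding cyc using 5 by simp
    next
      case 6
      have "w \<noteq> x" using 6 x by blast
      then have "inv' k w = w" "k w = w" using kfix 6 by blast+
      moreover have "inv' h w = w" "h w = w" using hfix 6 by blast+
      ultimately have "?c w = w" by simp
      moreover have "w \<noteq> y" "w \<noteq> z" using 6 y z by blast+
      ultimately show ?thesis unfolding cyc using \<open>w \<noteq> x\<close> by simp
    qed
  qed
  then have c: "cycle_of_list [x, y, z] = ?c" by (intro ext) simp
  show ?thesis
  proof (rule that)
    show "cycle_of_list [x, y, z] \<in> H" unfolding c by (intro comp_in inv_in h(1) k)
    show "distinct [x, y, z]" using y z yz by auto
    show "{x, y, z} \<subseteq> \<Omega>" using x y z D(1) F(1) by blast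
  qed
qed

end

text \<open>A small support yields one 3-cycle, triple transitivity conjugates it to all of them,
  and these generate the alternating group.\<close>

lemma alt_group_subset:
  assumes H: "perm_group {1..n} H" and h: "h \<in> H" "h \<noteq> id"
    and t: "ktrans {1..n} H (n div 2)" "6 \<le> n" and small: "2 * card (moved h) \<le> n"
  shows "carrier (alt_group n) \<subseteq> H"
proof -
  interpret perm_group "{1..n}" H by (rule H)
  have "ktrans {1..n} H (card (moved h))" by (rule ktrans_mono[OF _ t(1)]) (use small in auto)
  moreover have "2 * card (moved h) \<le> card {1..n}" using small by simp
  ultimately obtain x y z where xyz: "cycle_of_list [x, y, z] \<in> H" "distinct [x, y, z]" "{x, y, z} \<subseteq> {1..n}"
    using three_cycle_from_small_support[OF h] by blast
  have t3: "ktrans {1..n} H 3" by (rule ktrans_mono[OF _ t(1)]) (use t(2) in auto)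
  have three: "three_cycles n \<subseteq> H"
  proof
    fix p assume "p \<in> three_cycles n"
    then obtain cs where cs: "p = cycle_of_list cs" "distinct cs" "length cs = 3" "set cs \<subseteq> {1..n}" by blast
    have "\<exists>g\<in>H. map g [x, y, z] = cs"
      by (rule t3[unfolded ktrans_def, rule_format]) (use xyz(2,3) cs(2-4) in simp_all)
    then obtain g where g: "g \<in> H" "map g [x, y, z] = cs" by blast
    have "g \<circ> cycle_of_list [x, y, z] \<circ> inv' g = p"
      unfolding cs(1) g(2)[symmetric] by (rule conjugation_of_cycle[OF xyz(2) permutes_bij[OF perm[OF g(1)]]])
    moreover have "g \<circ> cycle_of_list [x, y, z] \<circ> inv' g \<in> H" using g(1) xyz(1) comp_in inv_in by blast
    ultimately show "p \<in> H" by simp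
  qed
  have "p \<in> H" if "p \<in> generate (alt_group n) (three_cycles n)" for p
    using that
  proof (induction rule: generate.induct)
    case one
    show ?case unfolding alt_group_one by (rule id_in)
  next
    case (incl p)
    then show ?case using three by blast
  next
    case (inv p)
    have pA: "p \<in> carrier (alt_group n)" using three_cycles_incl inv by blast
    have "p \<in> H" using three inv by blast
    then show ?case unfolding alt_group_inv_equality[OF pA] by (rule inv_in)
  next
    case (eng p q)
    show ?case unfolding alt_group_mult by (rule comp_in[OF eng.IH])
  qed
  then show ?thesis unfolding alt_group_carrier_as_three_cycles by blast
qed

text \<open>The least power of \<open>p\<close> above sqrt n; by minimality it is at most p sqrt
  n.\<close>

lemma exists_prime_power_exponent:
  fixes p n :: nat
  assumes "prime p" "1 \<le> n"
  shows "\<exists>a>0. n < (p ^ a)\<^sup>2 \<and> (p ^ a)\<^sup>2 \<le> p\<^sup>2 * n"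
proof -
  have p2: "2 \<le> p" using assms(1) by (rule prime_ge_2_nat)
  have "n < 2 ^ n" by (rule less_exp)
  also have "\<dots> \<le> p ^ n" using p2 by (rule power_mono) simp
  also have "\<dots> \<le> (p ^ n)\<^sup>2" by (simp add: power2_eq_square)
  finally have ex: "\<exists>a. n < (p ^ a)\<^sup>2" by blast
  define a where "a = (LEAST a. n < (p ^ a)\<^sup>2)"
  have a: "n < (p ^ a)\<^sup>2" unfolding a_def by (rule LeastI_ex[OF ex])
  have a0: "a > 0"
  proof (rule ccontr)
    assume "\<not> a > 0"
    with a assms(2) show False by simp
  qed
  then have "a - 1 < a" by simp
  then have "\<not> n < (p ^ (a - 1))\<^sup>2" unfolding a_def by (rule not_less_Least)
  moreover have "p ^ a = p * p ^ (a - 1)" using a0 by (metis power_Suc Suc_diff_1)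
  ultimately have "(p ^ a)\<^sup>2 \<le> p\<^sup>2 * n" by (simp add: power_mult_distrib)
  with a a0 show ?thesis by blast
qed

lemma exists_last_true:
  fixes a b :: nat
  assumes "Q a" "\<not> Q b" "a \<le> b"
  shows "\<exists>t. a \<le> t \<and> t < b \<and> Q t \<and> \<not> Q (Suc t)"
proof (rule ccontr)
  assume no: "\<not> ?thesis"
  have "Q b" using assms(3)
  proof (induction rule: dec_induct)
    case (step n)
    then show ?case using no by blast
  qed (rule assms(1))
  with assms(2) show False by blast
qed

text \<open>The sum \<open>t0\<close> of 80 prime powers just above sqrt n is O(sqrt n). If
  \<open>H\<close> were \<open>t0\<close>-transitive, \<open>small_support_element\<close> would
  give an \<open>h\<close> moving at most n/80 points. As \<open>H\<close> does not contain the
  alternating group, \<open>alt_group_subset\<close> bounds its transitivity below n div 2, and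
  \<open>min_degree_stab\<close> then forces \<open>h\<close> to move at least n div 40 points, a
  contradiction. So the maximal degree of transitivity is below \<open>t0\<close>. The divisor 40
  leaves room: 16 n/40 + 1 + n/2 is still at most n.\<close>

lemma two_transitive_structure:
  "\<exists>C n0. \<forall>n\<ge>n0. \<forall>H. perm_group {1..n} H \<longrightarrow> ktrans {1..n} H 2 \<longrightarrow> \<not> carrier (alt_group n) \<subseteq> H \<longrightarrow>
     (\<exists>W\<subseteq>{1..n}. real (card W) \<le> C * sqrt (real n) \<and> well_separated ({1..n} - W) (stab W H) (n div 40) \<and>
        (\<forall>h\<in>H. h \<noteq> id \<longrightarrow> n div 40 \<le> card (moved h)))"
proof -
  obtain P :: "nat set" where P: "finite P" "card P = 80" "P \<subseteq> {p. prime p}"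
    using infinite_arbitrarily_large[OF primes_infinite] by blast
  define S where "S = real (\<Sum>p\<in>P. p)"
  \<comment> \<open>The square ensures \<open>4 * t0 <= n\<close>; the summand 100 makes
    \<open>n div 40\<close> exceed n/80.\<close>
  define n0 where "n0 = nat \<lceil>(4 * S)\<^sup>2\<rceil> + 100"
  have S0: "S \<ge> 0" unfolding S_def by (rule of_nat_0_le_iff)
  show ?thesis
  proof (intro exI[of _ S] exI[of _ n0] allI impI)
    fix n H assume n: "n0 \<le> n" and H: "perm_group {1..n} H" and t2: "ktrans {1..n} H 2"
      and nA: "\<not> carrier (alt_group n) \<subseteq> H"
    interpret perm_group "{1..n}" H by (rule H)
    have n100: "100 \<le> n" using n by (simp add: n0_def)
    have "(4 * S)\<^sup>2 \<le> real n" using n by (simp add: n0_def) linarith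
    then have "4 * S \<le> sqrt (real n)" by (rule real_le_rsqrt)
    then have "4 * S * sqrt (real n) \<le> sqrt (real n) * sqrt (real n)" by (rule mult_right_mono) simp
    then have Sn: "4 * (S * sqrt (real n)) \<le> real n" by simp
    have "\<forall>p\<in>P. \<exists>a>0. n < (p ^ a)\<^sup>2 \<and> (p ^ a)\<^sup>2 \<le> p\<^sup>2 * n"
      using exists_prime_power_exponent P(3) n100 by auto
    then obtain a where a: "\<And>p. p \<in> P \<Longrightarrow> 0 < a p \<and> n < (p ^ a p)\<^sup>2 \<and> (p ^ a p)\<^sup>2 \<le> p\<^sup>2 * n" by metis
    define t0 where "t0 = (\<Sum>p\<in>P. p ^ a p)"
    have "real (p ^ a p) \<le> real p * sqrt (real n)" if "p \<in> P" for p
    proof -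
      have "real ((p ^ a p)\<^sup>2) \<le> real (p\<^sup>2 * n)" using a[OF that] by (intro of_nat_mono) blast
      then have "(real (p ^ a p))\<^sup>2 \<le> (real p * sqrt (real n))\<^sup>2" by (simp add: power_mult_distrib)
      then show ?thesis by (rule power2_le_imp_le) simp
    qed
    then have "real t0 \<le> (\<Sum>p\<in>P. real p * sqrt (real n))" unfolding t0_def of_nat_sum by (rule sum_mono)
    also have "\<dots> = S * sqrt (real n)" by (simp add: S_def sum_distrib_right)
    finally have t0: "real t0 \<le> S * sqrt (real n)" .
    with Sn have t0n: "4 * t0 \<le> n" by linarith
    obtain p where p: "p \<in> P" using P(2) by fastforce
    have "n < (p ^ a p)\<^sup>2" using a[OF p] by blast
    moreover have "p ^ a p \<le> t0" unfolding t0_def by (rule member_le_sum[OF p]) (use P(1) in auto)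
    then have "(p ^ a p)\<^sup>2 \<le> t0\<^sup>2" by (rule power_mono) simp
    ultimately have "n < t0\<^sup>2" by linarith
    have t02: "2 \<le> t0"
    proof (rule ccontr)
      assume "\<not> 2 \<le> t0"
      then have "t0\<^sup>2 \<le> 1" using power_mono[of t0 1 2] by simp
      with \<open>n < t0\<^sup>2\<close> n100 show False by simp
    qed
    have not0: "\<not> ktrans {1..n} H t0"
    proof
      assume kt: "ktrans {1..n} H t0"
      have Pp: "prime p \<and> 0 < a p \<and> card {1..n} < (p ^ a p)\<^sup>2" if "p \<in> P" for p
        using a[OF that] P(3) that by auto
      have t0c: "(\<Sum>p\<in>P. p ^ a p) \<le> card {1..n}" using t0n by (simp add: t0_def)
      have Pne: "P \<noteq> {}" using p by blast
      obtain h where h: "h \<in> H" "h \<noteq> id" "80 * card (moved h) \<le> n"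
        using small_support_element[OF P(1) Pne Pp kt[unfolded t0_def] t0c] P(2) by auto
      have n2: "\<not> ktrans {1..n} H (n div 2)"
        using alt_group_subset[OF H h(1,2)] nA n100 h(3) by auto
      have "t0 \<le> n div 2" using t0n by linarith
      then obtain t where t: "t0 \<le> t" "t < n div 2" "ktrans {1..n} H t" "\<not> ktrans {1..n} H (Suc t)"
        using exists_last_true[of "ktrans {1..n} H", OF kt n2] by blast
      have "n div 40 \<le> card (moved h)"
      proof (rule min_degree_stab[OF _ t(3,4) _ _ h(1,2)])
        show "2 \<le> t" using t02 t(1) by simp
        show "2 * t \<le> card {1..n}" "16 * (n div 40) + 1 + t \<le> card {1..n}" using t(2) by simp_all
      qed
      with h(3) n100 show False by linarith
    qed
    obtain t where t: "2 \<le> t" "t < t0" "ktrans {1..n} H t" "\<not> ktrans {1..n} H (Suc t)"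
      using exists_last_true[of "ktrans {1..n} H", OF t2 not0 t02] by blast
    have tn: "2 * t \<le> card {1..n}" "16 * (n div 40) + 1 + t \<le> card {1..n}" using t(2) t0n by simp_all
    have "t - 2 \<le> card {1..n}" using tn by simp
    then obtain W where W: "W \<subseteq> {1..n}" "card W = t - 2" using obtain_subset_with_card_n by metis
    show "\<exists>W\<subseteq>{1..n}. real (card W) \<le> S * sqrt (real n) \<and> well_separated ({1..n} - W) (stab W H) (n div 40) \<and>
        (\<forall>h\<in>H. h \<noteq> id \<longrightarrow> n div 40 \<le> card (moved h))"
    proof (intro exI[of _ W] conjI ballI impI W(1))
      show "real (card W) \<le> S * sqrt (real n)" using W(2) t(2) t0 by simp
      show "well_separated ({1..n} - W) (stab W H) (n div 40)"
        by (rule well_separated_stab[OF t(1,3,4) _ W tn(2)]) (use tn in simp)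
      show "n div 40 \<le> card (moved h)" if "h \<in> H" "h \<noteq> id" for h
        by (rule min_degree_stab[OF t(1,3,4) tn that])
    qed
  qed
qed

subsection \<open>Sizes of conjugacy classes\<close>

lemma exists_permutes_map:
  assumes "length us = length vs" "distinct us" "distinct vs" "set us \<subseteq> \<Omega>" "set vs \<subseteq> \<Omega>"
  shows "\<exists>g. g permutes \<Omega> \<and> map g us = vs"
  using assms
proof (induction us vs rule: rev_induct2)
  case 1
  then show ?case using permutes_id by fastforce
next
  case (4 u us v vs)
  then obtain g where g: "g permutes \<Omega>" "map g us = vs" by auto
  let ?g = "Transposition.transpose (g u) v \<circ> g"
  have gu: "g u \<in> \<Omega>" "v \<in> \<Omega>" using 4(5,6) permutes_in_image[OF g(1), of u] by auto
  have "?g permutes \<Omega>" by (rule permutes_compose[OF g(1) permutes_swap_id[OF gu]])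
  moreover have "?g w = g w" if "w \<in> set us" for w
  proof -
    have "g w \<noteq> g u" using that 4(3) permutes_inj[OF g(1)] by (auto dest: injD)
    moreover have "g w \<noteq> v" using that 4(4) g(2) by auto
    ultimately show ?thesis by simp
  qed
  then have "map ?g (us @ [u]) = vs @ [v]" using g(2) by auto
  ultimately show ?case by blast
qed auto

text \<open>Take \<open>A\<close> of maximum size among the sets disjoint from their image. A moved
  point outside \<open>A\<close>, its image and its preimage could be added, so these three sets
  cover the support.\<close>

lemma exists_displaced_subset:
  assumes h: "h permutes \<Omega>" and fin: "finite \<Omega>"
  shows "\<exists>A\<subseteq>\<Omega>. A \<inter> h ` A = {} \<and> card (moved h) \<le> 3 * card A"
proof -
  define F where "F = {A. A \<subseteq> \<Omega> \<and> A \<inter> h ` A = {}}"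
  have "finite F" unfolding F_def by (rule finite_subset[of _ "Pow \<Omega>"]) (use fin in auto)
  have "{} \<in> F" by (simp add: F_def)
  with \<open>finite F\<close> have "Max (card ` F) \<in> card ` F" by (intro Max_in) auto
  then obtain A where A: "A \<in> F" "Max (card ` F) = card A" by auto
  have max: "card B \<le> card A" if "B \<in> F" for B
    using Max_ge[OF finite_imageI[OF \<open>finite F\<close>]] that unfolding A(2)[symmetric] by blast
  have fA: "finite A" using A(1) fin finite_subset by (auto simp: F_def)
  have "moved h \<subseteq> A \<union> h ` A \<union> inv' h ` A"
  proof
    fix x assume x: "x \<in> moved h"
    show "x \<in> A \<union> h ` A \<union> inv' h ` A"
    proof (rule ccontr)
      assume n: "x \<notin> A \<union> h ` A \<union> inv' h ` A"
      have "h x \<notin> A" using n permutes_inverses(2)[OF h] by (metis UnCI imageI)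
      moreover have "x \<in> \<Omega>" using x h unfolding moved_def permutes_def by blast
      ultimately have "insert x A \<in> F" using A(1) n x by (auto simp: F_def moved_def)
      then have "card (insert x A) \<le> card A" by (rule max)
      with n fA show False by simp
    qed
  qed
  then have "card (moved h) \<le> card (A \<union> h ` A \<union> inv' h ` A)" by (rule card_mono[rotated]) (use fA in simp)
  also have "\<dots> \<le> card A + card (h ` A) + card (inv' h ` A)" by (meson card_Un_le le_trans add_le_mono1)
  also have "\<dots> \<le> 3 * card A" using card_image_le[OF fA, of h] card_image_le[OF fA, of "inv' h"] by simp
  finally show ?thesis using A(1) by (auto simp: F_def)
qed

text \<open>Let \<open>A\<close> be a set of \<open>a\<close> points disjoint from its image under
  \<open>h\<close>. Conjugating by a permutation that fixes \<open>A\<close> pointwise replaces the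
  images of \<open>A\<close> by an arbitrary list of distinct points outside \<open>A\<close>. There
  are (n - a)...(n - 2a + 1) such lists, with n the number of points, and n + 1 - 2a is the smallest
  factor.\<close>

lemma card_conjugates_ge:
  assumes h: "h permutes \<Omega>" and fin: "finite \<Omega>" and a: "3 * a \<le> card (moved h)"
  shows "(card \<Omega> + 1 - 2 * a) ^ a \<le> card {g \<circ> h \<circ> inv' g | g. g permutes \<Omega>}"
proof -
  let ?C = "{g \<circ> h \<circ> inv' g | g. g permutes \<Omega>}"
  obtain A' where A': "A' \<subseteq> \<Omega>" "A' \<inter> h ` A' = {}" "card (moved h) \<le> 3 * card A'"
    using exists_displaced_subset[OF h fin] by blast
  then have "a \<le> card A'" using a by linarith
  then obtain A where A: "A \<subseteq> A'" "card A = a" "finite A"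
    using obtain_subset_with_card_n[of a A'] A'(1) fin finite_subset by (metis subset_trans)
  have AO: "A \<subseteq> \<Omega>" "A \<inter> h ` A = {}" using A(1) A'(1,2) by auto
  obtain xs where xs: "set xs = A" "distinct xs" using finite_distinct_list[OF A(3)] by blast
  have lx: "length xs = a" using xs A(2) distinct_card by metis
  have dx: "distinct (xs @ map h xs)" "set (xs @ map h xs) \<subseteq> \<Omega>"
    using xs AO permutes_in_image[OF h] by (auto simp: distinct_map intro: inj_on_subset[OF permutes_inj[OF h]])
  let ?L = "{zs. length zs = a \<and> distinct zs \<and> set zs \<subseteq> \<Omega> - A}"
  have "finite {g. g permutes \<Omega>}" by (rule finite_permutations[OF fin])
  then have fC: "finite ?C" by (auto simp: setcompr_eq_image)
  have sub: "?L \<subseteq> (\<lambda>f. map f xs) ` ?C"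
  proof
    fix zs assume "zs \<in> ?L"
    then have zs: "length zs = a" "distinct zs" "set zs \<subseteq> \<Omega> - A" by auto
    have "\<exists>g. g permutes \<Omega> \<and> map g (xs @ map h xs) = xs @ zs"
      by (rule exists_permutes_map) (use dx zs xs lx AO in auto)
    then obtain g where g: "g permutes \<Omega>" "map g xs = xs" "map g (map h xs) = zs"
      by (auto simp: append_eq_append_conv)
    have gx: "\<forall>x\<in>set xs. g x = x" using g(2) map_eq_conv[of g xs "\<lambda>x. x"] by simp
    have "(g \<circ> h \<circ> inv' g) x = g (h x)" if "x \<in> set xs" for x
      using gx that permutes_inverses(2)[OF g(1), of x] by (metis comp_apply)
    then have "map (g \<circ> h \<circ> inv' g) xs = zs" using g(3) by auto
    with g(1) show "zs \<in> (\<lambda>f. map f xs) ` ?C" by blast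
  qed
  have cO: "card (\<Omega> - A) = card \<Omega> - a" using AO(1) A by (simp add: card_Diff_subset)
  have "card (moved h) \<le> card \<Omega>"
    using h fin by (intro card_mono) (auto simp: moved_def permutes_def)
  with a have a3: "3 * a \<le> card \<Omega>" by linarith
  have "card ?L = \<Prod>{card (\<Omega> - A) - a + 1..card (\<Omega> - A)}"
    using card_lists_distinct_length_eq[of "\<Omega> - A" a] fin cO a3 by simp
  moreover have "(\<Prod>i\<in>{card (\<Omega> - A) - a + 1..card (\<Omega> - A)}. card \<Omega> + 1 - 2 * a)
      \<le> \<Prod>{card (\<Omega> - A) - a + 1..card (\<Omega> - A)}"
    unfolding cO by (intro prod_mono) auto
  moreover have "(\<Prod>i\<in>{card (\<Omega> - A) - a + 1..card (\<Omega> - A)}. card \<Omega> + 1 - 2 * a) = (card \<Omega> + 1 - 2 * a) ^ a"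
    unfolding cO prod_constant using a3 by simp
  ultimately have "(card \<Omega> + 1 - 2 * a) ^ a \<le> card ?L" by simp
  also have "\<dots> \<le> card ((\<lambda>f. map f xs) ` ?C)" by (rule card_mono[OF finite_imageI[OF fC] sub])
  also have "\<dots> \<le> card ?C" by (rule card_image_le[OF fC])
  finally show ?thesis .
qed

text \<open>With a = m div 4 each factor of the class bound is at least n/2, hence at least sqrt n.
  As a >= m/8 for m >= 8, the class has at least n^(m/16) elements, and the square root gives
  m/32.\<close>

lemma inverse_sqrt_class_le:
  assumes h: "h permutes {1..n}" and m: "8 \<le> card (moved h)"
  shows "1 / sqrt (real (card {g \<circ> h \<circ> inv' g | g. g permutes {1..n}})) \<le> real n powr (- (real (card (moved h)) / 32))"
proof -
  let ?c = "card {g \<circ> h \<circ> inv' g | g. g permutes {1..n}}"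
  define m where "m = card (moved h)"
  define a where "a = m div 4"
  have "moved h \<subseteq> {1..n}" using h unfolding moved_def permutes_def by blast
  then have "card (moved h) \<le> card {1..n}" by (rule card_mono[rotated]) simp
  then have mn: "m \<le> n" by (simp add: m_def)
  have m8: "8 \<le> m" using assms(2) by (simp add: m_def)
  have a: "3 * a \<le> m" "8 * a \<ge> m" "4 * a \<le> n" using m8 mn unfolding a_def by linarith+
  have "(n + 1 - 2 * a) ^ a \<le> ?c"
    using card_conjugates_ge[OF h finite_atLeastAtMost a(1)[unfolded m_def]] by (simp only: card_atLeastAtMost diff_Suc_1)
  then have c: "real (n + 1 - 2 * a) ^ a \<le> real ?c" unfolding of_nat_power[symmetric] by (rule of_nat_mono)
  have n: "n \<ge> 8" using m8 mn by simp
  have "sqrt (real n) \<le> real n / 2"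
  proof (rule real_le_lsqrt)
    have "4 * real n \<le> real n * real n" using n by (intro mult_right_mono) auto
    then show "real n \<le> (real n / 2)\<^sup>2" by (simp add: power2_eq_square)
  qed simp
  also have "\<dots> \<le> real (n + 1 - 2 * a)" using a(3) by simp
  finally have "sqrt (real n) ^ a \<le> real (n + 1 - 2 * a) ^ a" by (rule power_mono) simp
  with c have "sqrt (real n) ^ a \<le> real ?c" by linarith
  then have s: "sqrt (sqrt (real n) ^ a) \<le> sqrt (real ?c)" by (rule real_sqrt_le_mono)
  have "sqrt (sqrt (real n) ^ a) = real n powr (real a / 4)"
    using n by (simp add: powr_half_sqrt[symmetric] powr_powr powr_realpow[symmetric])
  then have "real n powr (real m / 32) \<le> sqrt (sqrt (real n) ^ a)"
    using a(2) n by (simp add: powr_mono)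
  with s have le: "real n powr (real m / 32) \<le> sqrt (real ?c)" by linarith
  have "1 / sqrt (real ?c) \<le> 1 / real n powr (real m / 32)"
    using le n by (intro frac_le) auto
  then show ?thesis by (simp add: powr_minus_divide m_def)
qed

subsection \<open>Bounds for primitive groups\<close>

lemma conj_class_sym_group:
  "conj_class (sym_group n) h = {g \<circ> h \<circ> inv' g | g. g permutes {1..n}}"
proof -
  have "conj_class (sym_group n) h = (\<lambda>g. g \<circ> h \<circ> inv' g) ` {g. g permutes {1..n}}"
    unfolding conj_class_def
    by (rule image_cong) (auto simp: sym_group_carrier sym_group_mult sym_group_inv_equality)
  then show ?thesis by (simp add: setcompr_eq_image)
qed

lemma D_dist_sym_group_le:
  assumes H: "perm_group {1..n} H"
  shows "D_dist (sym_group n) H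
    \<le> (\<Sum>h\<in>H - {id}. 1 / sqrt (real (card {g \<circ> h \<circ> inv' g | g. g permutes {1..n}})))"
proof -
  interpret S: fin_group "sym_group n"
  proof (intro fin_group.intro fin_group_axioms.intro sym_group_is_group)
    have "carrier (sym_group n) = {p. p permutes {1..n}}" by (auto simp: sym_group_carrier)
    then show "finite (carrier (sym_group n))" by (simp add: finite_permutations)
  qed
  have "H \<subseteq> carrier (sym_group n)" using perm_group.perm[OF H] by (auto simp: sym_group_carrier)
  from S.D_dist_le[OF this] show ?thesis by (simp only: sym_group_one conj_class_sym_group)
qed

text \<open>Elements are grouped by the number m of moved points. With 128 colours the exponent is
  |W| + 2m/128 - m/32 = |W| - m/64, at most |W| - k/64. The factor 128 and the number of values of m
  are both at most n, which accounts for the summand 2.\<close>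

lemma D_dist_bound:
  assumes H: "perm_group {1..n} H" and W: "W \<subseteq> {1..n}"
    and ws: "well_separated ({1..n} - W) (stab W H) k"
    and col: "real n ^ 2 * 128 * (1 - 1 / 128\<^sup>2) ^ k < 1" and n: "128 \<le> n" and k: "8 \<le> k"
    and deg: "\<And>h. h \<in> H \<Longrightarrow> h \<noteq> id \<Longrightarrow> k \<le> card (moved h)"
  shows "D_dist (sym_group n) H \<le> real n powr (real (card W) + 2 - real k / 64)"
proof -
  interpret perm_group "{1..n}" H by (rule H)
  let ?f = "\<lambda>h::nat \<Rightarrow> nat. real n powr (- (real (card (moved h)) / 32))"
  let ?e = "real n powr (real (card W) - real k / 64)"
  have "D_dist (sym_group n) H \<le> (\<Sum>h\<in>H - {id}. ?f h)"
    using deg k by (intro order_trans[OF D_dist_sym_group_le[OF H]] sum_mono inverse_sqrt_class_le perm) force+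
  also have "\<dots> = (\<Sum>m\<in>{k..n}. \<Sum>h\<in>{h \<in> H - {id}. card (moved h) = m}. ?f h)"
  proof (rule sum.group[symmetric])
    show "(\<lambda>h. card (moved h)) ` (H - {id}) \<subseteq> {k..n}"
    proof
      fix m assume "m \<in> (\<lambda>h. card (moved h)) ` (H - {id})"
      then obtain h where h: "h \<in> H" "h \<noteq> id" "m = card (moved h)" by auto
      then show "m \<in> {k..n}" using deg card_mono[OF fin moved_subset[OF h(1)]] by simp
    qed
  qed (use finite_H in auto)
  also have "\<dots> \<le> (\<Sum>m\<in>{k..n}. 128 * ?e)"
  proof (rule sum_mono)
    fix m assume m: "m \<in> {k..n}"
    have c: "card {h \<in> H. card (moved h) = m} \<le> 128 * n ^ (card W + 2 * (m div 128))"
      using card_small_support[OF W ws, of 128 m] col n by auto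
    have "(\<Sum>h\<in>{h \<in> H - {id}. card (moved h) = m}. ?f h) \<le> (\<Sum>h\<in>{h \<in> H. card (moved h) = m}. ?f h)"
      using finite_H by (intro sum_mono2) auto
    also have "\<dots> = real (card {h \<in> H. card (moved h) = m}) * real n powr (- (real m / 32))" by simp
    also have "\<dots> \<le> real (128 * n ^ (card W + 2 * (m div 128))) * real n powr (- (real m / 32))"
      using c by (intro mult_right_mono of_nat_mono) auto
    also have "\<dots> = 128 * real n powr (real (card W + 2 * (m div 128)) + - (real m / 32))"
      unfolding powr_add using n by (simp add: powr_realpow[symmetric])
    also have "\<dots> \<le> 128 * ?e"
    proof (intro mult_left_mono powr_mono)
      have "real (128 * (m div 128)) \<le> real m" by (rule of_nat_mono) simp
      then have "real (m div 128) \<le> real m / 128" by simp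
      with m show "real (card W + 2 * (m div 128)) + - (real m / 32) \<le> real (card W) - real k / 64" by simp
    qed (use n in auto)
    finally show "(\<Sum>h\<in>{h \<in> H - {id}. card (moved h) = m}. ?f h) \<le> 128 * ?e" .
  qed
  also have "\<dots> = real (card {k..n}) * (128 * ?e)" by simp
  also have "\<dots> \<le> real n * (real n * ?e)"
    using n k by (intro mult_mono) auto
  also have "\<dots> = real n powr (real (card W) + 2 - real k / 64)"
  proof -
    have "real (card W) + 2 - real k / 64 = 1 + (1 + (real (card W) - real k / 64))" by simp
    then show ?thesis using n by (simp only: powr_add) simp
  qed
  finally show ?thesis .
qed

section \<open>From subgroups of the symmetric group to the final estimate\<close>

lemma perm_group_subgroup:
  assumes "subgroup H (sym_group n)"
  shows "perm_group {1..n} H"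
proof -
  interpret subgroup H "sym_group n" by (rule assms)
  have p: "h permutes {1..n}" if "h \<in> H" for h using mem_carrier[OF that] by (simp add: sym_group_carrier)
  show ?thesis
  proof
    show "id \<in> H" using one_closed by (simp add: sym_group_one)
    show "g \<circ> h \<in> H" if "g \<in> H" "h \<in> H" for g h using m_closed[OF that] by (simp add: sym_group_mult)
    show "inv' h \<in> H" if "h \<in> H" for h
      using m_inv_closed[OF that] sym_group_inv_equality[OF mem_carrier[OF that]] by simp
  qed (use p in auto)
qed

text \<open>The classes of an invariant equivalence relation form a block system; the two trivial
  systems correspond to the two trivial relations.\<close>

lemma primitive_group_primitive_subgroup:
  assumes H: "primitive_subgroup n H"
  shows "primitive_group {1..n} H"
proof -
  interpret perm_group "{1..n}" H using H by (intro perm_group_subgroup) (simp add: primitive_subgroup_def)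
  show ?thesis
  proof
    show "\<exists>h\<in>H. h x = y" if "x \<in> {1..n}" "y \<in> {1..n}" for x y
      using H that by (simp add: primitive_subgroup_def transitive_on_points_def)
    fix r :: "(nat \<times> nat) set"
    assume r: "equiv {1..n} r" and inv: "\<And>x y g. (x, y) \<in> r \<Longrightarrow> g \<in> H \<Longrightarrow> (g x, g y) \<in> r"
    have rs: "r \<subseteq> {1..n} \<times> {1..n}" using r by (rule equiv_type)
    have "block_system n H ({1..n} // r)"
      unfolding block_system_def
    proof (intro conjI ballI)
      show "partition_on {1..n} ({1..n} // r)" using r by (rule partition_on_quotient)
      fix h B assume h: "h \<in> H" and "B \<in> {1..n} // r"
      then obtain x where x: "x \<in> {1..n}" "B = r `` {x}" by (auto elim: quotientE)
      have "h ` B = r `` {h x}"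
      proof
        show "h ` B \<subseteq> r `` {h x}" using inv h x by auto
        show "r `` {h x} \<subseteq> h ` B"
        proof
          fix y assume "y \<in> r `` {h x}"
          then have "(inv' h (h x), inv' h y) \<in> r" using inv inv_in[OF h] by blast
          then have "inv' h y \<in> B" using h x(2) by simp
          then have "h (inv' h y) \<in> h ` B" by (rule imageI)
          then show "y \<in> h ` B" using h by simp
        qed
      qed
      moreover have "h x \<in> {1..n}" using in_iff[OF h] x(1) by blast
      ultimately show "h ` B \<in> {1..n} // r" by (simp add: quotientI)
    qed
    with H have c: "{1..n} // r = {{1..n}} \<or> {1..n} // r = (\<lambda>x. {x}) ` {1..n}"
      by (simp add: primitive_subgroup_def)
    have q: "r `` {x} \<in> {1..n} // r" "x \<in> r `` {x}" if "x \<in> {1..n}" for x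
      using that equiv_class_self[OF r that] by (auto intro: quotientI)
    from c show "r = Id_on {1..n} \<or> r = {1..n} \<times> {1..n}"
    proof
      assume "{1..n} // r = {{1..n}}"
      then have "r `` {x} = {1..n}" if "x \<in> {1..n}" for x using q(1)[OF that] by simp
      then show ?thesis using rs by blast
    next
      assume a: "{1..n} // r = (\<lambda>x. {x}) ` {1..n}"
      have "r `` {x} = {x}" if x: "x \<in> {1..n}" for x
      proof -
        obtain z where "r `` {x} = {z}" using q(1)[OF x] unfolding a by blast
        with q(2)[OF x] show ?thesis by simp
      qed
      then have "(SIGMA x:{1..n}. r `` {x}) = (SIGMA x:{1..n}. {x})" by (intro Sigma_cong) auto
      moreover have "r = (SIGMA x:{1..n}. r `` {x})" using rs by blast
      ultimately have "r = Id_on {1..n}" unfolding Id_on_def by auto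
      then show ?thesis by blast
    qed
  qed
qed

text \<open>One odd element \<open>s\<close> of \<open>H\<close> suffices: for every odd
  \<open>p\<close> the product of \<open>p\<close> with the inverse of \<open>s\<close> is
  even.\<close>

lemma alt_group_subset_imp:
  assumes H: "perm_group {1..n} H" and A: "carrier (alt_group n) \<subseteq> H"
  shows "H = carrier (alt_group n) \<or> H = carrier (sym_group n)"
proof (cases "H \<subseteq> carrier (alt_group n)")
  case False
  interpret perm_group "{1..n}" H by (rule H)
  obtain s where s1: "s \<in> H" "s \<notin> carrier (alt_group n)" using False by blast
  then have s: "s \<in> H" "\<not> evenperm s" using perm[OF s1(1)] unfolding alt_group_carrier by blast+
  have ps: "permutation s" using perm[OF s(1)] permutation_permutes by blast
  have "p \<in> H" if p: "p permutes {1..n}" for p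
  proof (cases "evenperm p")
    case True
    then show ?thesis using A p by (auto simp: alt_group_carrier)
  next
    case f: False
    have pp: "permutation p" using p permutation_permutes by blast
    have "evenperm (p \<circ> inv' s)"
      using evenperm_comp[OF pp permutation_inverse[OF ps]] evenperm_inv[OF ps] f s(2) by simp
    moreover have "(p \<circ> inv' s) permutes {1..n}" by (rule permutes_compose[OF permutes_inv[OF perm[OF s(1)]] p])
    ultimately have "p \<circ> inv' s \<in> H" using A by (auto simp: alt_group_carrier)
    then have "(p \<circ> inv' s) \<circ> s \<in> H" using s(1) by (rule comp_in)
    moreover have "(p \<circ> inv' s) \<circ> s = p" using s(1) by (auto simp: fun_eq_iff)
    ultimately show ?thesis by simp
  qed
  then show ?thesis using perm by (auto simp: sym_group_carrier)
qed (use A in blast)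

text \<open>In the uniprimitive case k is about sqrt(n/8), above sqrt n / 3, so the exponent is
  about -sqrt n / 192; the constant 1/1000 absorbs the additive terms. In the doubly transitive case
  -n/2560 outweighs the cost C sqrt n of the fixed points.\<close>

lemma D_dist_primitive_le:
  "\<exists>n0. \<forall>n\<ge>n0. \<forall>H. primitive_subgroup n H \<longrightarrow> H \<noteq> carrier (alt_group n) \<longrightarrow> H \<noteq> carrier (sym_group n) \<longrightarrow>
     D_dist (sym_group n) H \<le> real n powr (- (1 / 1000 * sqrt (real n)))"
proof -
  obtain C n1 where C: "\<And>n H. n1 \<le> n \<Longrightarrow> perm_group {1..n} H \<Longrightarrow> ktrans {1..n} H 2 \<Longrightarrow>
      \<not> carrier (alt_group n) \<subseteq> H \<Longrightarrow>
     \<exists>W\<subseteq>{1..n}. real (card W) \<le> C * sqrt (real n) \<and> well_separated ({1..n} - W) (stab W H) (n div 40) \<and>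
        (\<forall>h\<in>H. h \<noteq> id \<longrightarrow> n div 40 \<le> card (moved h))"
    using two_transitive_structure by metis
  have "\<forall>\<^sub>F n::nat in sequentially. real n ^ 2 * 128 * (1 - 1 / 128\<^sup>2) powr (sqrt (real n) / 3 - 1) < 1"
    by real_asymp
  moreover have "\<forall>\<^sub>F n::nat in sequentially. 2 - (sqrt (real n) / 3 - 1) / 64 \<le> - (1 / 1000 * sqrt (real n))"
    by real_asymp
  moreover have "\<forall>\<^sub>F n::nat in sequentially. C * sqrt (real n) + 2 - (real n / 40 - 1) / 64 \<le> - (1 / 1000 * sqrt (real n))"
    by real_asymp
  moreover have "\<forall>\<^sub>F n::nat in sequentially. sqrt (real n) / 3 \<le> real n / 40" by real_asymp
  moreover have "\<forall>\<^sub>F n::nat in sequentially. 9 \<le> sqrt (real n) / 3" by real_asymp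
  moreover have "\<forall>\<^sub>F n::nat in sequentially. n1 + 128 \<le> n" by (rule eventually_ge_at_top)
  ultimately have "\<forall>\<^sub>F n::nat in sequentially. \<forall>H. primitive_subgroup n H \<longrightarrow> H \<noteq> carrier (alt_group n) \<longrightarrow>
     H \<noteq> carrier (sym_group n) \<longrightarrow> D_dist (sym_group n) H \<le> real n powr (- (1 / 1000 * sqrt (real n)))"
  proof eventually_elim
    case (elim n)
    show ?case
    proof (intro allI impI)
      fix H assume H: "primitive_subgroup n H" "H \<noteq> carrier (alt_group n)" "H \<noteq> carrier (sym_group n)"
      interpret primitive_group "{1..n}" H by (rule primitive_group_primitive_subgroup[OF H(1)])
      have pg: "perm_group {1..n} H" by (rule perm_group_axioms)
      have col: "real n ^ 2 * 128 * (1 - 1 / 128\<^sup>2) ^ k < 1" if k: "sqrt (real n) / 3 - 1 \<le> real k" for k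
      proof -
        have "(1 - 1 / 128\<^sup>2 :: real) ^ k = (1 - 1 / 128\<^sup>2) powr real k" by (simp add: powr_realpow)
        also have "\<dots> \<le> (1 - 1 / 128\<^sup>2) powr (sqrt (real n) / 3 - 1)" using k by (intro powr_mono') auto
        finally have "real n ^ 2 * 128 * (1 - 1 / 128\<^sup>2) ^ k
            \<le> real n ^ 2 * 128 * (1 - 1 / 128\<^sup>2) powr (sqrt (real n) / 3 - 1)" by (rule mult_left_mono) simp
        with elim(1) show ?thesis by linarith
      qed
      have n128: "128 \<le> n" using elim by simp
      show "D_dist (sym_group n) H \<le> real n powr (- (1 / 1000 * sqrt (real n)))"
      proof (cases "ktrans {1..n} H 2")
        case False
        define k where "k = nat \<lfloor>sqrt (real n / 8)\<rfloor>"
        have "real k \<le> sqrt (real n / 8)" unfolding k_def by simp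
        then have "(real k)\<^sup>2 \<le> (sqrt (real n / 8))\<^sup>2" by (rule power_mono) simp
        then have "(real k)\<^sup>2 \<le> real n / 8" by simp
        then have "real (8 * k\<^sup>2) \<le> real n" by simp
        then have "8 * k\<^sup>2 \<le> card {1..n}" by (simp only: of_nat_le_iff card_atLeastAtMost diff_Suc_1)
        then have ws: "well_separated {1..n} H k" by (rule well_separated_uniprimitive[OF False])
        have "sqrt (real n) / 3 \<le> sqrt (real n / 8)"
          by (rule real_le_rsqrt) (simp add: power_divide)
        moreover have "sqrt (real n / 8) - 1 \<le> real k" unfolding k_def by linarith
        ultimately have kl: "sqrt (real n) / 3 - 1 \<le> real k" by linarith
        have k8: "8 \<le> k" using kl elim(5) by linarith
        have "stab {} H = H" by (simp add: stab_def)
        with ws have "well_separated ({1..n} - {}) (stab {} H) k" by simp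
        then have "D_dist (sym_group n) H \<le> real n powr (real (card ({} :: nat set)) + 2 - real k / 64)"
          by (rule D_dist_bound[OF pg empty_subsetI _ col[OF kl] n128 k8]) (rule card_moved_ge[OF ws])
        also have "\<dots> \<le> real n powr (- (1 / 1000 * sqrt (real n)))"
        proof (rule powr_mono)
          have "real k / 64 \<ge> (sqrt (real n) / 3 - 1) / 64" using kl by (rule divide_right_mono) simp
          with elim(2) show "real (card ({} :: nat set)) + 2 - real k / 64 \<le> - (1 / 1000 * sqrt (real n))"
            unfolding card.empty of_nat_0 by linarith
        qed (use n128 in simp)
        finally show ?thesis .
      next
        case True
        have nA: "\<not> carrier (alt_group n) \<subseteq> H" using alt_group_subset_imp[OF pg] H(2,3) by blast
        obtain W where W: "W \<subseteq> {1..n}" "real (card W) \<le> C * sqrt (real n)"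
          "well_separated ({1..n} - W) (stab W H) (n div 40)" "\<And>h. h \<in> H \<Longrightarrow> h \<noteq> id \<Longrightarrow> n div 40 \<le> card (moved h)"
          using C[OF _ pg True nA] elim(6) by auto
        have kl': "real n / 40 - 1 \<le> real (n div 40)" by linarith
        then have kl: "sqrt (real n) / 3 - 1 \<le> real (n div 40)" using elim(4) by linarith
        have k8: "8 \<le> n div 40" using kl elim(5) by linarith
        have "D_dist (sym_group n) H \<le> real n powr (real (card W) + 2 - real (n div 40) / 64)"
          by (rule D_dist_bound[OF pg W(1,3) col[OF kl] n128 k8 W(4)])
        also have "\<dots> \<le> real n powr (- (1 / 1000 * sqrt (real n)))"
        proof (rule powr_mono)
          have "real (n div 40) / 64 \<ge> (real n / 40 - 1) / 64" using kl' by (rule divide_right_mono) simp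
          with elim(3) W(2) show "real (card W) + 2 - real (n div 40) / 64 \<le> - (1 / 1000 * sqrt (real n))" by linarith
        qed (use n128 in simp)
        finally show ?thesis .
      qed
    qed
  qed
  then show ?thesis by (simp add: eventually_sequentially)
qed

text \<open>Only finitely many pairs have bounded degree, so an infinite family contains members of
  arbitrarily large degree; this is how infinitude of the family enters.\<close>

lemma exists_large_degree:
  fixes F :: "((nat \<Rightarrow> nat) monoid \<times> (nat \<Rightarrow> nat) set) set"
  assumes F: "infinite F" and P: "\<forall>(G, H)\<in>F. \<exists>n. G = sym_group n \<and> primitive_subgroup n H \<and> R n H"
  shows "\<exists>n H. N < n \<and> (sym_group n, H) \<in> F \<and> primitive_subgroup n H \<and> R n H"
proof (rule ccontr)
  assume no: "\<not> ?thesis"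
  have "F \<subseteq> (\<Union>n\<le>N. {sym_group n} \<times> Pow (carrier (sym_group n)))"
  proof
    fix p assume p: "p \<in> F"
    obtain G H where GH: "p = (G, H)" by force
    then obtain n where n: "G = sym_group n" "primitive_subgroup n H" "R n H" using P p by blast
    then have "n \<le> N" using no p GH by (metis not_less)
    moreover have "H \<subseteq> carrier (sym_group n)"
      using n(2) by (simp add: primitive_subgroup_def subgroup.subset)
    ultimately show "p \<in> (\<Union>n\<le>N. {sym_group n} \<times> Pow (carrier (sym_group n)))" using GH n(1) by blast
  qed
  moreover have "finite (carrier (sym_group n))" for n
    using finite_permutations[of "{1..n}"] by (simp add: sym_group_def)
  ultimately show False using F finite_subset by (metis (no_types, lifting) finite_Pow_iff finite_SigmaI finite_UN_I finite_atMost finite.intros)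
qed

theorem theorem5:
  shows "(\<forall>F :: ((nat \<Rightarrow> nat) monoid \<times> (nat \<Rightarrow> nat) set) set.
            infinite F \<longrightarrow>
            (\<forall>(G, H)\<in>F. \<exists>n. G = sym_group n \<and> primitive_subgroup n H \<and>
               H \<noteq> carrier (alt_group n) \<and> H \<noteq> carrier (sym_group n)) \<longrightarrow>
            indistinguishable F)
       \<and> (\<exists>\<epsilon>>0. \<exists>n0. \<forall>n\<ge>n0. \<forall>H.
            primitive_subgroup n H \<longrightarrow>
            H \<noteq> carrier (alt_group n) \<longrightarrow> H \<noteq> carrier (sym_group n) \<longrightarrow>
            D_dist (sym_group n) H \<le> real n powr (- (\<epsilon> * sqrt (real n))))"
proof (intro conjI allI impI notI)
  show "\<exists>\<epsilon>>0. \<exists>n0. \<forall>n\<ge>n0. \<forall>H.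
            primitive_subgroup n H \<longrightarrow>
            H \<noteq> carrier (alt_group n) \<longrightarrow> H \<noteq> carrier (sym_group n) \<longrightarrow>
            D_dist (sym_group n) H \<le> real n powr (- (\<epsilon> * sqrt (real n)))"
    using D_dist_primitive_le by (intro exI[of _ "1 / 1000"]) simp
next
  fix F :: "((nat \<Rightarrow> nat) monoid \<times> (nat \<Rightarrow> nat) set) set"
  assume F: "infinite F" and P: "\<forall>(G, H)\<in>F. \<exists>n. G = sym_group n \<and> primitive_subgroup n H \<and>
               H \<noteq> carrier (alt_group n) \<and> H \<noteq> carrier (sym_group n)"
    and "distinguishable F"
  then obtain c where c: "\<And>G H. (G, H) \<in> F \<Longrightarrow> D_dist G H \<ge> ln (real (Coset.order G)) powr (- c)"
    unfolding distinguishable_def by blast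
  obtain n0 where n0: "\<And>n H. n0 \<le> n \<Longrightarrow> primitive_subgroup n H \<Longrightarrow> H \<noteq> carrier (alt_group n) \<Longrightarrow>
      H \<noteq> carrier (sym_group n) \<Longrightarrow> D_dist (sym_group n) H \<le> real n powr (- (1 / 1000 * sqrt (real n)))"
    using D_dist_primitive_le by blast
  \<comment> \<open>Since ln(n!) is at most n^2, distinguishability would force
    \<open>D_dist\<close> to be at least n^(-2|c|); this compares the two exponents.\<close>
  have "\<forall>\<^sub>F n::nat in sequentially. 2 * \<bar>c\<bar> < 1 / 1000 * sqrt (real n)" by real_asymp
  then obtain n1 where n1: "\<And>n. n1 \<le> n \<Longrightarrow> 2 * \<bar>c\<bar> < 1 / 1000 * sqrt (real n)"
    by (auto simp: eventually_sequentially)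
  obtain n H where nH: "n0 + n1 + 3 < n" "(sym_group n, H) \<in> F" "primitive_subgroup n H"
    "H \<noteq> carrier (alt_group n)" "H \<noteq> carrier (sym_group n)"
    using exists_large_degree[OF F P, of "n0 + n1 + 3"] by blast
  define l where "l = ln (real (fact n))"
  \<comment> \<open>From n > 3 follows ln(n!) >= 1, so its powers increase with the exponent and
    \<open>c\<close>, of either sign, may be replaced by its absolute value.\<close>
  have "fact 3 \<le> (fact n :: real)" by (rule fact_mono) (use nH(1) in simp)
  then have "3 \<le> real (fact n)" by (simp add: fact_numeral)
  with exp_le have "exp 1 \<le> real (fact n)" by (rule order_trans)
  then have l1: "1 \<le> l" unfolding l_def by (subst ln_ge_iff) auto
  have "real (fact n) \<le> real n ^ n" using fact_le_power[where 'a = real and n = n] by simp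
  then have "l \<le> ln (real n ^ n)" unfolding l_def using nH(1) by (subst ln_le_cancel_iff) auto
  also have "\<dots> = real n * ln (real n)" using nH(1) by (simp add: ln_realpow)
  also have "\<dots> \<le> real n * real n" using ln_bound[of "real n"] nH(1) by (intro mult_left_mono) auto
  finally have l2: "l \<le> real n powr 2" using nH(1) by (simp add: powr_numeral power2_eq_square)
  have "real n powr (- (1 / 1000 * sqrt (real n))) < real n powr (- (2 * \<bar>c\<bar>))"
    using n1[of n] nH(1) by (intro powr_less_mono) auto
  also have "\<dots> = (real n powr 2) powr (- \<bar>c\<bar>)" by (simp only: powr_powr mult_minus_right)
  also have "\<dots> \<le> l powr (- \<bar>c\<bar>)" using l1 l2 by (intro powr_mono2') auto
  also have "\<dots> \<le> l powr (- c)" using l1 by (intro powr_mono) auto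
  also have "l = ln (real (Coset.order (sym_group n)))"
    unfolding l_def Coset.order_def sym_group_card_carrier by simp
  also have "ln (real (Coset.order (sym_group n))) powr (- c) \<le> D_dist (sym_group n) H" by (rule c[OF nH(2)])
  also have "\<dots> \<le> real n powr (- (1 / 1000 * sqrt (real n)))" by (rule n0) (use nH in auto)
  finally show False by simp
qed

end
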